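(* Let $H$ be a densely defined, self-adjoint, nonnegative operator on a Hilbert space $\mathcal H$. Let $f,g$ be bounded positive continuous functions on $[0,\infty)$ such that for any $\lambda\ge0$ there exists a constant $c>0$ with $g(t)(t-\lambda)\ge c$ on $[\lambda+1,\infty)$. Fix $\lambda\ge0$ and a small positive number $\delta$ with $0<\delta<c_0$, where $c_0=\max(\sup f,\sup g)$. If $\mathrm{dist}(\lambda,\sigma(H))<\delta/c_0$, then there exists a sequence $\{\psi_j\}_{j\in\mathbb N}\subset\mathrm{Dom}(H)$ (the $\psi_j$ could all be identical) such that (1) $\|\psi_j\|=1$ for all $j$; (2) $|(f(H)(H-\lambda)\psi_j,(H-\lambda)\psi_j)|\le\delta$ for all $j$; and (3) $|(g(H)\psi_j,(H-\lambda)\psi_j)|\le\delta$ for all $j$. If $\mathrm{dist}(\lambda,\sigma_{\mathrm{ess}}(H))<\delta/c_0$, then such a sequence exists satisfying in addition (4) $\psi_j\to0$ weakly in $\mathcal H$ as $j\to\infty$. Conversely, if properties (1), (2), (3) hold for a sequence $\{\psi_j\}_{j\in\mathbb N}\subset\mathrm{Dom}(H)$, then \[ \mathrm{dist}(\lambda,\sigma(H))\le\left(\frac{c_1(\lambda)+c_2(\lambda)+c_3(\lambda)}{c_1(\lambda)\,c_2(\lambda)}\right)^{1/3}\delta^{1/3} \] in the case $\lambda>0$, and \[ \mathrm{dist}(\lambda,\sigma(H))\le\frac{\delta}{c_2(\lambda)} \] in the case $\lambda=0$. If the $\{\psi_j\}$ also satisfy (4), then the same upper bound holds for $\mathrm{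dist}(\lambda,\sigma_{\mathrm{ess}}(H))$.
   Context: $\sigma(H)$ and $\sigma_{\mathrm{ess}}(H)$ are the spectrum and essential spectrum of $H$; $\mathrm{Dom}(H)$ its domain; $f(H),g(H)$ are defined by the functional calculus; $(\cdot,\cdot)$ and $\|\cdot\|$ are the inner product and norm of $\mathcal H$. The constants are \[ c_1(\lambda)=\inf_{t\in[0,\lambda]}f(t),\quad c_2(\lambda)=\min\Big(\inf_{t\in[\lambda,\lambda+1]}g(t),\ \inf_{t\in[\lambda+1,\infty)}g(t)(t-\lambda)\Big),\quad c_3(\lambda)=\lambda\sup_{t\in[0,\lambda]}g(t). \]
   Formalization: In the converse, "small" δ means 0<δ<c_0 and δ<δ_0 for some δ_0>0 depending only on f, g, λ (not on H or the sequence); with only 0<δ<c_0 the converse bounds can fail. The forward parts hold for all 0<δ<c_0. *)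

theory Defs
  imports "HOL-Analysis.Analysis"
begin

text \<open>Complex Hilbert spaces. The library's real Hilbert space structure supplies the norm, the
  topology and completeness; the complex inner product is linear in its first argument, and its real
  part is the real inner product of the library.\<close>

class complex_hilbert = real_inner + complete_space +
  fixes scaleC :: "complex \<Rightarrow> 'a \<Rightarrow> 'a"  (infixr "*\<^sub>C" 75)
    and cinner :: "'a \<Rightarrow> 'a \<Rightarrow> complex"
  assumes scaleC_add_right: "c *\<^sub>C (x + y) = c *\<^sub>C x + c *\<^sub>C y"
    and scaleC_add_left: "(c + d) *\<^sub>C x = c *\<^sub>C x + d *\<^sub>C x"
    and scaleC_scaleC: "c *\<^sub>C d *\<^sub>C x = (c * d) *\<^sub>C x"
    and scaleR_scaleC: "r *\<^sub>R x = complex_of_real r *\<^sub>C x"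
    and cinner_commute: "cinner x y = cnj (cinner y x)"
    and cinner_add_left: "cinner (x + y) z = cinner x z + cinner y z"
    and cinner_scaleC_left: "cinner (c *\<^sub>C x) y = c * cinner x y"
    and inner_eq_Re_cinner: "inner x y = Re (cinner x y)"

text \<open>An unbounded operator is given by its domain \<open>D\<close> and a total function \<open>H\<close>; only the
  values of \<open>H\<close> on \<open>D\<close> are ever used.\<close>

definition clinear_on :: "'h::complex_hilbert set \<Rightarrow> ('h \<Rightarrow> 'h) \<Rightarrow> bool" where
  "clinear_on D H \<longleftrightarrow>
     0 \<in> D \<and>
     (\<forall>x\<in>D. \<forall>y\<in>D. x + y \<in> D \<and> H (x + y) = H x + H y) \<and>
     (\<forall>c. \<forall>x\<in>D. c *\<^sub>C x \<in> D \<and> H (c *\<^sub>C x) = c *\<^sub>C H x)"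

definition densely_defined :: "'h::complex_hilbert set \<Rightarrow> bool" where
  "densely_defined D \<longleftrightarrow> closure D = UNIV"

definition adjoint_dom :: "'h::complex_hilbert set \<Rightarrow> ('h \<Rightarrow> 'h) \<Rightarrow> 'h set" where
  "adjoint_dom D H = {y. \<exists>z. \<forall>x\<in>D. cinner (H x) y = cinner x z}"

definition adjoint_op :: "'h::complex_hilbert set \<Rightarrow> ('h \<Rightarrow> 'h) \<Rightarrow> 'h \<Rightarrow> 'h" where
  "adjoint_op D H y = (THE z. \<forall>x\<in>D. cinner (H x) y = cinner x z)"

definition self_adjoint_op :: "'h::complex_hilbert set \<Rightarrow> ('h \<Rightarrow> 'h) \<Rightarrow> bool" where
  "self_adjoint_op D H \<longleftrightarrow>
     clinear_on D H \<and> densely_defined D \<and>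
     adjoint_dom D H = D \<and> (\<forall>y\<in>D. adjoint_op D H y = H y)"

text \<open>For self-adjoint \<open>H\<close> the number \<open>cinner (H x) x\<close> is real, so taking the real part
  loses nothing.\<close>

definition nonneg_op :: "'h::complex_hilbert set \<Rightarrow> ('h \<Rightarrow> 'h) \<Rightarrow> bool" where
  "nonneg_op D H \<longleftrightarrow> (\<forall>x\<in>D. 0 \<le> Re (cinner (H x) x))"

definition resolvent_op :: "'h::complex_hilbert set \<Rightarrow> ('h \<Rightarrow> 'h) \<Rightarrow> complex \<Rightarrow> 'h \<Rightarrow> 'h" where
  "resolvent_op D H z = inv_into D (\<lambda>x. H x - z *\<^sub>C x)"

definition spectrum_op :: "'h::complex_hilbert set \<Rightarrow> ('h \<Rightarrow> 'h) \<Rightarrow> complex set" where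
  "spectrum_op D H =
     - {z. bij_betw (\<lambda>x. H x - z *\<^sub>C x) D UNIV \<and> bounded_linear (resolvent_op D H z)}"

definition eigenspace_op :: "'h::complex_hilbert set \<Rightarrow> ('h \<Rightarrow> 'h) \<Rightarrow> complex \<Rightarrow> 'h set" where
  "eigenspace_op D H z = {x\<in>D. H x = z *\<^sub>C x}"

definition finite_cdim :: "'h::complex_hilbert set \<Rightarrow> bool" where
  "finite_cdim E \<longleftrightarrow> (\<exists>B. finite B \<and> (\<forall>x\<in>E. \<exists>c. x = (\<Sum>b\<in>B. c b *\<^sub>C b)))"

text \<open>The discrete spectrum consists of the isolated points of the spectrum that are eigenvalues of
  finite multiplicity; the essential spectrum is the rest of the spectrum.\<close>

definition discrete_spectrum_op :: "'h::complex_hilbert set \<Rightarrow> ('h \<Rightarrow> 'h) \<Rightarrow> complex set" where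
  "discrete_spectrum_op D H =
     {z. z isolated_in spectrum_op D H \<and>
         eigenspace_op D H z \<noteq> {0} \<and> finite_cdim (eigenspace_op D H z)}"

definition ess_spectrum_op :: "'h::complex_hilbert set \<Rightarrow> ('h \<Rightarrow> 'h) \<Rightarrow> complex set" where
  "ess_spectrum_op D H = spectrum_op D H - discrete_spectrum_op D H"

text \<open>Distance to a set, with value \<open>\<infinity>\<close> on the empty set; the library's \<open>infdist\<close> and
  \<open>setdist\<close> are \<open>0\<close> there, which would be wrong when the essential spectrum is empty.\<close>

definition edist_set :: "complex \<Rightarrow> complex set \<Rightarrow> ereal" where
  "edist_set z S = (INF s\<in>S. ereal (dist z s))"

text \<open>The functional calculus of a nonnegative self-adjoint operator, on the bounded continuous
  functions on \<open>[0,\<infinity>)\<close>: the unital *-homomorphism into the bounded operators that sends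
  \<open>1 / (t - z)\<close> to the resolvent at \<open>z\<close>. It is unique: *-homomorphisms are contractive, so by
  Stone--Weierstrass it is determined on the functions \<open>u\<close> vanishing at infinity, and then on all
  \<open>u\<close>, because \<open>\<Phi> u\<close> composed with the resolvent at \<open>-1\<close> is \<open>\<Phi>\<close> of \<open>u t / (t + 1)\<close>, and
  the range of that resolvent is dense. Functions are total on the reals, so independence of the
  values at negative arguments is required explicitly.\<close>

definition bcont_nonneg :: "(real \<Rightarrow> complex) set" where
  "bcont_nonneg = {u. continuous_on {0..} u \<and> bounded (u ` {0..})}"

definition is_functional_calculus ::
    "'h::complex_hilbert set \<Rightarrow> ('h \<Rightarrow> 'h) \<Rightarrow> ((real \<Rightarrow> complex) \<Rightarrow> 'h \<Rightarrow> 'h) \<Rightarrow> bool" where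
  "is_functional_calculus D H \<Phi> \<longleftrightarrow>
     (\<forall>u\<in>bcont_nonneg. bounded_linear (\<Phi> u) \<and> (\<forall>c x. \<Phi> u (c *\<^sub>C x) = c *\<^sub>C \<Phi> u x)) \<and>
     (\<forall>u\<in>bcont_nonneg. \<forall>v\<in>bcont_nonneg. (\<forall>t\<ge>0. u t = v t) \<longrightarrow> \<Phi> u = \<Phi> v) \<and>
     (\<forall>u\<in>bcont_nonneg. \<forall>v\<in>bcont_nonneg. \<forall>x. \<Phi> (\<lambda>t. u t + v t) x = \<Phi> u x + \<Phi> v x) \<and>
     (\<forall>c. \<forall>u\<in>bcont_nonneg. \<forall>x. \<Phi> (\<lambda>t. c * u t) x = c *\<^sub>C \<Phi> u x) \<and>
     (\<forall>u\<in>bcont_nonneg. \<forall>v\<in>bcont_nonneg. \<forall>x. \<Phi> (\<lambda>t. u t * v t) x = \<Phi> u (\<Phi> v x)) \<and>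
     (\<forall>x. \<Phi> (\<lambda>t. 1) x = x) \<and>
     (\<forall>u\<in>bcont_nonneg. \<forall>x y. cinner (\<Phi> u x) y = cinner x (\<Phi> (\<lambda>t. cnj (u t)) y)) \<and>
     (\<forall>z. z \<notin> complex_of_real ` {0..} \<longrightarrow>
        \<Phi> (\<lambda>t. 1 / (complex_of_real t - z)) = resolvent_op D H z)"

definition fun_calc :: "(real \<Rightarrow> real) \<Rightarrow> 'h::complex_hilbert set \<Rightarrow> ('h \<Rightarrow> 'h) \<Rightarrow> 'h \<Rightarrow> 'h" where
  "fun_calc u D H = (SOME \<Phi>. is_functional_calculus D H \<Phi>) (\<lambda>t. complex_of_real (u t))"

definition weakly_null :: "(nat \<Rightarrow> 'h::complex_hilbert) \<Rightarrow> bool" where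
  "weakly_null \<psi> \<longleftrightarrow> (\<forall>\<phi>. (\<lambda>j. cinner (\<psi> j) \<phi>) \<longlonglongrightarrow> 0)"

text \<open>The four clauses: \<open>\<psi>\<close> lies in the domain; properties (1), (2) and (3).\<close>

definition approx_seq ::
    "'h::complex_hilbert set \<Rightarrow> ('h \<Rightarrow> 'h) \<Rightarrow> (real \<Rightarrow> real) \<Rightarrow> (real \<Rightarrow> real) \<Rightarrow> real \<Rightarrow> real \<Rightarrow>
     (nat \<Rightarrow> 'h) \<Rightarrow> bool" where
  "approx_seq D H f g lam \<delta> \<psi> \<longleftrightarrow>
     (\<forall>j. \<psi> j \<in> D) \<and>
     (\<forall>j. norm (\<psi> j) = 1) \<and>
     (\<forall>j. cmod (cinner (fun_calc f D H (H (\<psi> j) - lam *\<^sub>R \<psi> j)) (H (\<psi> j) - lam *\<^sub>R \<psi> j)) \<le> \<delta>) \<and>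
     (\<forall>j. cmod (cinner (fun_calc g D H (\<psi> j)) (H (\<psi> j) - lam *\<^sub>R \<psi> j)) \<le> \<delta>)"

definition c0 :: "(real \<Rightarrow> real) \<Rightarrow> (real \<Rightarrow> real) \<Rightarrow> real" where
  "c0 f g = max (SUP t\<in>{0..}. f t) (SUP t\<in>{0..}. g t)"

definition c1 :: "(real \<Rightarrow> real) \<Rightarrow> real \<Rightarrow> real" where
  "c1 f lam = (INF t\<in>{0..lam}. f t)"

definition c2 :: "(real \<Rightarrow> real) \<Rightarrow> real \<Rightarrow> real" where
  "c2 g lam = min (INF t\<in>{lam..lam + 1}. g t) (INF t\<in>{lam + 1..}. g t * (t - lam))"

definition c3 :: "(real \<Rightarrow> real) \<Rightarrow> real \<Rightarrow> real" where
  "c3 g lam = lam * (SUP t\<in>{0..lam}. g t)"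

text \<open>The upper bound for the distance in the converse direction.\<close>

definition dist_bound :: "(real \<Rightarrow> real) \<Rightarrow> (real \<Rightarrow> real) \<Rightarrow> real \<Rightarrow> real \<Rightarrow> real" where
  "dist_bound f g lam \<delta> =
     (if lam > 0
      then ((c1 f lam + c2 g lam + c3 g lam) / (c1 f lam * c2 g lam)) powr (1/3) * \<delta> powr (1/3)
      else \<delta> / c2 g lam)"

end

theory Submission
  imports Defs
begin

text \<open>Let \<open>R = (H + 1)\<^sup>-\<^sup>1\<close>, a contraction with \<open>0 \<le> R \<le> 1\<close>. The operators
  \<open>(n choose k) R\<^sup>k (1 - R)\<^sup>n\<^sup>-\<^sup>k\<close> are positive and sum to the identity, so Bernstein's formula
  \<open>\<Sum>k. U(s\<^sub>k) (n choose k) R\<^sup>k (1 - R)\<^sup>n\<^sup>-\<^sup>k\<close> defines contractions; they converge strongly, even for \<open>U\<close>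
  bounded and continuous on \<open>(0,1]\<close> only, because the nodes avoid \<open>0\<close> and \<open>R\<close> has dense range. The
  substitution \<open>s = 1 / (t + 1)\<close> then gives the functional calculus of \<open>H\<close>.

  Spectral projections are replaced by continuous bump functions: \<open>\<mu>\<close> lies outside the spectrum if and only
  if some bump at \<open>\<mu>\<close> is annihilated, and the range of a bump of radius \<open>\<epsilon>\<close> consists of vectors with
  \<open>norm (H x - \<mu> x) \<le> \<epsilon> norm x\<close>. This gives the sequences \<open>\<psi>\<close> near the spectrum. Conversely, if no spectrum
  lies within \<open>d\<close> of \<open>\<lambda>\<close>, the pointwise inequality
  \<open>1 \<le> A f(t) (t - \<lambda>)\<^sup>2 + B g(t) (t - \<lambda>) + K S(t)\<^sup>2\<close>, in which \<open>S\<close> is a finite sum of annihilated bumps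
  covering \<open>[\<lambda> - d, \<lambda> + d]\<close>, yields \<open>1 \<le> (A + B) \<delta>\<close>. For the essential spectrum the bumps only tend to
  zero along \<open>\<psi>\<close>: near a discrete eigenvalue their range is a finite-dimensional eigenspace, on which weak
  and norm convergence agree.\<close>

section \<open>Complex Hilbert spaces\<close>

text \<open>\<open>fun_calc\<close> rests on a choice operator: a functional calculus has to be
  constructed first, and the chosen one is then known only through the defining axioms. Facts about
  \<open>H\<close> are therefore derived in the locale \<open>calculus\<close>, instantiated twice:
  at the constructed map, to identify its resolvents and complete the existence proof, and at the
  chosen map.

  The exponent 1/3 comes from the left of \<open>lam\<close>. The g-term needs
  \<open>B = 1 / (c2 d)\<close> to reach 1 on the right and can cost \<open>B c3\<close> on the
  left; the f-term, guaranteed only to be at least \<open>c1 d\<^sup>2\<close> there, must make up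
  for this, so \<open>A\<close> can grow like \<open>d\<close> to the power -3. For
  \<open>lam = 0\<close> there is no left side, only \<open>B\<close> remains, and the bound is
  linear in \<open>\<delta>\<close>.

  The smallness of \<open>\<delta>\<close> becomes a threshold \<open>\<delta>0\<close> depending
  only on \<open>f\<close>, \<open>g\<close> and \<open>lam\<close>. Below it the distance bound is
  less than 1, so the argument can be confined to radii \<open>d \<le> 1\<close>, for which
  \<open>c2\<close> yields \<open>g(t) (t - lam) \<ge> c2 d\<close> right of
  \<open>lam + d\<close>.\<close>

lemma cinner_add_right: "cinner x (y + z) = cinner x y + cinner x (z::'h::complex_hilbert)"
  by (metis cinner_commute cinner_add_left complex_cnj_add)

lemma cinner_scaleC_right: "cinner x (c *\<^sub>C y) = cnj c * cinner x (y::'h::complex_hilbert)"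
  by (metis cinner_commute cinner_scaleC_left complex_cnj_mult)

lemma scaleC_one [simp]: "1 *\<^sub>C x = (x::'h::complex_hilbert)"
  using scaleR_scaleC[of 1 x] by simp

lemma scaleC_zero_left [simp]: "0 *\<^sub>C x = (0::'h::complex_hilbert)"
  using scaleR_scaleC[of 0 x] by simp

lemma scaleC_minus_one: "(-1) *\<^sub>C x = - (x::'h::complex_hilbert)"
  using scaleR_scaleC[of "-1" x] by simp

lemma cinner_self: "cinner x x = of_real ((norm (x::'h::complex_hilbert))\<^sup>2)"
  using cinner_commute[of x x] inner_eq_Re_cinner[of x x]
  by (auto simp: complex_eq_iff power2_norm_eq_inner)

lemma norm_scaleC: "norm (c *\<^sub>C x) = cmod c * norm (x::'h::complex_hilbert)"
proof -
  have "complex_of_real ((norm (c *\<^sub>C x))\<^sup>2) = of_real ((cmod c * norm x)\<^sup>2)"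
    unfolding cinner_self[symmetric] cinner_scaleC_left cinner_scaleC_right
    by (simp add: cinner_self power_mult_distrib complex_norm_square del: of_real_power)
  then have "(norm (c *\<^sub>C x))\<^sup>2 = (cmod c * norm x)\<^sup>2"
    by (simp only: of_real_eq_iff)
  then show ?thesis by (simp add: power2_eq_iff_nonneg)
qed

text \<open>A unimodular factor \<open>c\<close> rotates the inner product onto the positive real
  axis, where it agrees with the real inner product and the real Cauchy-Schwarz inequality
  applies.\<close>

lemma norm_cinner_le: "cmod (cinner x y) \<le> norm x * norm (y::'h::complex_hilbert)"
proof (cases "cinner x y = 0")
  case False
  define c where "c = cnj (cinner x y) / of_real (cmod (cinner x y))"
  have c: "cmod c = 1" using False by (simp add: c_def norm_divide)
  have "c * cinner x y = of_real (cmod (cinner x y))"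
    using False complex_norm_square[of "cinner x y"]
    by (simp add: c_def nonzero_divide_eq_eq power2_eq_square mult.commute)
  then have "cmod (cinner x y) = Re (cinner (c *\<^sub>C x) y)"
    by (simp add: cinner_scaleC_left)
  also have "\<dots> \<le> norm (c *\<^sub>C x) * norm y"
    by (metis inner_eq_Re_cinner norm_cauchy_schwarz)
  finally show ?thesis by (simp add: norm_scaleC c)
qed simp

lemma bounded_linear_cinner_left: "bounded_linear (\<lambda>x. cinner x (y::'h::complex_hilbert))"
  by (rule bounded_linear_intro[where K = "norm y"])
    (simp_all add: cinner_add_left scaleR_scaleC cinner_scaleC_left norm_cinner_le scaleR_conv_of_real)

lemma bounded_linear_cinner_right: "bounded_linear (\<lambda>y. cinner (x::'h::complex_hilbert) y)"
  by (rule bounded_linear_intro[where K = "norm x"])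
    (simp_all add: cinner_add_right scaleR_scaleC cinner_scaleC_right norm_cinner_le scaleR_conv_of_real
      mult.commute[of "norm _" "norm x"])

lemma bounded_linear_scaleC: "bounded_linear (\<lambda>x::'h::complex_hilbert. c *\<^sub>C x)"
  by (rule bounded_linear_intro[where K = "cmod c"])
    (simp_all add: scaleC_add_right scaleR_scaleC scaleC_scaleC norm_scaleC mult.commute)

lemmas cinner_diff_left = bounded_linear.linear[OF bounded_linear_cinner_left, THEN linear_diff]
lemmas cinner_diff_right = bounded_linear.linear[OF bounded_linear_cinner_right, THEN linear_diff]
lemmas cinner_sum_left = bounded_linear.linear[OF bounded_linear_cinner_left, THEN linear_sum]
lemmas cinner_sum_right = bounded_linear.linear[OF bounded_linear_cinner_right, THEN linear_sum]
lemmas cinner_zero_left [simp] = bounded_linear.linear[OF bounded_linear_cinner_left, THEN linear_0]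
lemmas cinner_zero_right [simp] = bounded_linear.linear[OF bounded_linear_cinner_right, THEN linear_0]
lemmas scaleC_zero_right [simp] = bounded_linear.linear[OF bounded_linear_scaleC, THEN linear_0]
lemmas scaleC_diff_right = bounded_linear.linear[OF bounded_linear_scaleC, THEN linear_diff]
lemmas scaleC_sum_right = bounded_linear.linear[OF bounded_linear_scaleC, THEN linear_sum]

lemma scaleC_diff_left: "(c - d) *\<^sub>C x = c *\<^sub>C x - d *\<^sub>C (x::'h::complex_hilbert)"
  using scaleC_add_left[of "c - d" d x] by (simp add: algebra_simps)

lemma tendsto_cinner_left: "X \<longlonglongrightarrow> x \<Longrightarrow> (\<lambda>n. cinner (X n) y) \<longlonglongrightarrow> cinner x (y::'h::complex_hilbert)"
  by (rule bounded_linear.tendsto[OF bounded_linear_cinner_left])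

lemma tendsto_cinner_right: "X \<longlonglongrightarrow> x \<Longrightarrow> (\<lambda>n. cinner y (X n)) \<longlonglongrightarrow> cinner (y::'h::complex_hilbert) x"
  by (rule bounded_linear.tendsto[OF bounded_linear_cinner_right])

text \<open>The projection argument: a minimizing sequence for the distance from \<open>y\<close> to
  \<open>V\<close> is Cauchy, its limit \<open>w\<close> is a nearest point, and
  \<open>y - w\<close> is orthogonal to \<open>V\<close>, hence zero.\<close>

lemma closed_subspace_eq_UNIV:
  fixes V :: "'h::complex_hilbert set"
  assumes "closed V" "subspace V" and orth: "\<And>z. (\<And>v. v \<in> V \<Longrightarrow> inner z v = 0) \<Longrightarrow> z = 0"
  shows "V = UNIV"
proof -
  have "y \<in> V" for y
  proof -
    define d where "d = infdist y V"
    have V: "V \<noteq> {}" using subspace_0[OF assms(2)] by auto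
    have d: "d \<le> dist y v" if "v \<in> V" for v
      unfolding d_def using that by (rule infdist_le)
    have d0: "d \<ge> 0" by (simp add: d_def infdist_nonneg)
    have "\<exists>v\<in>V. dist y v < d + 1 / Suc n" for n
    proof (rule ccontr)
      assume "\<not> ?thesis"
      then have "d + 1 / Suc n \<le> infdist y V"
        unfolding infdist_def using V by (auto intro!: cINF_greatest simp: not_less)
      moreover have "1 / real (Suc n) > 0" by simp
      ultimately show False unfolding d_def by linarith
    qed
    then obtain v where vV: "\<And>n. v n \<in> V" and vd: "\<And>n. dist y (v n) < d + 1 / Suc n"
      by metis
    \<comment> \<open>Parallelogram law; the midpoint of \<open>v m\<close> and \<open>v n\<close>
      lies in \<open>V\<close>, hence at distance at least \<open>d\<close> from
      \<open>y\<close>.\<close>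
    have par: "(dist (v m) (v n))\<^sup>2 \<le> 2 * (dist y (v m))\<^sup>2 + 2 * (dist y (v n))\<^sup>2 - 4 * d\<^sup>2" for m n
    proof -
      have "(1/2) *\<^sub>R (v m + v n) \<in> V"
        by (intro subspace_scale subspace_add assms vV)
      from d[OF this] have "d\<^sup>2 \<le> (dist y ((1/2) *\<^sub>R (v m + v n)))\<^sup>2"
        using d0 by (simp add: power_mono)
      also have "4 * \<dots> = (norm ((y - v m) + (y - v n)))\<^sup>2"
      proof -
        have "(y - v m) + (y - v n) = 2 *\<^sub>R (y - (1/2) *\<^sub>R (v m + v n))"
          by (simp add: scaleR_right_diff_distrib) (simp add: scaleR_2)
        then show ?thesis by (simp add: dist_norm power_mult_distrib)
      qed
      also have "(norm ((y - v m) + (y - v n)))\<^sup>2 + (norm ((y - v m) - (y - v n)))\<^sup>2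
          = 2 * (norm (y - v m))\<^sup>2 + 2 * (norm (y - v n))\<^sup>2"
        by (simp add: power2_norm_eq_inner inner_simps algebra_simps inner_commute)
      ultimately show ?thesis
        by (simp add: dist_norm norm_minus_commute algebra_simps)
    qed
    have vlim: "(\<lambda>n. dist y (v n)) \<longlonglongrightarrow> d"
    proof (rule tendsto_sandwich[of "\<lambda>_. d" _ _ "\<lambda>n. d + 1 / Suc n"])
      show "(\<lambda>n. d + 1 / Suc n) \<longlonglongrightarrow> d"
        using tendsto_add[OF tendsto_const LIMSEQ_inverse_real_of_nat, of d]
        by (simp add: inverse_eq_divide)
    qed (use d vV vd in \<open>auto intro!: always_eventually simp: less_imp_le simp del: of_nat_Suc\<close>)
    have "Cauchy v"
    proof (rule metric_CauchyI)
      fix e :: real assume e: "e > 0"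
      have "(\<lambda>n. 2 * (dist y (v n))\<^sup>2 - 2 * d\<^sup>2) \<longlonglongrightarrow> 2 * d\<^sup>2 - 2 * d\<^sup>2"
        by (intro tendsto_intros vlim)
      then have "\<forall>\<^sub>F n in sequentially. 2 * (dist y (v n))\<^sup>2 - 2 * d\<^sup>2 < e\<^sup>2 / 2"
        using e by (intro order_tendstoD(2)[of _ 0]) auto
      then obtain N where N: "\<And>n. n \<ge> N \<Longrightarrow> 2 * (dist y (v n))\<^sup>2 - 2 * d\<^sup>2 < e\<^sup>2 / 2"
        unfolding eventually_sequentially by auto
      have "dist (v m) (v n) < e" if "m \<ge> N" "n \<ge> N" for m n
      proof -
        have "(dist (v m) (v n))\<^sup>2 < e\<^sup>2"
          using par[of m n] N[OF that(1)] N[OF that(2)] by (simp add: field_simps)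
        then show ?thesis using e by (simp add: power2_less_imp_less)
      qed
      then show "\<exists>M. \<forall>m\<ge>M. \<forall>n\<ge>M. dist (v m) (v n) < e" by blast
    qed
    then obtain w where w: "v \<longlonglongrightarrow> w" using Cauchy_convergent convergent_def by blast
    have wV: "w \<in> V" using assms(1) vV w by (metis closed_sequentially)
    have wd: "dist y w = d"
      using tendsto_dist[OF tendsto_const w, of y] vlim LIMSEQ_unique by blast
    have "inner (y - w) x = 0" if x: "x \<in> V" for x
    proof (rule ccontr)
      assume ne: "inner (y - w) x \<noteq> 0"
      then have xx: "inner x x > 0" by auto
      \<comment> \<open>The minimizer along the line \<open>w + s x\<close>: it lowers the squared
        distance by \<open>(inner (y - w) x)\<^sup>2 / inner x x\<close>.\<close>
      define s where "s = inner (y - w) x / inner x x"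
      have "d\<^sup>2 \<le> (dist y (w + s *\<^sub>R x))\<^sup>2"
        using d d0 wV x assms(2) by (intro power_mono d subspace_add subspace_scale) auto
      also have "\<dots> = inner (y - w) (y - w) - (inner (y - w) x)\<^sup>2 / inner x x"
        using xx unfolding dist_norm power2_norm_eq_inner s_def
        by (simp add: inner_simps inner_commute field_simps power2_eq_square)
      also have "inner (y - w) (y - w) = d\<^sup>2"
        using wd by (simp add: dist_norm power2_norm_eq_inner[symmetric])
      finally have "(inner (y - w) x)\<^sup>2 / inner x x \<le> 0" by simp
      then show False using xx ne by (simp add: divide_le_0_iff power2_eq_square)
           (metis mult_less_0_iff not_le zero_less_mult_iff linorder_neqE_linordered_idom)
    qed
    then have "y - w = 0" by (rule orth)
    then show ?thesis using wV by simp
  qed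
  then show ?thesis by auto
qed

section \<open>The resolvent of a nonnegative self-adjoint operator\<close>

definition bounded_clinear :: "('h::complex_hilbert \<Rightarrow> 'h) \<Rightarrow> bool" where
  "bounded_clinear T \<longleftrightarrow> bounded_linear T \<and> (\<forall>c x. T (c *\<^sub>C x) = c *\<^sub>C T x)"

lemma bounded_clinear_scaleC: "bounded_clinear T \<Longrightarrow> T (c *\<^sub>C x) = c *\<^sub>C T x"
  by (simp add: bounded_clinear_def)

lemma bounded_clinear_linear: "bounded_clinear T \<Longrightarrow> linear T"
  by (simp add: bounded_clinear_def bounded_linear.linear)

lemma bounded_clinear_tendsto:
  "bounded_clinear T \<Longrightarrow> X \<longlonglongrightarrow> x \<Longrightarrow> (\<lambda>n. T (X n)) \<longlonglongrightarrow> T x"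
  by (simp add: bounded_clinear_def bounded_linear.tendsto)

lemma bounded_clinear_ident: "bounded_clinear (\<lambda>x. x)"
  by (simp add: bounded_clinear_def)

lemma bounded_clinear_compose:
  "bounded_clinear T \<Longrightarrow> bounded_clinear T' \<Longrightarrow> bounded_clinear (\<lambda>x. T (T' x))"
  by (simp add: bounded_clinear_def bounded_linear_compose)

lemma bounded_clinear_funpow: "bounded_clinear T \<Longrightarrow> bounded_clinear (T ^^ n)"
  by (induction n) (simp_all add: bounded_clinear_ident bounded_clinear_compose id_def comp_def)

lemma bounded_clinear_scale: "bounded_clinear T \<Longrightarrow> bounded_clinear (\<lambda>x. c *\<^sub>C T x)"
  by (simp add: bounded_clinear_def bounded_linear_compose[OF bounded_linear_scaleC] scaleC_scaleC
      mult.commute)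

lemma bounded_clinear_diff:
  "bounded_clinear T \<Longrightarrow> bounded_clinear T' \<Longrightarrow> bounded_clinear (\<lambda>x. T x - T' x)"
  by (simp add: bounded_clinear_def bounded_linear_sub scaleC_diff_right)

lemma bounded_clinear_sum:
  "(\<And>i. i \<in> I \<Longrightarrow> bounded_clinear (T i)) \<Longrightarrow> bounded_clinear (\<lambda>x. \<Sum>i\<in>I. T i x)"
  by (simp add: bounded_clinear_def bounded_linear_sum scaleC_sum_right)

lemma cinner_zero_dense:
  fixes z :: "'h::complex_hilbert"
  assumes "closure D = UNIV" "\<And>x. x \<in> D \<Longrightarrow> cinner x z = 0"
  shows "z = 0"
proof -
  have "closed {x. cinner x z = 0}"
    by (intro closed_Collect_eq continuous_on_const linear_continuous_on bounded_linear_cinner_left)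
  then have "closure D \<subseteq> {x. cinner x z = 0}"
    using assms(2) by (intro closure_minimal) auto
  then have "cinner z z = 0" using assms(1) by auto
  then show ?thesis by (simp add: cinner_self)
qed

locale nonneg_self_adjoint =
  fixes D :: "'h::complex_hilbert set" and H :: "'h \<Rightarrow> 'h"
  assumes self_adjoint: "self_adjoint_op D H" and nonneg: "nonneg_op D H"
begin

lemma clinear: "clinear_on D H"
  and dense: "closure D = UNIV"
  using self_adjoint by (auto simp: self_adjoint_op_def densely_defined_def)

text \<open>Self-adjointness makes the domain maximal, so membership in \<open>D\<close> and the
  value of \<open>H\<close> can both be read off from a weak identity. Density of \<open>D\<close>
  makes the candidate \<open>z\<close> unique.\<close>

lemma adjointI:
  assumes "\<And>x. x \<in> D \<Longrightarrow> cinner (H x) y = cinner x z"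
  shows "y \<in> D" "H y = z"
proof -
  have "y \<in> adjoint_dom D H" using assms by (auto simp: adjoint_dom_def)
  then show y: "y \<in> D" using self_adjoint by (simp add: self_adjoint_op_def)
  have "adjoint_op D H y = z"
    unfolding adjoint_op_def
  proof (rule the_equality)
    show "\<forall>x\<in>D. cinner (H x) y = cinner x z" using assms by simp
    fix z' assume z': "\<forall>x\<in>D. cinner (H x) y = cinner x z'"
    have "z' - z = 0"
      by (rule cinner_zero_dense[OF dense]) (use z' assms in \<open>simp add: cinner_diff_right\<close>)
    then show "z' = z" by simp
  qed
  then show "H y = z" using self_adjoint y by (simp add: self_adjoint_op_def)
qed

lemma symmetric:
  assumes "x \<in> D" "y \<in> D"
  shows "cinner (H x) y = cinner x (H y)"
proof -
  have "y \<in> adjoint_dom D H" using self_adjoint assms by (simp add: self_adjoint_op_def)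
  then obtain z where z: "\<And>x. x \<in> D \<Longrightarrow> cinner (H x) y = cinner x z"
    by (auto simp: adjoint_dom_def)
  show ?thesis using adjointI[of y z] z assms by auto
qed

lemma zero_mem: "0 \<in> D"
  and add_mem: "x \<in> D \<Longrightarrow> y \<in> D \<Longrightarrow> x + y \<in> D"
  and H_add: "x \<in> D \<Longrightarrow> y \<in> D \<Longrightarrow> H (x + y) = H x + H y"
  and scaleC_mem: "x \<in> D \<Longrightarrow> c *\<^sub>C x \<in> D"
  and H_scaleC: "x \<in> D \<Longrightarrow> H (c *\<^sub>C x) = c *\<^sub>C H x"
  using clinear by (auto simp: clinear_on_def)

lemma diff_mem: "x \<in> D \<Longrightarrow> y \<in> D \<Longrightarrow> x - y \<in> D"
  and H_diff: "x \<in> D \<Longrightarrow> y \<in> D \<Longrightarrow> H (x - y) = H x - H y"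
  using add_mem[of x "(-1) *\<^sub>C y"] H_add[of x "(-1) *\<^sub>C y"] scaleC_mem[of y "-1"]
    H_scaleC[of y "-1"]
  by (simp_all add: scaleC_minus_one)

lemma coercive: "x \<in> D \<Longrightarrow> (norm x)\<^sup>2 \<le> Re (cinner (H x + x) x)"
  using nonneg by (simp add: nonneg_op_def cinner_add_left cinner_self)

lemma norm_le_shift:
  assumes "x \<in> D"
  shows "norm x \<le> norm (H x + x)"
proof -
  have "norm x * norm x \<le> norm (H x + x) * norm x"
    using coercive[OF assms] complex_Re_le_cmod[of "cinner (H x + x) x"]
      norm_cinner_le[of "H x + x" x] by (simp add: power2_eq_square)
  then show ?thesis by (cases "x = 0") auto
qed

text \<open>The range is closed: by \<open>norm_le_shift\<close> preimages of a convergent sequence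
  are Cauchy, and \<open>adjointI\<close> puts their limit into \<open>D\<close>. A vector
  \<open>z\<close> orthogonal to the range satisfies \<open>H z = - z\<close> by
  \<open>adjointI\<close>, so \<open>norm_le_shift\<close> gives \<open>z = 0\<close>.\<close>

lemma range_shift: "(\<lambda>x. H x + x) ` D = UNIV"
proof (rule closed_subspace_eq_UNIV)
  let ?V = "(\<lambda>x. H x + x) ` D"
  show "closed ?V"
    unfolding closed_sequential_limits
  proof (intro allI impI, elim conjE)
    fix v y assume "\<forall>n. v n \<in> ?V" and vy: "v \<longlonglongrightarrow> y"
    then have "\<forall>n. \<exists>x\<in>D. v n = H x + x" by blast
    then obtain x where xD: "\<And>n. x n \<in> D" and vx: "\<And>n. v n = H (x n) + x n" by metis
    have "Cauchy x"
    proof (rule metric_CauchyI)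
      fix e :: real assume "e > 0"
      with LIMSEQ_imp_Cauchy[OF vy] obtain M where
        M: "\<And>m n. m \<ge> M \<Longrightarrow> n \<ge> M \<Longrightarrow> dist (v m) (v n) < e"
        unfolding Cauchy_def by blast
      have "dist (x m) (x n) \<le> dist (v m) (v n)" for m n
        using norm_le_shift[OF diff_mem[OF xD xD], of m n]
        by (simp add: dist_norm vx H_diff xD algebra_simps)
      then show "\<exists>M. \<forall>m\<ge>M. \<forall>n\<ge>M. dist (x m) (x n) < e"
        using M by (meson le_less_trans)
    qed
    then obtain l where l: "x \<longlonglongrightarrow> l" using Cauchy_convergent convergent_def by blast
    have Hl: "(\<lambda>n. H (x n)) \<longlonglongrightarrow> y - l"
      using tendsto_diff[OF vy l] by (simp add: vx)
    have "cinner (H w) l = cinner w (y - l)" if "w \<in> D" for w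
      using tendsto_cinner_right[OF l, of "H w"] tendsto_cinner_right[OF Hl, of w]
      by (simp add: symmetric[OF that xD] LIMSEQ_unique)
    from adjointI[OF this] have "l \<in> D" "H l = y - l" by auto
    then show "y \<in> ?V" by (intro image_eqI[of _ _ l]) auto
  qed
  show "subspace ?V"
    unfolding subspace_def
  proof (intro conjI ballI allI)
    show "0 \<in> ?V" using zero_mem H_diff[of 0 0] by (intro image_eqI[of _ _ 0]) auto
  next
    fix a b assume "a \<in> ?V" "b \<in> ?V"
    then obtain x y where "x \<in> D" "y \<in> D" "a = H x + x" "b = H y + y" by auto
    then show "a + b \<in> ?V"
      by (intro image_eqI[of _ _ "x + y"]) (auto simp: H_add add_mem algebra_simps)
  next
    fix c a assume "a \<in> ?V"
    then obtain x where "x \<in> D" "a = H x + x" by auto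
    then show "c *\<^sub>R a \<in> ?V"
      by (intro image_eqI[of _ _ "of_real c *\<^sub>C x"])
        (auto simp: scaleR_scaleC H_scaleC scaleC_mem scaleC_add_right)
  qed
  fix z assume z: "\<And>v. v \<in> ?V \<Longrightarrow> inner z v = 0"
  have "cinner (H x + x) z = 0" if x: "x \<in> D" for x
  proof -
    have "Re (cinner z (H x + x)) = 0"
      using z x by (simp flip: inner_eq_Re_cinner)
    \<comment> \<open>Real orthogonality controls only the real part of \<open>cinner\<close>;
      testing with \<open>\<i> x\<close> in place of \<open>x\<close> supplies the imaginary
      part.\<close>
    moreover have "H (\<i> *\<^sub>C x) + \<i> *\<^sub>C x \<in> ?V" using x by (simp add: scaleC_mem)
    then have "Re (cinner z (H (\<i> *\<^sub>C x) + \<i> *\<^sub>C x)) = 0"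
      by (metis z inner_eq_Re_cinner)
    then have "Im (cinner z (H x + x)) = 0"
      using x by (simp add: H_scaleC flip: scaleC_add_right) (simp add: cinner_scaleC_right)
    ultimately have "cinner z (H x + x) = 0" by (simp add: complex_eq_iff)
    then show ?thesis by (metis cinner_commute complex_cnj_zero)
  qed
  then have "cinner (H x) z = cinner x (- z)" if "x \<in> D" for x
    using that cinner_diff_right[of x 0 z] by (simp add: cinner_add_left add_eq_0_iff)
  from adjointI[OF this] have "z \<in> D" "H z = - z" by auto
  then show "z = 0" using norm_le_shift[of z] by simp
qed

definition R :: "'h \<Rightarrow> 'h" where "R = resolvent_op D H (-1)"

lemma R_eq: "R = inv_into D (\<lambda>x. H x + x)"
  by (simp add: R_def resolvent_op_def scaleC_minus_one)

lemma R_mem: "R x \<in> D"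
  unfolding R_eq by (rule inv_into_into) (simp add: range_shift)

lemma H_R: "H (R x) + R x = x"
  unfolding R_eq by (rule f_inv_into_f[where f = "\<lambda>x. H x + x"]) (simp add: range_shift)

lemma R_unique:
  assumes "y \<in> D" "H y + y = x"
  shows "R x = y"
proof -
  have "norm (R x - y) \<le> norm (H (R x - y) + (R x - y))"
    by (intro norm_le_shift diff_mem R_mem assms)
  also have "H (R x - y) + (R x - y) = (H (R x) + R x) - (H y + y)"
    by (simp add: H_diff R_mem assms(1))
  finally show ?thesis by (simp add: H_R assms(2))
qed

lemma R_shift: "y \<in> D \<Longrightarrow> R (H y + y) = y"
  by (rule R_unique) auto

lemma range_R: "range R = D"
proof (intro equalityI subsetI)
  show "x \<in> range R" if "x \<in> D" for x
    using R_shift[OF that] by (metis rangeI)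
qed (auto simp: R_mem)

lemma R_form: "(norm (R x))\<^sup>2 \<le> Re (cinner (R x) x)"
  using coercive[OF R_mem, of x] cinner_commute[of x "R x"] by (simp add: H_R)

lemma norm_R_le: "norm (R x) \<le> norm x"
  using norm_le_shift[OF R_mem] by (simp add: H_R)

lemma R_clinear: "bounded_clinear R"
proof -
  have add: "R (x + y) = R x + R y" for x y
  proof (rule R_unique)
    have "H (R x + R y) + (R x + R y) = (H (R x) + R x) + (H (R y) + R y)"
      by (simp add: H_add R_mem)
    then show "H (R x + R y) + (R x + R y) = x + y" by (simp add: H_R)
  qed (simp add: add_mem R_mem)
  have scale: "R (c *\<^sub>C x) = c *\<^sub>C R x" for c x
    by (rule R_unique) (auto simp: scaleC_mem R_mem H_scaleC H_R simp flip: scaleC_add_right)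
  show ?thesis
    unfolding bounded_clinear_def
    using add scale by (auto intro!: bounded_linear_intro[where K = 1] simp: scaleR_scaleC norm_R_le)
qed

lemma R_symmetric: "cinner (R x) y = cinner x (R y)"
proof -
  have "cinner (R x) (H (R y) + R y) = cinner (H (R x) + R x) (R y)"
    by (simp add: cinner_add_left cinner_add_right symmetric R_mem)
  then show ?thesis by (simp add: H_R)
qed

end

section \<open>Bernstein weights of a positive contraction\<close>

lemma complex_Weierstrass:
  fixes U :: "real \<Rightarrow> complex"
  assumes "continuous_on {0..1} U" "e > 0"
  shows "\<exists>a n. \<forall>s\<in>{0..1}. cmod (U s - (\<Sum>i\<le>n. a i * of_real s ^ i)) < e"
proof -
  obtain p where p: "polynomial_function p" "\<And>s. s \<in> {0..1} \<Longrightarrow> cmod (U s - p s) < e"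
    using Stone_Weierstrass_polynomial_function[OF compact_Icc assms] by blast
  have "real_polynomial_function (\<lambda>s. Re (p s))" "real_polynomial_function (\<lambda>s. Im (p s))"
    using p(1) by (simp_all add: polynomial_function_iff_Basis_inner Basis_complex_def)
  then obtain a m b n where
    a: "(\<lambda>s. Re (p s)) = (\<lambda>s. \<Sum>i\<le>m. a i * s ^ i)" and
    b: "(\<lambda>s. Im (p s)) = (\<lambda>s. \<Sum>i\<le>n. b i * s ^ i)"
    unfolding real_polynomial_function_iff_sum by blast
  define c where "c i = Complex (if i \<le> m then a i else 0) (if i \<le> n then b i else 0)" for i
  have "p s = (\<Sum>i\<le>max m n. c i * of_real s ^ i)" for s
  proof -
    have "(\<Sum>i\<le>m. a i * s ^ i) = (\<Sum>i\<le>max m n. if i \<le> m then a i * s ^ i else 0)"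
      "(\<Sum>i\<le>n. b i * s ^ i) = (\<Sum>i\<le>max m n. if i \<le> n then b i * s ^ i else 0)"
      by (auto intro!: sum.mono_neutral_cong_left split: if_splits)
    moreover have "Re (p s) = (\<Sum>i\<le>m. a i * s ^ i)" "Im (p s) = (\<Sum>i\<le>n. b i * s ^ i)"
      using a b by metis+
    ultimately show ?thesis
      by (auto simp: complex_eq_iff c_def simp flip: of_real_power intro!: sum.cong)
  qed
  then show ?thesis using p(2) by (intro exI[of _ c] exI[of _ "max m n"]) auto
qed

locale positive_contraction =
  fixes R :: "'h::complex_hilbert \<Rightarrow> 'h"
  assumes clinear_R: "bounded_clinear R"
    and symmetric_R: "cinner (R x) y = cinner x (R y)"
    and pos_R: "0 \<le> Re (cinner (R x) x)"
    and contr_R: "Re (cinner (R x) x) \<le> (norm x)\<^sup>2"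
    and dense_R: "closure (range R) = UNIV"
begin

definition S :: "'h \<Rightarrow> 'h" where "S x = x - R x"

lemma clinear_S: "bounded_clinear S"
  unfolding S_def by (intro bounded_clinear_diff bounded_clinear_ident clinear_R)

lemma symmetric_S: "cinner (S x) y = cinner x (S y)"
  by (simp add: S_def cinner_diff_left cinner_diff_right symmetric_R)

lemma pos_S: "0 \<le> Re (cinner (S x) x)"
  using contr_R[of x] by (simp add: S_def cinner_diff_left cinner_self)

lemma R_S: "R (S x) = S (R x)"
  by (simp add: S_def linear_diff[OF bounded_clinear_linear[OF clinear_R]])

lemma R_S_funpow: "R ((S ^^ n) x) = (S ^^ n) (R x)"
  by (induction n) (simp_all add: R_S)

lemma S_R_funpow: "S ((R ^^ n) x) = (R ^^ n) (S x)"
  by (induction n) (simp_all flip: R_S)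

text \<open>Positivity of \<open>R S\<close> comes from \<open>R S = R S R + S R S\<close>; even powers are stripped off in pairs.\<close>

lemma pos_R_S: "0 \<le> Re (cinner (R (S x)) x)"
proof -
  have "R (S x) = R (S (R x + S x))"
    by (simp add: S_def)
  also have "\<dots> = R (S (R x)) + S (R (S x))"
    by (simp add: R_S linear_add[OF bounded_clinear_linear[OF clinear_R]]
        linear_add[OF bounded_clinear_linear[OF clinear_S]])
  finally have "cinner (R (S x)) x = cinner (R (S (R x))) x + cinner (S (R (S x))) x"
    by (metis cinner_add_left)
  also have "\<dots> = cinner (S (R x)) (R x) + cinner (R (S x)) (S x)"
    by (simp only: symmetric_R[of "S (R x)"] symmetric_S[of "R (S x)"])
  finally have "cinner (R (S x)) x = cinner (S (R x)) (R x) + cinner (R (S x)) (S x)" .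
  then show ?thesis using pos_S[of "R x"] pos_R[of "S x"] by simp
qed

lemma pos_funpow: "0 \<le> Re (cinner ((R ^^ k) ((S ^^ m) x)) x)"
proof (induction "k + m" arbitrary: k m x rule: less_induct)
  case less
  show ?case
  proof (cases "k \<ge> 2")
    case True
    then obtain k' where k: "k = Suc (Suc k')" by (metis add_2_eq_Suc le_Suc_ex)
    have "(R ^^ k) ((S ^^ m) x) = R ((R ^^ k') ((S ^^ m) (R x)))"
      by (simp add: k funpow_swap1 R_S_funpow)
    then have "cinner ((R ^^ k) ((S ^^ m) x)) x = cinner ((R ^^ k') ((S ^^ m) (R x))) (R x)"
      by (simp only: symmetric_R)
    then show ?thesis using less[of k' m "R x"] k by simp
  next
    case False
    show ?thesis
    proof (cases "m \<ge> 2")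
      case True
      then obtain m' where m: "m = Suc (Suc m')" by (metis add_2_eq_Suc le_Suc_ex)
      have "(R ^^ k) ((S ^^ m) x) = S ((R ^^ k) ((S ^^ m') (S x)))"
        by (simp add: m funpow_swap1 S_R_funpow)
      then have "cinner ((R ^^ k) ((S ^^ m) x)) x = cinner ((R ^^ k) ((S ^^ m') (S x))) (S x)"
        by (simp only: symmetric_S)
      then show ?thesis using less[of k m' "S x"] m by simp
    next
      case m: False
      then have "k \<in> {0, 1}" "m \<in> {0, 1}" using False by auto
      then show ?thesis
        using pos_R[of x] pos_S[of x] pos_R_S[of x] by (auto simp: cinner_self)
    qed
  qed
qed

definition E :: "nat \<Rightarrow> nat \<Rightarrow> 'h \<Rightarrow> 'h" where
  "E n k x = of_nat (n choose k) *\<^sub>C (R ^^ k) ((S ^^ (n - k)) x)"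

lemma clinear_E: "bounded_clinear (E n k)"
  unfolding E_def
  by (rule bounded_clinear_scale[OF bounded_clinear_compose[OF
        bounded_clinear_funpow[OF clinear_R] bounded_clinear_funpow[OF clinear_S]]])

lemma symmetric_funpow:
  "cinner ((R ^^ k) x) y = cinner x ((R ^^ k) y)" "cinner ((S ^^ k) x) y = cinner x ((S ^^ k) y)"
  by (induction k arbitrary: x y) (simp_all add: symmetric_R symmetric_S funpow_swap1)

lemma R_funpow_S_funpow: "(R ^^ k) ((S ^^ m) x) = (S ^^ m) ((R ^^ k) x)"
  by (induction k) (simp_all add: R_S_funpow)

lemma symmetric_E: "cinner (E n k x) y = cinner x (E n k y)"
  by (simp add: E_def cinner_scaleC_left cinner_scaleC_right symmetric_funpow R_funpow_S_funpow)

lemma pos_E: "0 \<le> Re (cinner (E n k x) x)"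
  by (simp add: E_def cinner_scaleC_left pos_funpow)

lemma R_E: "R (E n k x) = E n k (R x)"
  by (simp add: E_def bounded_clinear_scaleC[OF clinear_R] R_S_funpow funpow_swap1)

text \<open>Pascal's rule: each binomial coefficient of degree \<open>Suc n\<close> splits into one
  term that gains a factor \<open>R\<close> and one that gains a factor \<open>S\<close>.\<close>

lemma E_Suc_Suc: "E (Suc n) (Suc k) x = R (E n k x) + S (E n (Suc k) x)"
proof -
  have S0: "S 0 = 0" by (rule linear_0[OF bounded_clinear_linear[OF clinear_S]])
  have "S (E n (Suc k) x) = of_nat (n choose Suc k) *\<^sub>C (R ^^ Suc k) ((S ^^ (n - k)) x)"
  \<comment> \<open>For \<open>k \<ge> n\<close> the subtraction \<open>n - Suc k\<close> truncates,
    but the coefficient \<open>n choose Suc k\<close> is zero, so both sides vanish.\<close>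
  proof (cases "k < n")
    case True
    then have "n - k = Suc (n - Suc k)" by simp
    then show ?thesis
      by (simp add: E_def bounded_clinear_scaleC[OF clinear_S] S_R_funpow del: funpow.simps(2))
         (simp add: funpow_swap1 S_R_funpow)
  qed (simp add: E_def binomial_eq_0 S0)
  then show ?thesis
    by (simp add: E_def bounded_clinear_scaleC[OF clinear_R] scaleC_add_left)
qed

text \<open>The binomial theorem for \<open>R + S = 1\<close>: by Pascal's rule, passing from degree
  \<open>n\<close> to \<open>Suc n\<close> applies \<open>R + S\<close> to the sum.\<close>

lemma sum_E: "(\<Sum>k\<le>n. E n k x) = x"
proof (induction n)
  case (Suc n)
  have "(\<Sum>k\<le>Suc n. E (Suc n) k x) = E (Suc n) 0 x + (\<Sum>k\<le>n. R (E n k x) + S (E n (Suc k) x))"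
    by (simp only: sum.atMost_Suc_shift E_Suc_Suc)
  also have "\<dots> = R (\<Sum>k\<le>n. E n k x) + (S (E n 0 x) + (\<Sum>k\<le>n. S (E n (Suc k) x)))"
    by (simp add: sum.distrib linear_sum[OF bounded_clinear_linear[OF clinear_R]] E_def)
  also have "S (E n 0 x) + (\<Sum>k\<le>n. S (E n (Suc k) x)) = (\<Sum>k\<le>Suc n. S (E n k x))"
    by (simp only: sum.atMost_Suc_shift)
  also have "\<dots> = S (\<Sum>k\<le>n. E n k x)"
    by (simp add: linear_sum[OF bounded_clinear_linear[OF clinear_S]] E_def binomial_eq_0
        linear_0[OF bounded_clinear_linear[OF clinear_S]])
  finally show ?case by (simp add: Suc.IH S_def)
qed (simp add: E_def)

text \<open>The absorption identity for binomial coefficients. It says that \<open>R\<close> acts on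
  a weight as multiplication by the node \<open>Suc k / Suc n\<close>, at the price of raising the
  degree by one; this ties the operator \<open>R\<close> to the function \<open>s\<close>.\<close>

lemma R_E_shift: "R (E n k x) = of_real (real (Suc k) / real (Suc n)) *\<^sub>C E (Suc n) (Suc k) x"
proof -
  have "real (Suc k) / real (Suc n) * real (Suc n choose Suc k) = real (n choose k)"
  proof -
    have "real (Suc k) * real (Suc n choose Suc k) = real (n choose k) * real (Suc n)"
      using Suc_times_binomial_eq[of n k] by (metis of_nat_mult mult.commute)
    then show ?thesis
      by (simp add: divide_eq_eq del: of_nat_Suc binomial_Suc_Suc)
  qed
  then have "complex_of_real (real (Suc k) / real (Suc n) * real (Suc n choose Suc k))
      = complex_of_real (real (n choose k))"
    by (rule arg_cong)
  then have "of_real (real (Suc k) / real (Suc n)) * of_nat (Suc n choose Suc k)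
      = complex_of_nat (n choose k)"
    by (simp only: of_real_mult of_real_of_nat_eq)
  then show ?thesis
    by (simp add: E_def bounded_clinear_scaleC[OF clinear_R] scaleC_scaleC del: binomial_Suc_Suc of_nat_Suc)
qed

definition wsum :: "nat \<Rightarrow> (nat \<Rightarrow> complex) \<Rightarrow> 'h \<Rightarrow> 'h" where
  "wsum n a x = (\<Sum>k\<le>n. a k *\<^sub>C E n k x)"

lemma clinear_wsum: "bounded_clinear (wsum n a)"
  unfolding wsum_def by (intro bounded_clinear_sum bounded_clinear_scale clinear_E)

text \<open>Positivity of \<open>E n k\<close> on \<open>x - y\<close>: the Cauchy-Schwarz
  inequality of its quadratic form in arithmetic-mean shape, which can be summed over
  \<open>k\<close> directly.\<close>

lemma Re_cinner_E_le: "Re (cinner (E n k x) y) \<le> (Re (cinner (E n k x) x) + Re (cinner (E n k y) y)) / 2"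
proof -
  have "cinner (E n k y) x = cnj (cinner (E n k x) y)"
    by (metis cinner_commute symmetric_E)
  then have "Re (cinner (E n k (x - y)) (x - y))
      = Re (cinner (E n k x) x) + Re (cinner (E n k y) y) - 2 * Re (cinner (E n k x) y)"
    by (simp add: linear_diff[OF bounded_clinear_linear[OF clinear_E]] cinner_diff_left cinner_diff_right)
  then show ?thesis using pos_E[of n k "x - y"] by simp
qed

text \<open>The operators \<open>E n k\<close> are positive and sum to the identity, so they act on weights as a
  probability distribution would.\<close>

lemma norm_wsum_le_one:
  assumes "\<And>k. k \<le> n \<Longrightarrow> cmod (a k) \<le> 1"
  shows "norm (wsum n a x) \<le> norm x"
proof -
  define y where "y = wsum n a x"
  \<comment> \<open>Pairing the sum with itself bounds \<open>(norm y)\<^sup>2\<close> by the mean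
    of \<open>(norm x)\<^sup>2\<close> and \<open>(norm y)\<^sup>2\<close>; the second half is
    absorbed on the left.\<close>
  have "(norm y)\<^sup>2 = Re (cinner (wsum n a x) y)"
    by (simp add: y_def cinner_self)
  also have "\<dots> = (\<Sum>k\<le>n. Re (cinner (E n k (a k *\<^sub>C x)) y))"
    by (simp add: wsum_def cinner_sum_left bounded_clinear_scaleC[OF clinear_E])
  also have "\<dots> \<le> (\<Sum>k\<le>n. (Re (cinner (E n k x) x) + Re (cinner (E n k y) y)) / 2)"
  proof (rule sum_mono)
    fix k assume k: "k \<in> {..n}"
    have "cinner (E n k (a k *\<^sub>C x)) (a k *\<^sub>C x) = of_real ((cmod (a k))\<^sup>2) * cinner (E n k x) x"
      by (simp add: bounded_clinear_scaleC[OF clinear_E] cinner_scaleC_left cinner_scaleC_right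
          complex_norm_square mult_ac del: of_real_power)
    then have "Re (cinner (E n k (a k *\<^sub>C x)) (a k *\<^sub>C x)) = (cmod (a k))\<^sup>2 * Re (cinner (E n k x) x)"
      by (simp flip: of_real_power)
    also have "\<dots> \<le> 1 * Re (cinner (E n k x) x)"
      using assms[of k] k by (intro mult_right_mono pos_E) (auto simp: power_le_one)
    finally show "Re (cinner (E n k (a k *\<^sub>C x)) y)
        \<le> (Re (cinner (E n k x) x) + Re (cinner (E n k y) y)) / 2"
      using Re_cinner_E_le[of n k "a k *\<^sub>C x" y] by simp
  qed
  also have "\<dots> = (Re (cinner (\<Sum>k\<le>n. E n k x) x) + Re (cinner (\<Sum>k\<le>n. E n k y) y)) / 2"
    by (simp add: cinner_sum_left sum.distrib flip: sum_divide_distrib)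
  also have "\<dots> = ((norm x)\<^sup>2 + (norm y)\<^sup>2) / 2"
    by (simp add: sum_E cinner_self)
  finally have "(norm y)\<^sup>2 \<le> (norm x)\<^sup>2" by simp
  then show ?thesis by (simp add: y_def power2_le_iff_abs_le)
qed

lemma norm_wsum_le:
  assumes "\<And>k. k \<le> n \<Longrightarrow> cmod (a k) \<le> M"
  shows "norm (wsum n a x) \<le> M * norm x"
proof (cases "M = 0")
  case True
  then show ?thesis using assms by (simp add: wsum_def)
next
  case False
  then have M: "M > 0" using assms[of 0] norm_ge_zero[of "a 0"] by linarith
  have "wsum n a x = of_real M *\<^sub>C wsum n (\<lambda>k. a k / of_real M) x"
    using False by (simp add: wsum_def scaleC_sum_right scaleC_scaleC)
  moreover have "norm (wsum n (\<lambda>k. a k / of_real M) x) \<le> norm x"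
    using assms M by (intro norm_wsum_le_one) (simp add: norm_divide divide_le_eq)
  ultimately show ?thesis using M by (simp add: norm_scaleC)
qed

lemma wsum_add: "wsum n (\<lambda>k. a k + b k) x = wsum n a x + wsum n b x"
  by (simp add: wsum_def scaleC_add_left sum.distrib)

lemma wsum_diff: "wsum n (\<lambda>k. a k - b k) x = wsum n a x - wsum n b x"
  by (simp add: wsum_def scaleC_diff_left sum_subtractf)

lemma wsum_scale: "wsum n (\<lambda>k. c * a k) x = c *\<^sub>C wsum n a x"
  by (simp add: wsum_def scaleC_sum_right scaleC_scaleC)

lemma wsum_one: "wsum n (\<lambda>k. 1) x = x"
  by (simp add: wsum_def sum_E)

lemma wsum_adjoint: "cinner (wsum n a x) y = cinner x (wsum n (\<lambda>k. cnj (a k)) y)"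
  by (simp add: wsum_def cinner_sum_left cinner_sum_right cinner_scaleC_left cinner_scaleC_right symmetric_E)

lemma R_wsum: "R (wsum n a x) = wsum n a (R x)"
  by (simp add: wsum_def linear_sum[OF bounded_clinear_linear[OF clinear_R]]
      bounded_clinear_scaleC[OF clinear_R] R_E)

text \<open>Summing \<open>R_E_shift\<close> produces the indices from 1 on; the index 0 can be
  added because its node, and with it the factor \<open>of_real (real k / real (Suc n))\<close>, is
  zero.\<close>

lemma R_wsum_shift:
  "R (wsum n (\<lambda>k. U (real (Suc k) / real (Suc n))) x)
    = wsum (Suc n) (\<lambda>k. U (real k / real (Suc n)) * of_real (real k / real (Suc n))) x"
  unfolding wsum_def sum.atMost_Suc_shift
  by (simp add: linear_sum[OF bounded_clinear_linear[OF clinear_R]]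
      bounded_clinear_scaleC[OF clinear_R] R_E_shift scaleC_scaleC del: of_nat_Suc)

end

section \<open>Functional calculus of a positive contraction\<close>

lemma convergent_uniform_approx:
  fixes X :: "nat \<Rightarrow> 'a::{real_normed_vector, complete_space}"
  assumes "\<And>e. e > 0 \<Longrightarrow> \<exists>Y. convergent Y \<and> (\<forall>n. norm (X n - Y n) \<le> e)"
  shows "convergent X"
proof (rule Cauchy_convergent, rule metric_CauchyI)
  fix e :: real assume e: "e > 0"
  then obtain Y where Y: "convergent Y" "\<And>n. norm (X n - Y n) \<le> e / 4"
    using assms[of "e / 4"] by auto
  obtain N where N: "\<And>m n. m \<ge> N \<Longrightarrow> n \<ge> N \<Longrightarrow> dist (Y m) (Y n) < e / 4"
    using convergent_Cauchy[OF Y(1)] e unfolding Cauchy_def by (meson divide_pos_pos zero_less_numeral)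
  have "dist (X m) (X n) < e" if "m \<ge> N" "n \<ge> N" for m n
  proof -
    have "dist (X m) (X n) \<le> dist (X m) (Y m) + dist (Y m) (Y n) + dist (Y n) (X n)"
      by (metis add.assoc add_left_mono dist_triangle order_trans)
    also have "\<dots> \<le> e / 4 + e / 4 + e / 4"
      using Y(2) N[OF that] by (intro add_mono) (auto simp: dist_norm norm_minus_commute less_imp_le)
    finally show ?thesis using e by simp
  qed
  then show "\<exists>M. \<forall>m\<ge>M. \<forall>n\<ge>M. dist (X m) (X n) < e" by blast
qed

text \<open>The interval is open at 0, the image of \<open>t\<close> tending to infinity under
  \<open>s = 1 / (t + 1)\<close>: bounded functions of \<open>t\<close> may oscillate there.\<close>

definition bcont_unit :: "(real \<Rightarrow> complex) set" where
  "bcont_unit = {U. continuous_on {0<..1} U \<and> (\<exists>M. \<forall>s\<in>{0<..1}. cmod (U s) \<le> M)}"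

lemma bcont_unit_bound:
  assumes "U \<in> bcont_unit"
  obtains M where "M > 0" "\<And>s. s \<in> {0<..1} \<Longrightarrow> cmod (U s) \<le> M"
proof -
  obtain M where "\<And>s. s \<in> {0<..1} \<Longrightarrow> cmod (U s) \<le> M"
    using assms unfolding bcont_unit_def by blast
  then show ?thesis by (intro that[of "max M 1"]) (auto simp: le_max_iff_disj)
qed

lemma bcont_unit_const: "(\<lambda>s. c) \<in> bcont_unit"
  by (auto simp: bcont_unit_def)

lemma bcont_unit_of_real: "of_real \<in> bcont_unit"
  by (auto simp: bcont_unit_def intro!: continuous_intros exI[of _ 1])

lemma bcont_unit_cnj: "U \<in> bcont_unit \<Longrightarrow> (\<lambda>s. cnj (U s)) \<in> bcont_unit"
  by (auto simp: bcont_unit_def intro!: continuous_intros)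

lemma bcont_unit_add:
  assumes "U \<in> bcont_unit" "V \<in> bcont_unit"
  shows "(\<lambda>s. U s + V s) \<in> bcont_unit"
proof -
  obtain M where M: "M > 0" "\<And>s. s \<in> {0<..1} \<Longrightarrow> cmod (U s) \<le> M"
    using bcont_unit_bound[OF assms(1)] by blast
  obtain N where N: "N > 0" "\<And>s. s \<in> {0<..1} \<Longrightarrow> cmod (V s) \<le> N"
    using bcont_unit_bound[OF assms(2)] by blast
  have "\<forall>s\<in>{0<..1}. cmod (U s + V s) \<le> M + N"
    by (intro ballI norm_triangle_mono M N)
  then show ?thesis
    using assms unfolding bcont_unit_def by (blast intro: continuous_on_add)
qed

lemma bcont_unit_mult:
  assumes "U \<in> bcont_unit" "V \<in> bcont_unit"
  shows "(\<lambda>s. U s * V s) \<in> bcont_unit"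
proof -
  obtain M where M: "M > 0" "\<And>s. s \<in> {0<..1} \<Longrightarrow> cmod (U s) \<le> M"
    using bcont_unit_bound[OF assms(1)] by blast
  obtain N where N: "N > 0" "\<And>s. s \<in> {0<..1} \<Longrightarrow> cmod (V s) \<le> N"
    using bcont_unit_bound[OF assms(2)] by blast
  have "\<forall>s\<in>{0<..1}. cmod (U s * V s) \<le> M * N"
    using M N by (auto simp: norm_mult intro!: mult_mono)
  then show ?thesis
    using assms unfolding bcont_unit_def by (blast intro: continuous_on_mult)
qed

lemma bcont_unit_scale: "U \<in> bcont_unit \<Longrightarrow> (\<lambda>s. c * U s) \<in> bcont_unit"
  by (rule bcont_unit_mult[OF bcont_unit_const])

lemma bcont_unit_power: "(\<lambda>s. of_real s ^ m) \<in> bcont_unit"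
  by (induction m) (auto intro!: bcont_unit_const bcont_unit_mult[OF bcont_unit_of_real])

lemma bcont_unit_sum: "(\<And>i. i \<in> I \<Longrightarrow> F i \<in> bcont_unit) \<Longrightarrow> (\<lambda>s. \<Sum>i\<in>I. F i s) \<in> bcont_unit"
  by (induction I rule: infinite_finite_induct) (auto intro: bcont_unit_const bcont_unit_add)

lemma bcont_unit_continuous:
  assumes "continuous_on {0..1} U"
  shows "U \<in> bcont_unit"
proof -
  have "bounded (U ` {0..1})"
    by (intro compact_imp_bounded compact_continuous_image assms compact_Icc)
  then obtain M where "\<forall>s\<in>{0<..1}. cmod (U s) \<le> M" by (fastforce simp: bounded_iff)
  moreover have "continuous_on {0<..1} U" using assms by (rule continuous_on_subset) auto
  ultimately show ?thesis unfolding bcont_unit_def by blast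
qed

text \<open>The factor \<open>s\<close> damps any bounded oscillation at 0, so the product tends to
  its value 0 there. This is how functions on the half-open interval are reduced to continuous
  functions on a compact one.\<close>

lemma continuous_bcont_unit_mult_id:
  assumes "U \<in> bcont_unit"
  shows "continuous_on {0..1} (\<lambda>s. U s * of_real s)"
  unfolding continuous_on_def
proof
  fix s :: real assume s: "s \<in> {0..1}"
  show "((\<lambda>s. U s * of_real s) \<longlongrightarrow> U s * of_real s) (at s within {0..1})"
  proof (cases "s = 0")
    case True
    obtain M where M: "\<And>s. s \<in> {0<..1} \<Longrightarrow> cmod (U s) \<le> M"
      using bcont_unit_bound[OF assms] by blast
    have "((\<lambda>s. U s * of_real s) \<longlongrightarrow> 0) (at 0 within {0..1})"
    proof (rule Lim_null_comparison)
      show "\<forall>\<^sub>F s in at 0 within {0..1}. norm (U s * of_real s) \<le> M * \<bar>s\<bar>"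
        unfolding eventually_at_filter
        by (rule always_eventually) (auto simp: norm_mult intro!: mult_right_mono M)
      have "((\<lambda>s::real. M * \<bar>s\<bar>) \<longlongrightarrow> M * \<bar>0\<bar>) (at 0 within {0..1})"
        by (intro tendsto_intros)
      then show "((\<lambda>s::real. M * \<bar>s\<bar>) \<longlongrightarrow> 0) (at 0 within {0..1})" by simp
    qed
    then show ?thesis using True by simp
  next
    case False
    then have s': "s \<in> {0<..1}" using s by auto
    have "at s within {0..1} = at s within {0<..1}"
      by (rule at_within_nhd[of _ "{0<..}"]) (use s' in auto)
    moreover have "continuous_on {0<..1} (\<lambda>s. U s * of_real s)"
      using assms by (auto simp: bcont_unit_def intro!: continuous_intros)
    ultimately show ?thesis using s' by (auto simp: continuous_on_def)
  qed
qed

section \<open>Bernstein approximants and their strong limit\<close>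

context positive_contraction
begin

definition bern :: "(real \<Rightarrow> complex) \<Rightarrow> nat \<Rightarrow> 'h \<Rightarrow> 'h" where
  "bern U n x = wsum n (\<lambda>k. U (real (Suc k) / real (Suc n))) x"

lemma node_mem: "k \<le> n \<Longrightarrow> real (Suc k) / real (Suc n) \<in> {0<..1}"
  by simp

lemma norm_bern_le:
  assumes "\<And>s. s \<in> {0<..1} \<Longrightarrow> cmod (U s) \<le> M"
  shows "norm (bern U n x) \<le> M * norm x"
  unfolding bern_def by (intro norm_wsum_le assms node_mem)

lemma clinear_bern: "bounded_clinear (bern U n)"
  unfolding bern_def by (rule clinear_wsum)

text \<open>By \<open>R_wsum_shift\<close> the first term samples \<open>s U(s)\<close> at
  \<open>k / (n + 1)\<close>, while the second, also of degree \<open>n + 1\<close>, samples it at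
  \<open>(k + 1) / (n + 2)\<close>. The nodes differ by at most \<open>1 / (n + 2)\<close>, so
  uniform continuity makes the weights uniformly close, and \<open>norm_wsum_le\<close> turns this
  into norm convergence.\<close>

lemma bern_step:
  assumes "continuous_on {0..1} (\<lambda>s. U s * of_real s)"
  shows "(\<lambda>n. R (bern U n x) - bern (\<lambda>s. U s * of_real s) (Suc n) x) \<longlonglongrightarrow> 0"
proof (rule LIMSEQ_I)
  fix e :: real assume e: "e > 0"
  let ?V = "\<lambda>s. U s * of_real s"
  define e' where "e' = e / (norm x + 1)"
  have e': "e' > 0" using e by (simp add: e'_def add_nonneg_pos)
  have "uniformly_continuous_on {0..1} ?V"
    by (rule compact_uniformly_continuous[OF assms compact_Icc])
  then obtain d where d: "d > 0"
    "\<And>s t. s \<in> {0..1} \<Longrightarrow> t \<in> {0..1} \<Longrightarrow> dist t s < d \<Longrightarrow> dist (?V t) (?V s) < e'"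
    using e' unfolding uniformly_continuous_on_def by metis
  obtain N where N: "1 / real (Suc N) < d"
    using d(1) nat_approx_posE by blast
  have "norm (R (bern U n x) - bern ?V (Suc n) x) < e" if n: "n \<ge> N" for n
  proof -
    have "R (bern U n x) - bern ?V (Suc n) x
        = wsum (Suc n) (\<lambda>k. ?V (real k / real (Suc n)) - ?V (real (Suc k) / real (Suc (Suc n)))) x"
      unfolding bern_def wsum_diff R_wsum_shift ..
    also have "norm \<dots> \<le> e' * norm x"
    proof (rule norm_wsum_le)
      fix k assume k: "k \<le> Suc n"
      have "real (Suc k) / real (Suc (Suc n)) - real k / real (Suc n)
          = (real (Suc n) - real k) / real (Suc n) * (1 / real (Suc (Suc n)))"
        by (simp add: field_simps)
      then have "\<bar>real k / real (Suc n) - real (Suc k) / real (Suc (Suc n))\<bar>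
          = \<bar>(real (Suc n) - real k) / real (Suc n) * (1 / real (Suc (Suc n)))\<bar>"
        by linarith
      also have "\<dots> \<le> 1 * (1 / real (Suc (Suc n)))"
        unfolding abs_mult using k by (intro mult_mono) (auto simp: field_simps)
      also have "\<dots> \<le> 1 / real (Suc N)"
        using n by (simp add: field_simps)
      finally have "dist (real k / real (Suc n)) (real (Suc k) / real (Suc (Suc n))) < d"
        using N by (simp add: dist_real_def)
      then have "dist (?V (real k / real (Suc n))) (?V (real (Suc k) / real (Suc (Suc n)))) < e'"
        using k by (intro d(2)) (auto simp: field_simps)
      then show "cmod (?V (real k / real (Suc n)) - ?V (real (Suc k) / real (Suc (Suc n)))) \<le> e'"
        by (simp add: dist_norm)
    qed
    also have "\<dots> < e"
      using e by (simp add: e'_def divide_less_eq add_nonneg_pos)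
    finally show ?thesis .
  qed
  then show "\<exists>N. \<forall>n\<ge>N. norm (R (bern U n x) - bern ?V (Suc n) x - 0) < e" by auto
qed

text \<open>Instead of computing Bernstein moments, each extra factor \<open>s\<close> is traded for
  a factor \<open>R\<close> through \<open>bern_step\<close>.\<close>

lemma bern_power: "(\<lambda>n. bern (\<lambda>s. of_real s ^ m) n x) \<longlonglongrightarrow> (R ^^ m) x"
proof (induction m)
  case 0
  then show ?case by (simp add: bern_def wsum_one)
next
  case (Suc m)
  have "(\<lambda>n. R (bern (\<lambda>s. of_real s ^ m) n x)
      - (R (bern (\<lambda>s. of_real s ^ m) n x) - bern (\<lambda>s. of_real s ^ m * of_real s) (Suc n) x))
    \<longlonglongrightarrow> R ((R ^^ m) x) - 0"
    by (intro tendsto_diff bounded_clinear_tendsto[OF clinear_R] Suc bern_step continuous_intros)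
  then have "(\<lambda>n. bern (\<lambda>s. of_real s ^ Suc m) (Suc n) x) \<longlonglongrightarrow> (R ^^ Suc m) x"
    by (simp add: mult.commute)
  then show ?case by (rule LIMSEQ_imp_Suc)
qed

lemma bern_add: "bern (\<lambda>s. U s + V s) n x = bern U n x + bern V n x"
  by (simp add: bern_def wsum_add)

lemma bern_diff: "bern (\<lambda>s. U s - V s) n x = bern U n x - bern V n x"
  by (simp add: bern_def wsum_diff)

lemma bern_scale: "bern (\<lambda>s. c * U s) n x = c *\<^sub>C bern U n x"
  by (simp add: bern_def wsum_scale)

lemma bern_zero: "bern (\<lambda>s. 0) n x = 0"
  by (simp add: bern_def wsum_def)

lemma bern_sum: "finite I \<Longrightarrow> bern (\<lambda>s. \<Sum>i\<in>I. F i s) n x = (\<Sum>i\<in>I. bern (F i) n x)"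
  by (induction I rule: finite_induct) (simp_all add: bern_add bern_zero)

text \<open>Convergence is known for polynomials by \<open>bern_power\<close>, and a uniform error
  in the function costs the same error in the operators, for all \<open>n\<close> at once.\<close>

lemma convergent_bern_continuous:
  assumes "continuous_on {0..1} U"
  shows "convergent (\<lambda>n. bern U n x)"
proof (rule convergent_uniform_approx)
  fix e :: real assume "e > 0"
  then have e': "e / (norm x + 1) > 0" by (simp add: add_nonneg_pos)
  from complex_Weierstrass[OF assms e'] obtain a m where
    am: "\<And>s. s \<in> {0..1} \<Longrightarrow> cmod (U s - (\<Sum>i\<le>m. a i * of_real s ^ i)) < e / (norm x + 1)"
    by blast
  let ?p = "\<lambda>s. \<Sum>i\<le>m. a i * complex_of_real s ^ i"
  have "(\<lambda>n. bern ?p n x) \<longlonglongrightarrow> (\<Sum>i\<le>m. a i *\<^sub>C (R ^^ i) x)"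
    by (simp add: bern_sum bern_scale)
      (intro tendsto_sum bounded_linear.tendsto[OF bounded_linear_scaleC] bern_power)
  then have "convergent (\<lambda>n. bern ?p n x)" by (rule convergentI)
  moreover have "norm (bern U n x - bern ?p n x) \<le> e" for n
  proof -
    have "norm (bern U n x - bern ?p n x) \<le> e / (norm x + 1) * norm x"
      unfolding bern_diff[symmetric] by (rule norm_bern_le) (use am in \<open>force intro: less_imp_le\<close>)
    also have "\<dots> \<le> e" using \<open>e > 0\<close> by (simp add: divide_le_eq add_nonneg_pos)
    finally show ?thesis .
  qed
  ultimately show "\<exists>Y. convergent Y \<and> (\<forall>n. norm (bern U n x - Y n) \<le> e)" by blast
qed

definition Phi :: "(real \<Rightarrow> complex) \<Rightarrow> 'h \<Rightarrow> 'h" where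
  "Phi U x = lim (\<lambda>n. bern U n x)"

text \<open>\<open>R (bern U n x)\<close> is asymptotic to the approximants of \<open>s U(s)\<close>, which is continuous on the closed interval;
  hence convergence holds on the dense range of \<open>R\<close>.\<close>

lemma bern_Phi:
  assumes "U \<in> bcont_unit"
  shows "(\<lambda>n. bern U n x) \<longlonglongrightarrow> Phi U x"
proof -
  obtain M where M: "M > 0" "\<And>s. s \<in> {0<..1} \<Longrightarrow> cmod (U s) \<le> M"
    using bcont_unit_bound[OF assms] by blast
  note cont = continuous_bcont_unit_mult_id[OF assms]
  have "convergent (\<lambda>n. bern U n x)"
  proof (rule convergent_uniform_approx)
    fix e :: real assume e: "e > 0"
    have "x \<in> closure (range R)" by (simp add: dense_R)
    then obtain y where y: "dist (R y) x < e / M"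
      using e M(1) unfolding closure_approachable by (metis divide_pos_pos imageE)
    have "convergent (\<lambda>n. bern (\<lambda>s. U s * of_real s) (Suc n) y)"
      using convergent_bern_continuous[OF cont] by (subst convergent_Suc_iff)
    then have "convergent (\<lambda>n. (R (bern U n y) - bern (\<lambda>s. U s * of_real s) (Suc n) y)
        + bern (\<lambda>s. U s * of_real s) (Suc n) y)"
      by (intro convergent_add convergentI[OF bern_step[OF cont]])
    then have "convergent (\<lambda>n. bern U n (R y))"
      by (simp add: bern_def R_wsum)
    moreover have "norm (bern U n x - bern U n (R y)) \<le> e" for n
    proof -
      have "norm (bern U n (x - R y)) \<le> M * norm (x - R y)"
        by (rule norm_bern_le) (rule M(2))
      also have "\<dots> \<le> M * (e / M)"
        using y M(1) by (intro mult_left_mono) (auto simp: dist_norm norm_minus_commute)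
      finally show ?thesis
        using M(1) by (simp add: linear_diff[OF bounded_clinear_linear[OF clinear_bern]])
    qed
    ultimately show "\<exists>Y. convergent Y \<and> (\<forall>n. norm (bern U n x - Y n) \<le> e)" by blast
  qed
  then show ?thesis unfolding Phi_def by (rule convergent_LIMSEQ_iff[THEN iffD1])
qed

lemma Phi_eqI: "U \<in> bcont_unit \<Longrightarrow> (\<lambda>n. bern U n x) \<longlonglongrightarrow> y \<Longrightarrow> Phi U x = y"
  using bern_Phi LIMSEQ_unique by blast

lemma norm_Phi_le:
  assumes "U \<in> bcont_unit" "\<And>s. s \<in> {0<..1} \<Longrightarrow> cmod (U s) \<le> M"
  shows "norm (Phi U x) \<le> M * norm x"
  using tendsto_norm[OF bern_Phi[OF assms(1)]]
  by (rule LIMSEQ_le_const2) (auto intro: norm_bern_le assms(2))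

lemma Phi_add:
  assumes "U \<in> bcont_unit" "V \<in> bcont_unit"
  shows "Phi (\<lambda>s. U s + V s) x = Phi U x + Phi V x"
  by (rule Phi_eqI) (auto simp: bern_add intro!: tendsto_add bern_Phi bcont_unit_add assms)

lemma Phi_scale:
  assumes "U \<in> bcont_unit"
  shows "Phi (\<lambda>s. c * U s) x = c *\<^sub>C Phi U x"
  by (rule Phi_eqI)
    (auto simp: bern_scale intro!: bounded_linear.tendsto[OF bounded_linear_scaleC] bern_Phi bcont_unit_scale assms)

lemma Phi_one: "Phi (\<lambda>s. 1) x = x"
  by (rule Phi_eqI) (simp_all add: bcont_unit_const bern_def wsum_one)

lemma Phi_sum:
  "finite I \<Longrightarrow> (\<And>i. i \<in> I \<Longrightarrow> F i \<in> bcont_unit) \<Longrightarrow> Phi (\<lambda>s. \<Sum>i\<in>I. F i s) x = (\<Sum>i\<in>I. Phi (F i) x)"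
  by (rule Phi_eqI) (auto simp: bern_sum intro!: tendsto_sum bern_Phi bcont_unit_sum)

lemma Phi_clinear:
  assumes "U \<in> bcont_unit"
  shows "bounded_clinear (Phi U)"
proof -
  obtain M where M: "\<And>s. s \<in> {0<..1} \<Longrightarrow> cmod (U s) \<le> M"
    using bcont_unit_bound[OF assms] by blast
  have add: "Phi U (x + y) = Phi U x + Phi U y" for x y
    by (rule Phi_eqI[OF assms])
      (auto simp: linear_add[OF bounded_clinear_linear[OF clinear_bern]] intro!: tendsto_add bern_Phi assms)
  have scale: "Phi U (c *\<^sub>C x) = c *\<^sub>C Phi U x" for c x
    by (rule Phi_eqI[OF assms])
      (auto simp: bounded_clinear_scaleC[OF clinear_bern]
        intro!: bounded_linear.tendsto[OF bounded_linear_scaleC] bern_Phi assms)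
  show ?thesis
    unfolding bounded_clinear_def
    using add scale norm_Phi_le[OF assms M]
    by (auto intro!: bounded_linear_intro[where K = M] simp: scaleR_scaleC mult.commute[of M])
qed

lemma Phi_adjoint:
  assumes "U \<in> bcont_unit"
  shows "cinner (Phi U x) y = cinner x (Phi (\<lambda>s. cnj (U s)) y)"
proof (rule LIMSEQ_unique)
  show "(\<lambda>n. cinner (bern U n x) y) \<longlonglongrightarrow> cinner (Phi U x) y"
    by (intro tendsto_cinner_left bern_Phi assms)
  have "(\<lambda>n. cinner x (bern (\<lambda>s. cnj (U s)) n y)) \<longlonglongrightarrow> cinner x (Phi (\<lambda>s. cnj (U s)) y)"
    by (intro tendsto_cinner_right bern_Phi bcont_unit_cnj assms)
  then show "(\<lambda>n. cinner (bern U n x) y) \<longlonglongrightarrow> cinner x (Phi (\<lambda>s. cnj (U s)) y)"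
    by (simp add: bern_def wsum_adjoint)
qed

lemma R_Phi:
  assumes "U \<in> bcont_unit"
  shows "R (Phi U x) = Phi (\<lambda>s. U s * of_real s) x"
proof (rule LIMSEQ_unique)
  show "(\<lambda>n. R (bern U n x)) \<longlonglongrightarrow> R (Phi U x)"
    by (intro bounded_clinear_tendsto[OF clinear_R] bern_Phi assms)
  have "(\<lambda>n. (R (bern U n x) - bern (\<lambda>s. U s * of_real s) (Suc n) x)
      + bern (\<lambda>s. U s * of_real s) (Suc n) x) \<longlonglongrightarrow> 0 + Phi (\<lambda>s. U s * of_real s) x"
    by (intro tendsto_add bern_step continuous_bcont_unit_mult_id assms
        LIMSEQ_Suc[OF bern_Phi[OF bcont_unit_mult[OF assms bcont_unit_of_real]]])
  then show "(\<lambda>n. R (bern U n x)) \<longlonglongrightarrow> Phi (\<lambda>s. U s * of_real s) x" by simp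
qed

text \<open>The kernel of a symmetric operator is orthogonal to its range, which is dense
  here.\<close>

lemma R_eq_zero: "R x = 0 \<Longrightarrow> x = 0"
proof (rule cinner_zero_dense[OF dense_R])
  fix y assume "R x = 0" "y \<in> range R"
  then show "cinner y x = 0" by (auto simp: symmetric_R)
qed

lemma Phi_power_mult:
  assumes "V \<in> bcont_unit"
  shows "Phi (\<lambda>s. of_real s ^ m * V s) x = (R ^^ m) (Phi V x)"
proof (induction m)
  case (Suc m)
  have "R ((R ^^ m) (Phi V x)) = Phi (\<lambda>s. (of_real s ^ m * V s) * of_real s) x"
    unfolding Suc[symmetric] by (intro R_Phi bcont_unit_mult bcont_unit_power assms)
  then show ?case by (simp add: mult_ac)
qed simp

lemma Phi_poly_mult:
  assumes "V \<in> bcont_unit"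
  shows "Phi (\<lambda>s. (\<Sum>i\<le>m. a i * of_real s ^ i) * V s) x = Phi (\<lambda>s. \<Sum>i\<le>m. a i * of_real s ^ i) (Phi V x)"
proof -
  have "Phi (\<lambda>s. (\<Sum>i\<le>m. a i * of_real s ^ i) * W s) z = (\<Sum>i\<le>m. a i *\<^sub>C (R ^^ i) (Phi W z))"
    if W: "W \<in> bcont_unit" for W z
    by (simp add: sum_distrib_right mult.assoc Phi_sum bcont_unit_scale bcont_unit_mult
        bcont_unit_power W Phi_scale Phi_power_mult)
  from this[OF assms] this[OF bcont_unit_const[of 1]] show ?thesis by (simp add: Phi_one)
qed

text \<open>Write \<open>U = p + q\<close> with a polynomial \<open>p\<close> and \<open>q\<close>
  uniformly small. The identity is exact for \<open>p\<close>, and the contribution of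
  \<open>q\<close> to either side is at most \<open>e * M * norm x\<close>.\<close>

lemma Phi_mult_continuous:
  assumes U: "continuous_on {0..1} U" and V: "V \<in> bcont_unit"
  shows "Phi (\<lambda>s. U s * V s) x = Phi U (Phi V x)"
proof -
  obtain M where M: "M > 0" "\<And>s. s \<in> {0<..1} \<Longrightarrow> cmod (V s) \<le> M"
    using bcont_unit_bound[OF V] by blast
  note U' = bcont_unit_continuous[OF U]
  have small: "norm (Phi (\<lambda>s. U s * V s) x - Phi U (Phi V x)) \<le> e * (2 * M * norm x)" if e: "e > 0" for e
  proof -
    from complex_Weierstrass[OF U e] obtain a m where
      am: "\<And>s. s \<in> {0..1} \<Longrightarrow> cmod (U s - (\<Sum>i\<le>m. a i * of_real s ^ i)) < e"
      by blast
    define p where "p = (\<lambda>s. \<Sum>i\<le>m. a i * complex_of_real s ^ i)"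
    define q where "q = (\<lambda>s. U s - p s)"
    have "p \<in> bcont_unit"
      unfolding p_def by (intro bcont_unit_sum bcont_unit_scale bcont_unit_power)
    then have p: "p \<in> bcont_unit" "q \<in> bcont_unit"
      using bcont_unit_add[OF U' bcont_unit_scale[of p "-1"]] by (simp_all add: q_def)
    have q: "cmod (q s) \<le> e" if "s \<in> {0<..1}" for s
      using am[of s] that by (auto simp: q_def p_def intro: less_imp_le)
    have U_eq: "U s = q s + p s" for s by (simp add: q_def)
    have "Phi (\<lambda>s. U s * V s) x = Phi (\<lambda>s. q s * V s) x + Phi (\<lambda>s. p s * V s) x"
      unfolding U_eq distrib_right by (intro Phi_add bcont_unit_mult p V)
    moreover have "Phi U (Phi V x) = Phi q (Phi V x) + Phi p (Phi V x)"
      using Phi_add[OF p(2,1)] by (simp flip: U_eq)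
    moreover have "Phi (\<lambda>s. p s * V s) x = Phi p (Phi V x)"
      unfolding p_def by (rule Phi_poly_mult[OF V])
    ultimately have "norm (Phi (\<lambda>s. U s * V s) x - Phi U (Phi V x))
        \<le> norm (Phi (\<lambda>s. q s * V s) x) + norm (Phi q (Phi V x))"
      by (simp add: norm_triangle_ineq4)
    also have "\<dots> \<le> (e * M) * norm x + e * (M * norm x)"
    proof (intro add_mono)
      show "norm (Phi (\<lambda>s. q s * V s) x) \<le> (e * M) * norm x"
        using e by (intro norm_Phi_le bcont_unit_mult p V) (auto simp: norm_mult intro!: mult_mono q M)
      have "norm (Phi q (Phi V x)) \<le> e * norm (Phi V x)"
        by (intro norm_Phi_le p q)
      also have "\<dots> \<le> e * (M * norm x)"
        using e by (intro mult_left_mono norm_Phi_le V M(2)) auto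
      finally show "norm (Phi q (Phi V x)) \<le> e * (M * norm x)" .
    qed
    finally show ?thesis by (simp add: algebra_simps)
  qed
  have "norm (Phi (\<lambda>s. U s * V s) x - Phi U (Phi V x)) \<le> 0"
  proof (rule field_le_epsilon)
    fix e :: real assume "e > 0"
    define K where "K = 2 * M * norm x + 1"
    have K: "K > 0" using M(1) by (simp add: K_def add_nonneg_pos)
    have "norm (Phi (\<lambda>s. U s * V s) x - Phi U (Phi V x)) \<le> e / K * (2 * M * norm x)"
      by (rule small) (use \<open>e > 0\<close> K in simp)
    also have "\<dots> \<le> e / K * K" using \<open>e > 0\<close> K by (intro mult_left_mono) (auto simp: K_def)
    finally show "norm (Phi (\<lambda>s. U s * V s) x - Phi U (Phi V x)) \<le> 0 + e" using K by simp
  qed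
  then show ?thesis by simp
qed

text \<open>\<open>U\<close> need not extend continuously to 0. Applying \<open>R\<close> to both
  sides replaces \<open>U(s)\<close> by \<open>s U(s)\<close>, which does, and injectivity of
  \<open>R\<close> removes the extra factor.\<close>

lemma Phi_mult:
  assumes U: "U \<in> bcont_unit" and V: "V \<in> bcont_unit"
  shows "Phi (\<lambda>s. U s * V s) x = Phi U (Phi V x)"
proof -
  have "R (Phi (\<lambda>s. U s * V s) x) = Phi (\<lambda>s. (U s * of_real s) * V s) x"
    by (simp add: R_Phi bcont_unit_mult U V mult_ac)
  also have "\<dots> = Phi (\<lambda>s. U s * of_real s) (Phi V x)"
    by (rule Phi_mult_continuous[OF continuous_bcont_unit_mult_id[OF U] V])
  also have "\<dots> = R (Phi U (Phi V x))"
    by (simp add: R_Phi U)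
  finally have "R (Phi (\<lambda>s. U s * V s) x - Phi U (Phi V x)) = 0"
    by (simp add: linear_diff[OF bounded_clinear_linear[OF clinear_R]])
  then show ?thesis using R_eq_zero by fastforce
qed

lemma Phi_of_real: "Phi of_real x = R x"
  using R_Phi[OF bcont_unit_const[of 1], of x] by (simp add: Phi_one)

lemma Phi_cong:
  assumes "\<And>s. s \<in> {0<..1} \<Longrightarrow> U s = V s"
  shows "Phi U = Phi V"
proof -
  have "bern U n x = bern V n x" for n x
    unfolding bern_def wsum_def using assms[OF node_mem] by (intro sum.cong) auto
  then show ?thesis by (simp add: Phi_def fun_eq_iff)
qed

end

section \<open>Functional calculus of an unbounded operator\<close>

lemma bcont_nonnegI:
  "continuous_on {0..} u \<Longrightarrow> (\<And>t. t \<ge> 0 \<Longrightarrow> cmod (u t) \<le> M) \<Longrightarrow> u \<in> bcont_nonneg"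
  by (auto simp: bcont_nonneg_def bounded_iff)

lemma bcont_nonneg_bound:
  assumes "u \<in> bcont_nonneg"
  obtains M where "M > 0" "\<And>t. t \<ge> 0 \<Longrightarrow> cmod (u t) \<le> M"
proof -
  obtain M where "\<And>t. t \<ge> 0 \<Longrightarrow> cmod (u t) \<le> M"
    using assms unfolding bcont_nonneg_def bounded_iff by force
  then show ?thesis by (intro that[of "max M 1"]) (auto simp: le_max_iff_disj)
qed

lemma bcont_nonneg_const: "(\<lambda>t. c) \<in> bcont_nonneg"
  by (rule bcont_nonnegI[of _ "cmod c"]) auto

lemma bcont_nonneg_add:
  assumes "u \<in> bcont_nonneg" "v \<in> bcont_nonneg"
  shows "(\<lambda>t. u t + v t) \<in> bcont_nonneg"
  using assms by (auto simp: bcont_nonneg_def intro!: continuous_intros bounded_plus_comp)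

lemma bcont_nonneg_mult:
  assumes "u \<in> bcont_nonneg" "v \<in> bcont_nonneg"
  shows "(\<lambda>t. u t * v t) \<in> bcont_nonneg"
proof -
  obtain M where M: "M > 0" "\<And>t. t \<ge> 0 \<Longrightarrow> cmod (u t) \<le> M"
    using bcont_nonneg_bound[OF assms(1)] by blast
  obtain N where N: "N > 0" "\<And>t. t \<ge> 0 \<Longrightarrow> cmod (v t) \<le> N"
    using bcont_nonneg_bound[OF assms(2)] by blast
  show ?thesis
  proof (rule bcont_nonnegI)
    show "continuous_on {0..} (\<lambda>t. u t * v t)"
      using assms by (auto simp: bcont_nonneg_def intro!: continuous_intros)
    show "cmod (u t * v t) \<le> M * N" if "t \<ge> 0" for t
      using M N that by (auto simp: norm_mult intro!: mult_mono)
  qed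
qed

lemma bcont_nonneg_scale: "u \<in> bcont_nonneg \<Longrightarrow> (\<lambda>t. c * u t) \<in> bcont_nonneg"
  by (rule bcont_nonneg_mult[OF bcont_nonneg_const])

lemma bcont_nonneg_shift:
  assumes "u \<in> bcont_nonneg" "(\<lambda>t. of_real t * u t) \<in> bcont_nonneg"
  shows "(\<lambda>t. (of_real t - z) * u t) \<in> bcont_nonneg"
  using bcont_nonneg_add[OF assms(2) bcont_nonneg_scale[OF assms(1), of "- z"]]
  by (simp add: algebra_simps)

definition bcont_real :: "(real \<Rightarrow> real) set" where
  "bcont_real = {u. continuous_on {0..} u \<and> bounded (u ` {0..})}"

lemma bcont_real_iff: "u \<in> bcont_real \<longleftrightarrow> (\<lambda>t. complex_of_real (u t)) \<in> bcont_nonneg"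
proof -
  have "continuous_on {0..} u" if "continuous_on {0..} (\<lambda>t. complex_of_real (u t))"
    using continuous_on_Re[OF that] by simp
  then show ?thesis
    by (auto simp: bcont_real_def bcont_nonneg_def bounded_iff intro: continuous_on_of_real)
qed

lemma bcont_realI:
  "continuous_on {0..} u \<Longrightarrow> (\<And>t. t \<ge> 0 \<Longrightarrow> \<bar>u t\<bar> \<le> M) \<Longrightarrow> u \<in> bcont_real"
  by (auto simp: bcont_real_def bounded_iff)

lemma bcont_real_const: "(\<lambda>t. c) \<in> bcont_real"
  using bcont_nonneg_const[of "of_real c"] by (simp add: bcont_real_iff)

lemma bcont_real_add: "u \<in> bcont_real \<Longrightarrow> v \<in> bcont_real \<Longrightarrow> (\<lambda>t. u t + v t) \<in> bcont_real"
  using bcont_nonneg_add by (simp add: bcont_real_iff)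

lemma bcont_real_mult: "u \<in> bcont_real \<Longrightarrow> v \<in> bcont_real \<Longrightarrow> (\<lambda>t. u t * v t) \<in> bcont_real"
  using bcont_nonneg_mult by (simp add: bcont_real_iff)

lemma bcont_real_diff:
  assumes "u \<in> bcont_real" "v \<in> bcont_real"
  shows "(\<lambda>t. u t - v t) \<in> bcont_real"
  using bcont_real_add[OF assms(1) bcont_real_mult[OF bcont_real_const[of "-1"] assms(2)]] by simp

definition rec :: "real \<Rightarrow> real" where "rec t = 1 / (t + 1)"

lemma rec_bcont: "rec \<in> bcont_real"
  unfolding rec_def by (rule bcont_realI[where M = 1]) (auto intro!: continuous_intros)

text \<open>A clipped parabola rather than a tent: \<open>1 - bump \<mu> \<epsilon> t\<close> is
  then divisible by \<open>t - \<mu>\<close> with a bounded continuous quotient, which is what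
  inverting \<open>t - \<mu>\<close> modulo the bump requires.\<close>

definition bump :: "real \<Rightarrow> real \<Rightarrow> real \<Rightarrow> real" where
  "bump \<mu> \<epsilon> t = max 0 (1 - ((t - \<mu>) / \<epsilon>)\<^sup>2)"

lemma bump_nonneg: "0 \<le> bump \<mu> \<epsilon> t"
  and bump_le_one: "bump \<mu> \<epsilon> t \<le> 1"
  by (simp_all add: bump_def)

lemma continuous_bump: "continuous_on X (bump \<mu> \<epsilon>)"
  unfolding bump_def by (simp add: divide_inverse) (intro continuous_intros)

lemma bump_pos_iff:
  assumes "\<epsilon> > 0"
  shows "0 < bump \<mu> \<epsilon> t \<longleftrightarrow> \<bar>t - \<mu>\<bar> < \<epsilon>"
  using assms by (simp add: bump_def less_max_iff_disj abs_square_less_1 abs_divide divide_less_eq)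

lemma bump_eq_0:
  assumes "\<epsilon> > 0" "\<bar>t - \<mu>\<bar> \<ge> \<epsilon>"
  shows "bump \<mu> \<epsilon> t = 0"
  using bump_pos_iff[OF assms(1), of \<mu> t] bump_nonneg[of \<mu> \<epsilon> t] assms(2) by linarith

lemma bump_bcont: "bump \<mu> \<epsilon> \<in> bcont_real"
  by (rule bcont_realI[where M = 1]) (auto simp: bump_nonneg bump_le_one continuous_bump)

lemmas bcont_real_intros = bcont_real_const bcont_real_diff bcont_real_add bcont_real_mult rec_bcont bump_bcont

lemma mult_bump_le:
  assumes "\<epsilon> > 0"
  shows "\<bar>(t - \<mu>) * bump \<mu> \<epsilon> t\<bar> \<le> \<epsilon> * bump \<mu> \<epsilon> t"
proof (cases "\<bar>t - \<mu>\<bar> < \<epsilon>")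
  case True
  then show ?thesis by (auto simp: abs_mult bump_nonneg intro!: mult_right_mono)
qed (use assms in \<open>simp add: bump_eq_0\<close>)

lemma mult_bump_bcont:
  assumes "\<epsilon> > 0"
  shows "(\<lambda>t. (t - \<mu>) * bump \<mu> \<epsilon> t) \<in> bcont_real"
proof (rule bcont_realI)
  show "continuous_on {0..} (\<lambda>t. (t - \<mu>) * bump \<mu> \<epsilon> t)"
    by (intro continuous_intros continuous_bump)
  show "\<bar>(t - \<mu>) * bump \<mu> \<epsilon> t\<bar> \<le> \<epsilon>" for t
    using mult_bump_le[OF assms, of t \<mu>] bump_le_one[of \<mu> \<epsilon> t] assms
    by (meson mult_left_le order_trans less_imp_le)
qed

lemma id_bump_bcont:
  assumes "\<epsilon> > 0"
  shows "(\<lambda>t. t * bump \<mu> \<epsilon> t) \<in> bcont_real"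
proof -
  have "(\<lambda>t. (t - \<mu>) * bump \<mu> \<epsilon> t + \<mu> * bump \<mu> \<epsilon> t) \<in> bcont_real"
    by (intro bcont_real_intros mult_bump_bcont assms)
  then show ?thesis by (simp add: algebra_simps)
qed

text \<open>Of the resolvents, the assumptions fix only the one at -1, as the operator of
  \<open>rec\<close>; \<open>inverse_imp_resolvent\<close> recovers the others. In this form the
  locale can be verified for the constructed map before its resolvents are known.\<close>

locale calculus =
  fixes D :: "'h::complex_hilbert set" and H R :: "'h \<Rightarrow> 'h"
    and \<Phi> :: "(real \<Rightarrow> complex) \<Rightarrow> 'h \<Rightarrow> 'h"
  assumes clinear_H: "clinear_on D H"
    and R_mem: "R x \<in> D"
    and H_R: "H (R x) + R x = x"
    and R_shift: "y \<in> D \<Longrightarrow> R (H y + y) = y"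
    and Phi_clinear: "u \<in> bcont_nonneg \<Longrightarrow> bounded_clinear (\<Phi> u)"
    and Phi_cong: "u \<in> bcont_nonneg \<Longrightarrow> v \<in> bcont_nonneg \<Longrightarrow> (\<And>t. t \<ge> 0 \<Longrightarrow> u t = v t) \<Longrightarrow> \<Phi> u = \<Phi> v"
    and Phi_add: "u \<in> bcont_nonneg \<Longrightarrow> v \<in> bcont_nonneg \<Longrightarrow> \<Phi> (\<lambda>t. u t + v t) x = \<Phi> u x + \<Phi> v x"
    and Phi_scale: "u \<in> bcont_nonneg \<Longrightarrow> \<Phi> (\<lambda>t. c * u t) x = c *\<^sub>C \<Phi> u x"
    and Phi_mult: "u \<in> bcont_nonneg \<Longrightarrow> v \<in> bcont_nonneg \<Longrightarrow> \<Phi> (\<lambda>t. u t * v t) x = \<Phi> u (\<Phi> v x)"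
    and Phi_one: "\<Phi> (\<lambda>t. 1) x = x"
    and Phi_adjoint: "u \<in> bcont_nonneg \<Longrightarrow> cinner (\<Phi> u x) y = cinner x (\<Phi> (\<lambda>t. cnj (u t)) y)"
    and Phi_R: "\<Phi> (\<lambda>t. complex_of_real (rec t)) x = R x"
begin

lemma Phi_diff:
  assumes "u \<in> bcont_nonneg" "v \<in> bcont_nonneg"
  shows "\<Phi> (\<lambda>t. u t - v t) x = \<Phi> u x - \<Phi> v x"
  using Phi_add[OF assms(1) bcont_nonneg_scale[OF assms(2), of "-1"], of x] Phi_scale[OF assms(2), of "-1"]
  by (simp add: scaleC_minus_one)

lemma rec_bcont_nonneg: "(\<lambda>t. complex_of_real (rec t)) \<in> bcont_nonneg"
  using rec_bcont by (simp add: bcont_real_iff)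

text \<open>Factor \<open>u\<close> as \<open>rec\<close> times \<open>(t + 1) u(t)\<close>, which
  is bounded by hypothesis. Then \<open>\<Phi> u x\<close> lies in the range of \<open>R\<close>,
  and \<open>H_R\<close> computes \<open>H\<close> on it.\<close>

lemma Phi_domain:
  assumes "u \<in> bcont_nonneg" "(\<lambda>t. of_real t * u t) \<in> bcont_nonneg"
  shows "\<Phi> u x \<in> D" "H (\<Phi> u x) = \<Phi> (\<lambda>t. of_real t * u t) x"
proof -
  let ?v = "\<lambda>t. of_real t * u t + u t"
  have v: "?v \<in> bcont_nonneg" by (intro bcont_nonneg_add assms)
  have eq: "\<Phi> u x = R (\<Phi> ?v x)"
  proof -
    have "complex_of_real t + 1 \<noteq> 0" if "t \<ge> 0" for t
      using that by (metis of_real_1 of_real_add of_real_eq_0_iff add_nonneg_pos less_irrefl zero_less_one)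
    then have "u t = complex_of_real (rec t) * ?v t" if "t \<ge> 0" for t
      using that by (simp add: rec_def field_simps)
    then have "\<Phi> u = \<Phi> (\<lambda>t. complex_of_real (rec t) * ?v t)"
      by (intro Phi_cong bcont_nonneg_mult rec_bcont_nonneg v assms) auto
    then show ?thesis by (simp add: Phi_mult rec_bcont_nonneg v Phi_R)
  qed
  show "\<Phi> u x \<in> D" unfolding eq by (rule R_mem)
  have "H (\<Phi> u x) = \<Phi> ?v x - \<Phi> u x"
    unfolding eq using H_R[of "\<Phi> ?v x"] by (simp add: eq_diff_eq)
  then show "H (\<Phi> u x) = \<Phi> (\<lambda>t. of_real t * u t) x"
    by (simp add: Phi_add assms)
qed

lemma Phi_shift:
  assumes "u \<in> bcont_nonneg" "(\<lambda>t. of_real t * u t) \<in> bcont_nonneg"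
  shows "H (\<Phi> u x) - z *\<^sub>C \<Phi> u x = \<Phi> (\<lambda>t. (of_real t - z) * u t) x"
  using Phi_diff[OF assms(2) bcont_nonneg_scale[OF assms(1), of z]]
  by (simp add: Phi_domain[OF assms] Phi_scale assms left_diff_distrib)

text \<open>The unbounded \<open>t - z\<close> is expressed by a bounded function acting on
  \<open>H y + y\<close>, since \<open>(t - z) / (t + 1) = 1 - (z + 1) rec(t)\<close>.\<close>

lemma shift_eq_Phi:
  assumes "y \<in> D"
  shows "H y - z *\<^sub>C y = \<Phi> (\<lambda>t. 1 - (z + 1) * of_real (rec t)) (H y + y)"
  using assms
  by (simp add: Phi_diff bcont_nonneg_const bcont_nonneg_scale rec_bcont_nonneg Phi_one Phi_scale Phi_R
      R_shift scaleC_add_left)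

text \<open>The inverse relation is required of operators, not pointwise, so that it also covers
  functions with \<open>(t - z) v(t) = 1 - bump \<mu> \<epsilon> t\<close> when that bump is
  annihilated. The right inverse is \<open>Phi_shift\<close>; for the left one the unbounded factor
  is first moved onto \<open>H y + y\<close>.\<close>

lemma inverse_imp_resolvent:
  assumes v: "v \<in> bcont_nonneg" and tv: "(\<lambda>t. of_real t * v t) \<in> bcont_nonneg"
    and inv: "\<And>x. \<Phi> (\<lambda>t. (of_real t - z) * v t) x = x"
  shows "bij_betw (\<lambda>x. H x - z *\<^sub>C x) D UNIV" "resolvent_op D H z = \<Phi> v" "z \<notin> spectrum_op D H"
proof -
  have right: "H (\<Phi> v x) - z *\<^sub>C \<Phi> v x = x" for x
    by (simp add: Phi_shift v tv inv)
  note tzv = bcont_nonneg_shift[OF v tv, of z]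
  have left: "\<Phi> v (H y - z *\<^sub>C y) = y" if y: "y \<in> D" for y
  proof -
    let ?q = "\<lambda>t. 1 - (z + 1) * complex_of_real (rec t)"
    have q: "?q \<in> bcont_nonneg"
      using bcont_nonneg_add[OF bcont_nonneg_const[of 1] bcont_nonneg_scale[OF rec_bcont_nonneg, of "- (z + 1)"]]
      by (simp add: algebra_simps)
    have "\<Phi> v (H y - z *\<^sub>C y) = \<Phi> (\<lambda>t. v t * ?q t) (H y + y)"
      by (simp only: Phi_mult v q shift_eq_Phi[OF y])
    also have "\<Phi> (\<lambda>t. v t * ?q t) = \<Phi> (\<lambda>t. of_real (rec t) * ((of_real t - z) * v t))"
    proof (rule Phi_cong[OF bcont_nonneg_mult[OF v q] bcont_nonneg_mult[OF rec_bcont_nonneg tzv]])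
      fix t :: real assume "t \<ge> 0"
      then have "complex_of_real t + 1 \<noteq> 0"
        by (metis of_real_1 of_real_add of_real_eq_0_iff add_nonneg_pos less_irrefl zero_less_one)
      then show "v t * ?q t = of_real (rec t) * ((of_real t - z) * v t)"
        by (simp add: rec_def field_simps)
    qed
    also have "\<dots> (H y + y) = R (H y + y)"
      by (simp only: Phi_mult rec_bcont_nonneg tzv inv Phi_R)
    finally show ?thesis using R_shift[OF y] by simp
  qed
  show bij: "bij_betw (\<lambda>x. H x - z *\<^sub>C x) D UNIV"
    by (rule bij_betw_byWitness[where f' = "\<Phi> v"]) (auto simp: left right intro: Phi_domain(1)[OF v tv])
  have "inv_into D (\<lambda>x. H x - z *\<^sub>C x) x = \<Phi> v x" for x
    by (rule inv_into_f_eq) (use bij in \<open>auto simp: bij_betw_def right intro: Phi_domain(1)[OF v tv]\<close>)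
  then show res: "resolvent_op D H z = \<Phi> v" by (auto simp: resolvent_op_def)
  show "z \<notin> spectrum_op D H"
    using bij Phi_clinear[OF v] by (simp add: spectrum_op_def res bounded_clinear_def)
qed

text \<open>The closed half-line has a positive distance \<open>d\<close> from \<open>z\<close>, so
  \<open>1 / (t - z)\<close> is bounded by \<open>1 / d\<close>, and
  \<open>t / (t - z) = 1 + z / (t - z)\<close> is bounded as well.\<close>

lemma resolvent_off_halfline:
  assumes z: "z \<notin> complex_of_real ` {0..}"
  shows "resolvent_op D H z = \<Phi> (\<lambda>t. 1 / (of_real t - z))" "z \<notin> spectrum_op D H"
proof -
  have "closed (complex_of_real ` {0..})"
    by (rule closed_injective_linear_image) (auto simp: inj_def intro: bounded_linear.linear bounded_linear_of_real)
  then obtain d where d: "d > 0" "\<And>t. t \<ge> 0 \<Longrightarrow> d \<le> dist z (of_real t)"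
    using separate_point_closed[OF _ z] by auto
  have ne: "complex_of_real t - z \<noteq> 0" if "t \<ge> 0" for t
    using d that by force
  let ?v = "\<lambda>t. 1 / (complex_of_real t - z)"
  have v: "?v \<in> bcont_nonneg"
  proof (rule bcont_nonnegI)
    show "continuous_on {0..} ?v" using ne by (auto intro!: continuous_intros)
    show "cmod (?v t) \<le> 1 / d" if "t \<ge> 0" for t
      using d(1) d(2)[OF that] by (auto simp: norm_divide dist_norm norm_minus_commute intro!: frac_le)
  qed
  have "(\<lambda>t. 1 + z * ?v t) \<in> bcont_nonneg"
    by (intro bcont_nonneg_add bcont_nonneg_const bcont_nonneg_scale v)
  moreover have eq: "of_real t * ?v t = 1 + z * ?v t" if "t \<ge> 0" for t
    using ne[OF that] by (simp add: field_simps)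
  then have "continuous_on {0..} (\<lambda>t. of_real t * ?v t) = continuous_on {0..} (\<lambda>t. 1 + z * ?v t)"
    "(\<lambda>t. of_real t * ?v t) ` {0..} = (\<lambda>t. 1 + z * ?v t) ` {0..}"
    by (auto intro!: continuous_on_cong image_cong simp del: times_divide_eq_right)
  ultimately have tv: "(\<lambda>t. of_real t * ?v t) \<in> bcont_nonneg"
    by (simp add: bcont_nonneg_def)
  note tzv = bcont_nonneg_shift[OF v tv, of z]
  have "\<Phi> (\<lambda>t. (of_real t - z) * ?v t) = \<Phi> (\<lambda>t. 1)"
    by (rule Phi_cong[OF tzv bcont_nonneg_const]) (use ne in simp)
  then have "\<Phi> (\<lambda>t. (of_real t - z) * ?v t) x = x" for x by (simp only: Phi_one)
  from inverse_imp_resolvent[OF v tv this]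
  show "resolvent_op D H z = \<Phi> ?v" "z \<notin> spectrum_op D H" by auto
qed

end

section \<open>Operators of real functions, bumps and the spectrum\<close>

context calculus
begin

definition F :: "(real \<Rightarrow> real) \<Rightarrow> 'h \<Rightarrow> 'h" where
  "F u = \<Phi> (\<lambda>t. complex_of_real (u t))"

lemma F_clinear: "u \<in> bcont_real \<Longrightarrow> bounded_clinear (F u)"
  by (simp add: F_def Phi_clinear bcont_real_iff)

lemma F_add: "u \<in> bcont_real \<Longrightarrow> v \<in> bcont_real \<Longrightarrow> F (\<lambda>t. u t + v t) x = F u x + F v x"
  by (simp add: F_def Phi_add bcont_real_iff)

lemma F_diff: "u \<in> bcont_real \<Longrightarrow> v \<in> bcont_real \<Longrightarrow> F (\<lambda>t. u t - v t) x = F u x - F v x"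
  by (simp add: F_def Phi_diff bcont_real_iff)

lemma F_mult: "u \<in> bcont_real \<Longrightarrow> v \<in> bcont_real \<Longrightarrow> F (\<lambda>t. u t * v t) x = F u (F v x)"
  by (simp add: F_def Phi_mult bcont_real_iff)

lemma F_scale: "u \<in> bcont_real \<Longrightarrow> F (\<lambda>t. c * u t) x = c *\<^sub>R F u x"
  by (simp add: F_def Phi_scale bcont_real_iff scaleR_scaleC)

lemma F_const: "F (\<lambda>t. c) x = c *\<^sub>R x"
  using Phi_scale[OF bcont_nonneg_const[of 1], of "of_real c" x]
  by (simp add: F_def Phi_one scaleR_scaleC)

lemma F_rec: "F rec x = R x"
  by (simp add: F_def Phi_R)

lemma F_cong:
  "u \<in> bcont_real \<Longrightarrow> v \<in> bcont_real \<Longrightarrow> (\<And>t. t \<ge> 0 \<Longrightarrow> u t = v t) \<Longrightarrow> F u = F v"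
  unfolding F_def by (rule Phi_cong) (simp_all add: bcont_real_iff)

lemma F_symmetric: "u \<in> bcont_real \<Longrightarrow> cinner (F u x) y = cinner x (F u y)"
  by (simp add: F_def Phi_adjoint bcont_real_iff)

lemma F_scaleR: "u \<in> bcont_real \<Longrightarrow> F u (c *\<^sub>R x) = c *\<^sub>R F u x"
  by (simp add: scaleR_scaleC bounded_clinear_scaleC[OF F_clinear])

lemma F_pos:
  assumes u: "u \<in> bcont_real" "\<And>t. t \<ge> 0 \<Longrightarrow> u t \<ge> 0"
  shows "0 \<le> Re (cinner (F u x) x)"
proof -
  let ?s = "\<lambda>t. sqrt (u t)"
  obtain M where M: "\<And>t. t \<ge> 0 \<Longrightarrow> \<bar>u t\<bar> \<le> M"
    using u(1) unfolding bcont_real_def bounded_iff by force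
  have s: "?s \<in> bcont_real"
  proof (rule bcont_realI)
    show "continuous_on {0..} ?s"
      using u(1) by (auto simp: bcont_real_def intro!: continuous_intros)
    show "\<bar>sqrt (u t)\<bar> \<le> sqrt M" if "t \<ge> 0" for t
      using M[OF that] u(2)[OF that] by simp
  qed
  have "F u = F (\<lambda>t. ?s t * ?s t)"
    by (rule F_cong[OF u(1) bcont_real_mult[OF s s]]) (simp add: u(2))
  then have "cinner (F u x) x = cinner (F ?s (F ?s x)) x"
    by (simp only: F_mult[OF s s])
  then have "cinner (F u x) x = cinner (F ?s x) (F ?s x)"
    by (simp only: F_symmetric[OF s])
  then show ?thesis by (simp add: cinner_self)
qed

lemma cinner_F_F: "u \<in> bcont_real \<Longrightarrow> v \<in> bcont_real \<Longrightarrow> cinner (F u x) (F v x) = cinner (F (\<lambda>t. v t * u t) x) x"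
  by (simp add: F_mult F_symmetric)

text \<open>The difference of the squared norms is the quadratic form of
  \<open>v\<^sup>2 - u\<^sup>2\<close>, a nonnegative function. Pointwise estimates become norm
  estimates through this lemma.\<close>

lemma F_norm_mono:
  assumes "u \<in> bcont_real" "v \<in> bcont_real" "\<And>t. t \<ge> 0 \<Longrightarrow> \<bar>u t\<bar> \<le> \<bar>v t\<bar>"
  shows "norm (F u x) \<le> norm (F v x)"
proof -
  have "0 \<le> Re (cinner (F (\<lambda>t. v t * v t - u t * u t) x) x)"
  proof (rule F_pos)
    show "0 \<le> v t * v t - u t * u t" if "t \<ge> 0" for t
      using assms(3)[OF that] abs_le_square_iff[of "u t" "v t"] by (simp add: power2_eq_square)
  qed (intro bcont_real_diff bcont_real_mult assms(1,2))
  also have "\<dots> = Re (cinner (F v x) (F v x)) - Re (cinner (F u x) (F u x))"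
    by (simp add: F_diff bcont_real_mult assms cinner_diff_left cinner_F_F)
  finally have "(norm (F u x))\<^sup>2 \<le> (norm (F v x))\<^sup>2"
    by (simp add: cinner_self)
  then show ?thesis by (simp add: power2_le_iff_abs_le)
qed

lemma norm_F_le:
  assumes "u \<in> bcont_real" "\<And>t. t \<ge> 0 \<Longrightarrow> \<bar>u t\<bar> \<le> M"
  shows "norm (F u x) \<le> M * norm x"
proof -
  have "norm (F u x) \<le> norm (F (\<lambda>t. M) x)"
    by (rule F_norm_mono) (use assms(1) in \<open>auto intro: bcont_real_const order_trans[OF assms(2) abs_ge_self]\<close>)
  also have "\<dots> = M * norm x"
    using assms(2)[of 0] by (simp add: F_const)
  finally show ?thesis .
qed

lemma F_domain:
  assumes "u \<in> bcont_real" "(\<lambda>t. t * u t) \<in> bcont_real"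
  shows "F u x \<in> D" "H (F u x) - \<mu> *\<^sub>R F u x = F (\<lambda>t. (t - \<mu>) * u t) x"
  using assms Phi_domain(1)[of "\<lambda>t. of_real (u t)" x] Phi_shift[of "\<lambda>t. of_real (u t)" x "of_real \<mu>"]
  by (simp_all add: F_def bcont_real_iff scaleR_scaleC)

lemma bump_approx:
  assumes "\<epsilon> > 0"
  shows "F (bump \<mu> \<epsilon>) x \<in> D"
    "norm (H (F (bump \<mu> \<epsilon>) x) - \<mu> *\<^sub>R F (bump \<mu> \<epsilon>) x) \<le> \<epsilon> * norm (F (bump \<mu> \<epsilon>) x)"
proof -
  note dom = F_domain[OF bump_bcont id_bump_bcont[OF assms]]
  show "F (bump \<mu> \<epsilon>) x \<in> D" by (rule dom)
  have "norm (F (\<lambda>t. (t - \<mu>) * bump \<mu> \<epsilon> t) x) \<le> norm (F (\<lambda>t. \<epsilon> * bump \<mu> \<epsilon> t) x)"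
    using mult_bump_le[OF assms] assms
    by (intro F_norm_mono mult_bump_bcont bcont_real_mult bcont_real_const bump_bcont)
      (auto simp: abs_mult[of \<epsilon>] bump_nonneg)
  then show "norm (H (F (bump \<mu> \<epsilon>) x) - \<mu> *\<^sub>R F (bump \<mu> \<epsilon>) x) \<le> \<epsilon> * norm (F (bump \<mu> \<epsilon>) x)"
    using assms by (simp add: dom F_scale bump_bcont)
qed

text \<open>If the bump at \<open>\<mu>\<close> is annihilated then \<open>(t - \<mu>) / max ((t - \<mu>)\<^sup>2) (\<epsilon>\<^sup>2)\<close> inverts
  \<open>t - \<mu>\<close> modulo that bump.\<close>

lemma bump_zero_imp_resolvent:
  assumes e: "\<epsilon> > 0" and zero: "\<And>x. F (bump \<mu> \<epsilon>) x = 0"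
  shows "complex_of_real \<mu> \<notin> spectrum_op D H"
proof -
  let ?m = "\<lambda>t. max ((t - \<mu>)\<^sup>2) (\<epsilon>\<^sup>2)"
  define v where "v t = (t - \<mu>) / ?m t" for t
  have m: "?m t > 0" for t using e by (simp add: less_max_iff_disj)
  have tv: "(t - \<mu>) * v t = 1 - bump \<mu> \<epsilon> t" for t
  proof (cases "(t - \<mu>)\<^sup>2 \<le> \<epsilon>\<^sup>2")
    case True
    then show ?thesis
      using e by (simp add: v_def bump_def max_def power_divide power2_eq_square divide_le_eq)
  next
    case False
    then have "(t - \<mu>)\<^sup>2 > \<epsilon>\<^sup>2" "t \<noteq> \<mu>" using e by auto
    then show ?thesis
      using e by (simp add: v_def bump_def max_def power_divide power2_eq_square le_divide_eq)
  qed
  have v: "v \<in> bcont_real"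
  proof (rule bcont_realI)
    have "?m t \<noteq> 0" for t using m[of t] by linarith
    then show "continuous_on {0..} v"
      unfolding v_def by (intro continuous_intros) auto
    show "\<bar>v t\<bar> \<le> 1 / \<epsilon>" for t
    proof -
      have "\<bar>t - \<mu>\<bar> * \<epsilon> \<le> ?m t"
      proof (cases "\<bar>t - \<mu>\<bar> \<le> \<epsilon>")
        case True
        then have "\<bar>t - \<mu>\<bar> * \<epsilon> \<le> \<epsilon> * \<epsilon>" using e by (intro mult_right_mono) auto
        then show ?thesis by (simp add: power2_eq_square le_max_iff_disj)
      next
        case False
        then have "\<bar>t - \<mu>\<bar> * \<epsilon> \<le> \<bar>t - \<mu>\<bar> * \<bar>t - \<mu>\<bar>" using e by (intro mult_left_mono) auto
        then show ?thesis by (simp add: power2_eq_square le_max_iff_disj)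
      qed
      then show ?thesis using m[of t] e by (simp add: v_def abs_divide field_simps)
    qed
  qed
  have tv': "(\<lambda>t. t * v t) \<in> bcont_real"
  proof -
    have "(\<lambda>t. (1 - bump \<mu> \<epsilon> t) + \<mu> * v t) \<in> bcont_real"
      by (intro bcont_real_add bcont_real_diff bcont_real_mult bcont_real_const bump_bcont v)
    then show ?thesis by (simp add: tv[symmetric] algebra_simps)
  qed
  have "F (\<lambda>t. (t - \<mu>) * v t) x = x" for x
    by (simp add: tv F_diff bcont_real_const bump_bcont F_const zero)
  then show ?thesis
    using inverse_imp_resolvent(3)[of "\<lambda>t. of_real (v t)" "of_real \<mu>"] v tv'
    by (simp add: F_def bcont_real_iff)
qed

text \<open>With \<open>K\<close> a bound of the resolvent and radius \<open>1 / (2 * K)\<close>, a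
  vector \<open>y\<close> in the range of the bump satisfies
  \<open>norm y \<le> norm y / 2\<close>.\<close>

lemma resolvent_imp_bump_zero:
  assumes "complex_of_real \<mu> \<notin> spectrum_op D H"
  obtains \<epsilon> where "\<epsilon> > 0" "\<And>x. F (bump \<mu> \<epsilon>) x = 0"
proof -
  have bij: "bij_betw (\<lambda>x. H x - complex_of_real \<mu> *\<^sub>C x) D UNIV"
    and bl: "bounded_linear (resolvent_op D H (of_real \<mu>))"
    using assms by (auto simp: spectrum_op_def)
  obtain K where K: "K > 0" "\<And>x. norm (resolvent_op D H (of_real \<mu>) x) \<le> norm x * K"
    using bounded_linear.pos_bounded[OF bl] by blast
  have "F (bump \<mu> (1 / (2 * K))) x = 0" for x
  proof -
    define y where "y = F (bump \<mu> (1 / (2 * K))) x"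
    have y: "y \<in> D" "norm (H y - \<mu> *\<^sub>R y) \<le> 1 / (2 * K) * norm y"
      unfolding y_def using K(1) by (auto simp del: times_divide_eq_left intro!: bump_approx)
    have "y = resolvent_op D H (of_real \<mu>) (H y - \<mu> *\<^sub>R y)"
      unfolding resolvent_op_def scaleR_scaleC
      using inv_into_f_f[OF bij_betw_imp_inj_on[OF bij] y(1)] by (rule sym)
    then have "norm y \<le> norm (H y - \<mu> *\<^sub>R y) * K" using K(2) by metis
    also have "\<dots> \<le> 1 / (2 * K) * norm y * K" using K(1) y(2) by (intro mult_right_mono) auto
    finally show ?thesis using K(1) by (simp add: y_def[symmetric])
  qed
  then show ?thesis using K(1) by (intro that[of "1 / (2 * K)"]) auto
qed

lemma spectrum_real:
  assumes "z \<in> spectrum_op D H"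
  obtains \<mu> where "\<mu> \<ge> 0" "z = of_real \<mu>"
  using resolvent_off_halfline(2)[of z] assms by auto

lemma spectrum_approx:
  assumes "complex_of_real \<mu> \<in> spectrum_op D H" "\<epsilon> > 0"
  obtains x where "norm (F (bump \<mu> \<epsilon>) x) = 1"
proof -
  obtain x where x: "F (bump \<mu> \<epsilon>) x \<noteq> 0"
    using bump_zero_imp_resolvent assms by blast
  then show ?thesis
    by (intro that[of "(1 / norm (F (bump \<mu> \<epsilon>) x)) *\<^sub>R x"]) (simp add: F_scaleR bump_bcont)
qed

lemma F_combination:
  assumes "a \<in> bcont_real" "b \<in> bcont_real" "c \<in> bcont_real" "d \<in> bcont_real"
  shows "F (\<lambda>t. A * a t + B * b t + K * c t - d t) x = A *\<^sub>R F a x + B *\<^sub>R F b x + K *\<^sub>R F c x - F d x"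
  by (simp add: F_diff F_add F_scale bcont_real_add bcont_real_mult bcont_real_const assms)

text \<open>The pointwise inequality involves unbounded functions. Multiplied by
  \<open>rec\<^sup>2\<close> it becomes one between bounded functions, and the factors
  \<open>rec\<close> are absorbed by \<open>x = F rec w\<close> and
  \<open>H x - lam x = F q w\<close>, where \<open>w = H x + x\<close> and
  \<open>q(t) = (t - lam) rec(t)\<close>.\<close>

lemma form_inequality:
  assumes f: "f \<in> bcont_real" and g: "g \<in> bcont_real" and S: "S \<in> bcont_real" and x: "x \<in> D"
    and le: "\<And>t. t \<ge> 0 \<Longrightarrow> 1 \<le> A * (f t * (t - lam)\<^sup>2) + B * (g t * (t - lam)) + K * (S t)\<^sup>2"
  shows "(norm x)\<^sup>2 \<le> A * Re (cinner (F f (H x - lam *\<^sub>R x)) (H x - lam *\<^sub>R x))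
      + B * Re (cinner (F g x) (H x - lam *\<^sub>R x)) + K * (norm (F S x))\<^sup>2"
proof -
  define w where "w = H x + x"
  define q where "q t = 1 - (lam + 1) * rec t" for t
  have q: "q \<in> bcont_real"
    unfolding q_def by (intro bcont_real_diff bcont_real_mult bcont_real_const rec_bcont)
  have xw: "x = F rec w" using R_shift[OF x] by (simp add: F_rec w_def)
  have uw: "H x - lam *\<^sub>R x = F q w"
  proof -
    have "F q w = w - (lam + 1) *\<^sub>R R w"
      unfolding q_def
      by (simp add: F_diff F_scale F_const bcont_real_const bcont_real_mult rec_bcont F_rec)
    then show ?thesis using R_shift[OF x] by (simp add: w_def scaleR_left_distrib)
  qed
  \<comment> \<open>\<open>p\<close> is the slack of the inequality times
    \<open>rec\<^sup>2\<close>, with its factors ordered so that \<open>cinner_F_F\<close> splits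
    each term symmetrically.\<close>
  define p where "p t = A * (q t * (f t * q t)) + B * (q t * (g t * rec t))
      + K * ((S t * rec t) * (S t * rec t)) - rec t * rec t" for t
  have nonneg: "0 \<le> Re (cinner (F p w) w)"
  proof (rule F_pos)
    show "p \<in> bcont_real" unfolding p_def by (intro bcont_real_intros f g S q)
    fix t :: real assume t: "t \<ge> 0"
    have "p t = (A * (f t * (t - lam)\<^sup>2) + B * (g t * (t - lam)) + K * (S t)\<^sup>2 - 1) * (rec t)\<^sup>2"
    proof -
      have q_eq: "q t = (t - lam) * rec t"
        using t by (simp add: q_def rec_def field_simps)
      show ?thesis
        unfolding p_def q_eq by algebra
    qed
    then show "0 \<le> p t" using le[OF t] by simp
  qed
  have eq: "cinner (F p w) w = A * cinner (F f (F q w)) (F q w) + B * cinner (F g (F rec w)) (F q w)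
      + K * cinner (F S (F rec w)) (F S (F rec w)) - cinner (F rec w) (F rec w)"
  proof -
    have "F p w = A *\<^sub>R F (\<lambda>t. q t * (f t * q t)) w + B *\<^sub>R F (\<lambda>t. q t * (g t * rec t)) w
      + K *\<^sub>R F (\<lambda>t. (S t * rec t) * (S t * rec t)) w - F (\<lambda>t. rec t * rec t) w"
      unfolding p_def by (rule F_combination; intro bcont_real_intros f g S q)
    then have "cinner (F p w) w = A * cinner (F (\<lambda>t. f t * q t) w) (F q w) + B * cinner (F (\<lambda>t. g t * rec t) w) (F q w)
      + K * cinner (F (\<lambda>t. S t * rec t) w) (F (\<lambda>t. S t * rec t) w) - cinner (F rec w) (F rec w)"
      by (simp add: cinner_add_left cinner_diff_left scaleR_scaleC cinner_scaleC_left cinner_F_F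
          bcont_real_mult f g S q rec_bcont)
    then show ?thesis
      unfolding F_mult[OF f q] F_mult[OF g rec_bcont] F_mult[OF S rec_bcont] .
  qed
  show ?thesis using nonneg unfolding eq uw xw[symmetric] by (simp add: cinner_self)
qed

end

section \<open>Weakly null sequences and the essential spectrum\<close>

lemma csubspace_imp_diff:
  assumes "x \<in> E" "y \<in> E" "\<And>x y. x \<in> E \<Longrightarrow> y \<in> E \<Longrightarrow> x + y \<in> E"
    "\<And>c x. x \<in> E \<Longrightarrow> c *\<^sub>C x \<in> E"
  shows "x - y \<in> (E :: 'h::complex_hilbert set)"
  using assms(3)[OF assms(1) assms(4)[OF assms(2), of "-1"]] by (simp add: scaleC_minus_one)

text \<open>\<open>E\<close> lies in the real span of the finite set \<open>B\<close> together with
  its multiples by \<open>\<i>\<close>. In a finite real orthonormal basis of that span, the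
  coefficients of \<open>x j\<close> are real parts of inner products that tend to 0.\<close>

lemma finite_cdim_weakly_null:
  fixes x :: "nat \<Rightarrow> 'h::complex_hilbert"
  assumes fin: "finite_cdim E" and xE: "\<And>j. x j \<in> E" and null: "weakly_null x"
  shows "x \<longlonglongrightarrow> 0"
proof -
  obtain B where B: "finite B" "\<And>y. y \<in> E \<Longrightarrow> \<exists>c. y = (\<Sum>b\<in>B. c b *\<^sub>C b)"
    using fin unfolding finite_cdim_def by blast
  let ?B = "B \<union> (\<lambda>b. \<i> *\<^sub>C b) ` B"
  have ES: "y \<in> span ?B" if y: "y \<in> E" for y
  proof -
    obtain c where c: "y = (\<Sum>b\<in>B. c b *\<^sub>C b)" using B(2)[OF y] by blast
    have "c b *\<^sub>C b = Re (c b) *\<^sub>R b + Im (c b) *\<^sub>R (\<i> *\<^sub>C b)" for b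
      by (simp add: scaleR_scaleC scaleC_scaleC flip: scaleC_add_left)
        (metis complex_eq mult.commute)
    then show ?thesis
      unfolding c by (auto intro!: span_sum span_add span_scale intro: span_base)
  qed
  obtain C where C: "finite C" "span C = span ?B" "pairwise orthogonal C"
    using basis_orthogonal[of ?B] B(1) by auto
  define N where "N = (\<lambda>c. (1 / norm c) *\<^sub>R c) ` (C - {0})"
  have N: "finite N" "\<And>e. e \<in> N \<Longrightarrow> norm e = 1" "pairwise orthogonal N"
    using C(1,3) by (auto simp: N_def pairwise_def orthogonal_def split: if_splits)
  have "c \<in> span N" if "c \<in> C" for c
  proof (cases "c = 0")
    case False
    then have "(1 / norm c) *\<^sub>R c \<in> span N" using that by (intro span_base) (auto simp: N_def)
    then have "norm c *\<^sub>R ((1 / norm c) *\<^sub>R c) \<in> span N" by (rule span_scale)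
    then show ?thesis using False by simp
  qed (simp add: span_zero)
  then have "span C \<subseteq> span N" by (intro span_minimal subspace_span) auto
  then have xN: "x j \<in> span N" for j using ES[OF xE] C(2) by blast
  have "(\<lambda>j. inner (x j) e) \<longlonglongrightarrow> 0" for e
    using tendsto_Re[of "\<lambda>j. cinner (x j) e" 0] null by (simp add: weakly_null_def inner_eq_Re_cinner)
  then have "(\<lambda>j. \<Sum>e\<in>N. inner (x j) e *\<^sub>R e) \<longlonglongrightarrow> (\<Sum>e\<in>N. 0 *\<^sub>R e)"
    by (intro tendsto_sum tendsto_scaleR tendsto_const)
  then show ?thesis by (simp add: orthonormal_basis_expand[OF N(3,2) xN N(1)])
qed

text \<open>Bessel's inequality: the squared coefficients of a fixed vector are summable, so the
  coefficients tend to 0.\<close>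

lemma orthonormal_weakly_null:
  fixes \<psi> :: "nat \<Rightarrow> 'h::complex_hilbert"
  assumes norm: "\<And>j. norm (\<psi> j) = 1" and orth: "\<And>i j. i < j \<Longrightarrow> cinner (\<psi> j) (\<psi> i) = 0"
  shows "weakly_null \<psi>"
  unfolding weakly_null_def
proof
  fix \<phi> :: 'h
  define a where "a j = cinner \<phi> (\<psi> j)" for j
  have Bessel: "(norm (\<phi> - (\<Sum>j<n. a j *\<^sub>C \<psi> j)))\<^sup>2 = (norm \<phi>)\<^sup>2 - (\<Sum>j<n. (cmod (a j))\<^sup>2)" for n
  proof (induction n)
    case (Suc n)
    let ?y = "\<phi> - (\<Sum>j<n. a j *\<^sub>C \<psi> j)"
    have "cinner (\<psi> j) (\<psi> n) = 0" if "j < n" for j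
      using orth[OF that] by (metis cinner_commute complex_cnj_zero)
    then have y: "cinner ?y (\<psi> n) = a n"
      by (simp add: cinner_diff_left cinner_sum_left cinner_scaleC_left a_def)
    then have y': "cinner (\<psi> n) ?y = cnj (a n)"
      by (metis cinner_commute)
    have "complex_of_real ((norm (?y - a n *\<^sub>C \<psi> n))\<^sup>2)
        = cinner ?y ?y - cnj (a n) * cinner ?y (\<psi> n) - a n * (cinner (\<psi> n) ?y - cnj (a n) * cinner (\<psi> n) (\<psi> n))"
      by (simp only: cinner_self[symmetric] cinner_diff_left[of ?y] cinner_diff_right[of _ ?y]
          cinner_scaleC_left cinner_scaleC_right right_diff_distrib)
         (simp add: algebra_simps)
    also have "\<dots> = complex_of_real ((norm ?y)\<^sup>2 - (cmod (a n))\<^sup>2)"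
      unfolding y y' cinner_self norm of_real_diff complex_norm_square by (simp add: mult.commute)
    finally have "(norm (?y - a n *\<^sub>C \<psi> n))\<^sup>2 = (norm ?y)\<^sup>2 - (cmod (a n))\<^sup>2"
      by (simp only: of_real_eq_iff)
    then show ?case using Suc by (simp add: algebra_simps)
  qed simp
  have "summable (\<lambda>j. (cmod (a j))\<^sup>2)"
  proof (rule summableI_nonneg_bounded)
    show "(\<Sum>j<n. (cmod (a j))\<^sup>2) \<le> (norm \<phi>)\<^sup>2" for n
      using Bessel[of n] zero_le_power2[of "norm (\<phi> - (\<Sum>j<n. a j *\<^sub>C \<psi> j))"] by linarith
  qed simp
  then have "(\<lambda>j. sqrt ((cmod (a j))\<^sup>2)) \<longlonglongrightarrow> sqrt 0"
    by (intro tendsto_real_sqrt summable_LIMSEQ_zero)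
  then have "(\<lambda>j. cmod (a j)) \<longlonglongrightarrow> 0" by simp
  moreover have "cmod (cinner (\<psi> j) \<phi>) = cmod (a j)" for j
    by (metis a_def cinner_commute complex_mod_cnj)
  ultimately show "(\<lambda>j. cinner (\<psi> j) \<phi>) \<longlonglongrightarrow> 0"
    by (intro tendsto_norm_zero_cancel[of "\<lambda>j. cinner (\<psi> j) \<phi>"]) simp
qed

text \<open>Gram-Schmidt: a finite orthonormal set does not span \<open>E\<close>, so some vector of
  \<open>E\<close> minus its projection is nonzero, still in \<open>E\<close>, and orthogonal to the
  set.\<close>

lemma infinite_cdim_orthonormal:
  fixes E :: "'h::complex_hilbert set"
  assumes inf: "\<not> finite_cdim E"
    and add: "\<And>x y. x \<in> E \<Longrightarrow> y \<in> E \<Longrightarrow> x + y \<in> E" and scale: "\<And>c x. x \<in> E \<Longrightarrow> c *\<^sub>C x \<in> E"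
  obtains \<psi> :: "nat \<Rightarrow> 'h" where "\<And>j. \<psi> j \<in> E" "\<And>j. norm (\<psi> j) = 1"
    "\<And>i j. i < j \<Longrightarrow> cinner (\<psi> j) (\<psi> i) = 0"
proof -
  define ON where "ON S \<longleftrightarrow> finite S \<and> S \<subseteq> E \<and> (\<forall>s\<in>S. \<forall>t\<in>S. cinner s t = (if s = t then 1 else 0))"
    for S :: "'h set"
  have zero: "0 \<in> E"
  proof -
    have "E \<noteq> {}" using inf unfolding finite_cdim_def by blast
    then show ?thesis using scale[of _ 0] by auto
  qed
  have step: "\<exists>x\<in>E. norm x = 1 \<and> (\<forall>s\<in>S. cinner x s = 0)" if S: "ON S" for S
  proof -
    obtain x where x: "x \<in> E" "\<And>c. x \<noteq> (\<Sum>b\<in>S. c b *\<^sub>C b)"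
      using inf S unfolding finite_cdim_def ON_def by blast
    define y where "y = x - (\<Sum>b\<in>S. cinner x b *\<^sub>C b)"
    have "(\<Sum>b\<in>T. cinner x b *\<^sub>C b) \<in> E" if "T \<subseteq> E" for T
      using that by (induction T rule: infinite_finite_induct) (auto simp: zero add scale)
    then have y: "y \<in> E" "y \<noteq> 0"
      using x S csubspace_imp_diff[OF x(1) _ add scale] by (auto simp: y_def ON_def)
    have "cinner y s = 0" if "s \<in> S" for s
    proof -
      have "(\<Sum>b\<in>S. cinner x b * cinner b s) = (\<Sum>b\<in>S. if b = s then cinner x b else 0)"
        using S that by (intro sum.cong) (auto simp: ON_def)
      also have "\<dots> = cinner x s" using S that by (simp add: ON_def)
      finally show ?thesis
        by (simp add: y_def cinner_diff_left cinner_sum_left cinner_scaleC_left)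
    qed
    then show ?thesis
      using y by (intro bexI[of _ "of_real (1 / norm y) *\<^sub>C y"])
        (auto simp: cinner_scaleC_left norm_scaleC norm_divide scale)
  qed
  \<comment> \<open>The state of the recursion pairs the set of all vectors chosen so far with the
    next one; orthogonality to every earlier vector then reduces to membership in that set.\<close>
  define P where "P n p \<longleftrightarrow> ON (fst p) \<and> snd p \<in> E \<and> norm (snd p) = 1 \<and> (\<forall>s\<in>fst p. cinner (snd p) s = 0)"
    for n :: nat and p :: "'h set \<times> 'h"
  have "\<exists>p. \<forall>n. P n (p n) \<and> fst (p (Suc n)) = insert (snd (p n)) (fst (p n))"
  proof (rule dependent_nat_choice)
    show "\<exists>p. P 0 p" using step[of "{}"] by (auto simp: P_def ON_def)
    fix p n assume p: "P n p"
    have "cinner s (snd p) = 0" if "s \<in> fst p" for s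
      using p that cinner_commute[of s "snd p"] by (auto simp: P_def)
    then have "ON (insert (snd p) (fst p))"
      using p by (auto simp: ON_def P_def cinner_self)
    from step[OF this] show "\<exists>q. P (Suc n) q \<and> fst q = insert (snd p) (fst p)"
      using \<open>ON (insert (snd p) (fst p))\<close> by (auto simp: P_def)
  qed
  then obtain p where P: "\<And>n. P n (p n)" and Q: "\<And>n. fst (p (Suc n)) = insert (snd (p n)) (fst (p n))"
    by blast
  have mem: "snd (p i) \<in> fst (p j)" if "i < j" for i j
    using that by (induction j) (auto simp: Q less_Suc_eq)
  show ?thesis
    by (rule that[of "\<lambda>n. snd (p n)"]) (use P mem in \<open>auto simp: P_def\<close>)
qed

section \<open>Functions whose operators vanish along a sequence\<close>

context calculus
begin

text \<open>Serves both halves of the converse: an annihilated bump is in \<open>null \<psi>\<close>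
  for every \<open>\<psi>\<close>, and a bump at a discrete eigenvalue for weakly null
  \<open>\<psi>\<close>. For a constant sequence membership means exact annihilation of that
  vector.\<close>

definition null :: "(nat \<Rightarrow> 'h) \<Rightarrow> (real \<Rightarrow> real) set" where
  "null \<psi> = {u \<in> bcont_real. (\<lambda>j. F u (\<psi> j)) \<longlonglongrightarrow> 0}"

lemma null_mono:
  assumes "v \<in> null \<psi>" "u \<in> bcont_real" "\<And>t. t \<ge> 0 \<Longrightarrow> \<bar>u t\<bar> \<le> \<bar>v t\<bar>"
  shows "u \<in> null \<psi>"
proof -
  have "(\<lambda>j. F u (\<psi> j)) \<longlonglongrightarrow> 0"
  proof (rule Lim_null_comparison)
    show "\<forall>\<^sub>F j in sequentially. norm (F u (\<psi> j)) \<le> norm (F v (\<psi> j))"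
      using assms by (intro always_eventually allI F_norm_mono) (auto simp: null_def)
    show "(\<lambda>j. norm (F v (\<psi> j))) \<longlonglongrightarrow> 0"
      using assms(1) by (simp add: null_def tendsto_norm_zero)
  qed
  then show ?thesis using assms(2) by (simp add: null_def)
qed

lemma null_add: "u \<in> null \<psi> \<Longrightarrow> v \<in> null \<psi> \<Longrightarrow> (\<lambda>t. u t + v t) \<in> null \<psi>"
  using tendsto_add[of "\<lambda>j. F u (\<psi> j)" 0 _ "\<lambda>j. F v (\<psi> j)" 0]
  by (auto simp: null_def F_add bcont_real_add)

lemma null_scale: "u \<in> null \<psi> \<Longrightarrow> (\<lambda>t. c * u t) \<in> null \<psi>"
  using tendsto_scaleR[OF tendsto_const[of c], of "\<lambda>j. F u (\<psi> j)" 0]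
  by (auto simp: null_def F_scale bcont_real_mult bcont_real_const)

lemma null_sum: "(\<And>i. i \<in> I \<Longrightarrow> u i \<in> null \<psi>) \<Longrightarrow> (\<lambda>t. \<Sum>i\<in>I. u i t) \<in> null \<psi>"
proof (induction I rule: infinite_finite_induct)
  case (insert i I)
  then show ?case by (auto intro: null_add)
qed (simp_all add: null_def F_const bcont_real_const)

text \<open>Compactness extracts finitely many bumps whose positivity sets cover \<open>K\<close>;
  their sum is continuous and positive there, and \<open>m\<close> is its minimum.\<close>

lemma null_cover:
  assumes K: "compact K" and bumps: "\<And>t. t \<in> K \<Longrightarrow> \<exists>\<epsilon>>0. bump t \<epsilon> \<in> null \<psi>"
  obtains S m where "S \<in> null \<psi>" "m > 0" "\<And>t. S t \<ge> 0" "\<And>t. t \<in> K \<Longrightarrow> m \<le> S t"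
proof -
  obtain \<epsilon> where \<epsilon>: "\<And>t. t \<in> K \<Longrightarrow> \<epsilon> t > 0" "\<And>t. t \<in> K \<Longrightarrow> bump t (\<epsilon> t) \<in> null \<psi>"
    using bumps by metis
  obtain C where C: "C \<subseteq> K" "finite C" "K \<subseteq> (\<Union>t\<in>C. ball t (\<epsilon> t))"
    by (rule compactE_image[OF K, of K "\<lambda>t. ball t (\<epsilon> t)"]) (use \<epsilon>(1) in auto)
  define S where "S s = (\<Sum>t\<in>C. bump t (\<epsilon> t) s)" for s
  have S: "S \<in> null \<psi>" unfolding S_def using C(1) \<epsilon>(2) by (intro null_sum) auto
  have S0: "S t \<ge> 0" for t by (simp add: S_def sum_nonneg bump_nonneg)
  have pos: "S s > 0" if "s \<in> K" for s
  proof -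
    obtain t where t: "t \<in> C" "s \<in> ball t (\<epsilon> t)" using C(3) \<open>s \<in> K\<close> by blast
    then have "bump t (\<epsilon> t) s > 0"
      using C(1) \<epsilon>(1) by (subst bump_pos_iff) (auto simp: dist_real_def abs_minus_commute)
    then show ?thesis
      unfolding S_def by (intro sum_pos2[OF C(2) t(1)]) (auto simp: bump_nonneg)
  qed
  have cont: "continuous_on K S"
    unfolding S_def by (intro continuous_intros continuous_bump)
  show ?thesis
  proof (cases "K = {}")
    case True
    then show ?thesis using S S0 by (intro that[of S 1]) auto
  next
    case False
    then obtain k where "k \<in> K" "\<And>s. s \<in> K \<Longrightarrow> S k \<le> S s"
      using continuous_attains_inf[OF K _ cont] by blast
    then show ?thesis using S S0 pos by (intro that[of S "S k"]) auto
  qed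
qed

lemma null_off_spectrum:
  assumes "complex_of_real \<mu> \<notin> spectrum_op D H"
  shows "\<exists>\<epsilon>>0. bump \<mu> \<epsilon> \<in> null \<psi>"
proof -
  obtain \<epsilon> where "\<epsilon> > 0" "\<And>x. F (bump \<mu> \<epsilon>) x = 0"
    using resolvent_imp_bump_zero[OF assms] by blast
  then show ?thesis by (intro exI[of _ \<epsilon>]) (simp add: null_def bump_bcont)
qed

text \<open>Near an isolated spectral point \<open>\<mu>\<close> the function \<open>(t - \<mu>) * bump \<mu> \<epsilon> t\<close> is a uniform limit of
  functions supported off the spectrum.\<close>

lemma isolated_bump_eigen:
  assumes iso: "\<And>s. s \<in> spectrum_op D H \<Longrightarrow> dist (of_real \<mu>) s < r \<Longrightarrow> s = of_real \<mu>"
    and e: "0 < \<epsilon>" "\<epsilon> < r"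
  shows "F (bump \<mu> \<epsilon>) x \<in> eigenspace_op D H (of_real \<mu>)"
proof -
  have "norm (F (\<lambda>t. (t - \<mu>) * bump \<mu> \<epsilon> t) x) \<le> 0 + a" if a: "a > 0" for a
  proof -
    define a' where "a' = a / (norm x + 1)"
    have a': "a' > 0" using a by (simp add: a'_def add_nonneg_pos)
    let ?K = "cball \<mu> \<epsilon> - ball \<mu> a'"
    have "complex_of_real t \<notin> spectrum_op D H" if "t \<in> ?K" for t
    proof
      assume "complex_of_real t \<in> spectrum_op D H"
      moreover have "dist (complex_of_real \<mu>) (of_real t) < r"
        using that e by (simp add: dist_of_real)
      ultimately have "t = \<mu>" using iso by fastforce
      then show False using that a' by simp
    qed
    then have "\<exists>\<epsilon>>0. bump t \<epsilon> \<in> null (\<lambda>_. x)" if "t \<in> ?K" for t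
      using that by (intro null_off_spectrum) auto
    moreover have "compact ?K" by (intro compact_diff compact_cball open_ball)
    ultimately obtain S m where S: "S \<in> null (\<lambda>_. x)" "m > 0" "\<And>t. S t \<ge> 0" "\<And>t. t \<in> ?K \<Longrightarrow> m \<le> S t"
      using null_cover[of ?K] by blast
    \<comment> \<open>\<open>h\<close> vanishes within \<open>a'\<close> of \<open>\<mu>\<close> and
      outside radius \<open>\<epsilon>\<close>, so it is dominated by a multiple of \<open>S\<close>
      and annihilates \<open>x\<close>; yet it differs from
      \<open>\<bar>t - \<mu>\<bar> * bump \<mu> \<epsilon> t\<close> by at most
      \<open>a'\<close>.\<close>
    define h where "h t = max 0 (\<bar>t - \<mu>\<bar> - a') * bump \<mu> \<epsilon> t" for t
    have h_le: "h t \<le> \<epsilon> / m * S t" for t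
    proof (cases "t \<in> ?K")
      case True
      then have "max 0 (\<bar>t - \<mu>\<bar> - a') \<le> \<epsilon>"
        using a' e by (auto simp: dist_real_def)
      then have "h t \<le> \<epsilon> * 1"
        unfolding h_def using e by (intro mult_mono bump_le_one bump_nonneg) auto
      also have "\<dots> \<le> \<epsilon> / m * S t"
        using S(2) S(4)[OF True] e by (simp add: field_simps)
      finally show ?thesis .
    next
      case False
      then have "h t = 0"
        using e by (auto simp: h_def dist_real_def abs_minus_commute bump_eq_0 not_le not_less)
      then show ?thesis using S e by simp
    qed
    have h0: "h t \<ge> 0" for t by (simp add: h_def bump_nonneg)
    have hb: "h \<in> bcont_real"
    proof (rule bcont_realI)
      show "continuous_on {0..} h"
        unfolding h_def by (intro continuous_intros continuous_bump)
      show "\<bar>h t\<bar> \<le> \<epsilon>" for t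
      proof -
        have "h t \<le> \<bar>t - \<mu>\<bar> * bump \<mu> \<epsilon> t"
          unfolding h_def using a' by (intro mult_right_mono bump_nonneg) auto
        also have "\<dots> \<le> \<epsilon>"
          using mult_bump_le[OF e(1), of t \<mu>] bump_le_one[of \<mu> \<epsilon> t] e(1)
          by (simp add: abs_mult bump_nonneg) (meson mult_left_le order_trans less_imp_le)
        finally show ?thesis using h0[of t] by simp
      qed
    qed
    have "h \<in> null (\<lambda>_. x)"
      by (rule null_mono[OF null_scale[OF S(1), of "\<epsilon> / m"] hb])
        (use h0 h_le S e in \<open>auto simp: abs_mult abs_of_pos\<close>)
    then have h_zero: "F h x = 0"
      by (simp add: null_def LIMSEQ_const_iff)
    have tb: "(\<lambda>t. \<bar>t - \<mu>\<bar> * bump \<mu> \<epsilon> t) \<in> bcont_real"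
    proof (rule bcont_realI)
      show "continuous_on {0..} (\<lambda>t. \<bar>t - \<mu>\<bar> * bump \<mu> \<epsilon> t)"
        by (intro continuous_intros continuous_bump)
      show "\<bar>\<bar>t - \<mu>\<bar> * bump \<mu> \<epsilon> t\<bar> \<le> \<epsilon>" for t
        using mult_bump_le[OF e(1), of t \<mu>] bump_le_one[of \<mu> \<epsilon> t] e(1)
        by (simp add: abs_mult bump_nonneg) (meson mult_left_le order_trans less_imp_le)
    qed
    have "norm (F (\<lambda>t. (t - \<mu>) * bump \<mu> \<epsilon> t) x) \<le> norm (F (\<lambda>t. \<bar>t - \<mu>\<bar> * bump \<mu> \<epsilon> t) x)"
      by (intro F_norm_mono mult_bump_bcont tb e) (simp add: abs_mult)
    also have "\<dots> = norm (F (\<lambda>t. \<bar>t - \<mu>\<bar> * bump \<mu> \<epsilon> t - h t) x)"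
      by (simp add: F_diff tb hb h_zero)
    also have "\<dots> \<le> a' * norm x"
    proof (rule norm_F_le)
      show "\<bar>\<bar>t - \<mu>\<bar> * bump \<mu> \<epsilon> t - h t\<bar> \<le> a'" for t
      proof -
        have "\<bar>t - \<mu>\<bar> * bump \<mu> \<epsilon> t - h t = (\<bar>t - \<mu>\<bar> - max 0 (\<bar>t - \<mu>\<bar> - a')) * bump \<mu> \<epsilon> t"
          by (simp add: h_def left_diff_distrib)
        also have "\<bar>\<dots>\<bar> \<le> a' * 1"
          unfolding abs_mult using a' by (intro mult_mono) (auto simp: bump_nonneg bump_le_one)
        finally show ?thesis by simp
      qed
    qed (intro bcont_real_diff tb hb)
    also have "\<dots> \<le> a" using a by (simp add: a'_def divide_le_eq add_nonneg_pos)
    finally show ?thesis by simp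
  qed
  then have "norm (F (\<lambda>t. (t - \<mu>) * bump \<mu> \<epsilon> t) x) \<le> 0" by (rule field_le_epsilon)
  then have zero: "F (\<lambda>t. (t - \<mu>) * bump \<mu> \<epsilon> t) x = 0" by simp
  note dom = F_domain[OF bump_bcont id_bump_bcont[OF e(1)]]
  have "H (F (bump \<mu> \<epsilon>) x) - \<mu> *\<^sub>R F (bump \<mu> \<epsilon>) x = 0"
    by (rule trans[OF dom(2) zero])
  then show ?thesis
    by (simp add: eigenspace_op_def scaleR_scaleC dom(1))
qed

lemma null_discrete:
  assumes disc: "complex_of_real \<mu> \<in> discrete_spectrum_op D H" and null: "weakly_null \<psi>"
  shows "\<exists>\<epsilon>>0. bump \<mu> \<epsilon> \<in> null \<psi>"
proof -
  obtain r where r: "r > 0" "\<And>s. s \<in> spectrum_op D H \<Longrightarrow> dist (complex_of_real \<mu>) s < r \<Longrightarrow> s = of_real \<mu>"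
    using disc by (auto simp: discrete_spectrum_op_def isolated_in_dist_Ex_iff)
  let ?b = "bump \<mu> (r / 2)"
  have "(\<lambda>j. F ?b (\<psi> j)) \<longlonglongrightarrow> 0"
  proof (rule finite_cdim_weakly_null)
    show "finite_cdim (eigenspace_op D H (complex_of_real \<mu>))"
      using disc by (simp add: discrete_spectrum_op_def)
    show "F ?b (\<psi> j) \<in> eigenspace_op D H (complex_of_real \<mu>)" for j
      by (rule isolated_bump_eigen[OF r(2)]) (use r(1) in auto)
    show "weakly_null (\<lambda>j. F ?b (\<psi> j))"
      using null by (simp add: weakly_null_def F_symmetric bump_bcont)
  qed
  then show ?thesis using r(1) by (intro exI[of _ "r / 2"]) (simp add: null_def bump_bcont)
qed

text \<open>Properties (2) and (3) bound the two forms by \<open>\<delta>\<close>, while the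
  \<open>S\<close>-term tends to 0 along \<open>\<psi>\<close>; in the limit only
  \<open>(A + B) * \<delta>\<close> is left to dominate 1.\<close>

lemma approx_seq_bound:
  assumes f: "f \<in> bcont_real" and g: "g \<in> bcont_real"
    and D: "\<And>j. \<psi> j \<in> D" and norm: "\<And>j. norm (\<psi> j) = 1"
    and f_le: "\<And>j. cmod (cinner (F f (H (\<psi> j) - lam *\<^sub>R \<psi> j)) (H (\<psi> j) - lam *\<^sub>R \<psi> j)) \<le> \<delta>"
    and g_le: "\<And>j. cmod (cinner (F g (\<psi> j)) (H (\<psi> j) - lam *\<^sub>R \<psi> j)) \<le> \<delta>"
    and AB: "A \<ge> 0" "B \<ge> 0" and L: "L \<ge> 0"
    and bumps: "\<And>t. \<bar>t - lam\<bar> \<le> d \<Longrightarrow> \<exists>\<epsilon>>0. bump t \<epsilon> \<in> null \<psi>"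
    and far: "\<And>t. t \<ge> 0 \<Longrightarrow> \<bar>t - lam\<bar> > d \<Longrightarrow> 1 \<le> A * (f t * (t - lam)\<^sup>2) + B * (g t * (t - lam))"
    and near: "\<And>t. t \<ge> 0 \<Longrightarrow> - L \<le> A * (f t * (t - lam)\<^sup>2) + B * (g t * (t - lam))"
  shows "1 \<le> (A + B) * \<delta>"
proof -
  have "\<exists>\<epsilon>>0. bump t \<epsilon> \<in> null \<psi>" if "t \<in> cball lam d" for t
    using that by (intro bumps) (simp add: dist_real_def abs_minus_commute)
  then obtain S m where S: "S \<in> null \<psi>" "m > 0" "\<And>t. S t \<ge> 0" "\<And>t. t \<in> cball lam d \<Longrightarrow> m \<le> S t"
    using null_cover[OF compact_cball] by metis
  \<comment> \<open>On the covered interval the first two terms may be as low as \<open>- L\<close>;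
    since \<open>S \<ge> m\<close> there, this \<open>K\<close> adds at least
    \<open>1 + L\<close>.\<close>
  define K where "K = (1 + L) / m\<^sup>2"
  have K: "K \<ge> 0" using L by (simp add: K_def)
  have "1 \<le> A * \<delta> + B * \<delta> + K * (norm (F S (\<psi> j)))\<^sup>2" for j
  proof -
    let ?u = "H (\<psi> j) - lam *\<^sub>R \<psi> j"
    have "(norm (\<psi> j))\<^sup>2 \<le> A * Re (cinner (F f ?u) ?u) + B * Re (cinner (F g (\<psi> j)) ?u)
        + K * (norm (F S (\<psi> j)))\<^sup>2"
    proof (rule form_inequality[OF f g _ D])
      show "S \<in> bcont_real" using S(1) by (simp add: null_def)
      fix t :: real assume t: "t \<ge> 0"
      show "1 \<le> A * (f t * (t - lam)\<^sup>2) + B * (g t * (t - lam)) + K * (S t)\<^sup>2"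
      proof (cases "\<bar>t - lam\<bar> > d")
        case True
        then show ?thesis using far[OF t True] K by (simp add: add_increasing2)
      next
        case False
        then have "m \<le> S t" by (intro S(4)) (simp add: dist_real_def abs_minus_commute)
        then have "m\<^sup>2 \<le> (S t)\<^sup>2" using S(2) by (intro power_mono) auto
        then have "K * m\<^sup>2 \<le> K * (S t)\<^sup>2" using K by (intro mult_left_mono)
        moreover have "K * m\<^sup>2 = 1 + L" using S(2) by (simp add: K_def)
        ultimately show ?thesis using near[OF t] by linarith
      qed
    qed
    also have "\<dots> \<le> A * \<delta> + B * \<delta> + K * (norm (F S (\<psi> j)))\<^sup>2"
      using order_trans[OF complex_Re_le_cmod f_le[of j]] order_trans[OF complex_Re_le_cmod g_le[of j]] AB
      by (intro add_mono mult_left_mono order_refl)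
    finally show ?thesis by (simp add: norm)
  qed
  moreover have "(\<lambda>j. A * \<delta> + B * \<delta> + K * (norm (F S (\<psi> j)))\<^sup>2) \<longlonglongrightarrow> A * \<delta> + B * \<delta> + K * (norm (0::'h))\<^sup>2"
    using S(1) by (intro tendsto_intros) (auto simp: null_def)
  ultimately have "1 \<le> A * \<delta> + B * \<delta> + K * (norm (0::'h))\<^sup>2"
    by (intro LIMSEQ_le_const) auto
  then show ?thesis by (simp add: algebra_simps)
qed

lemma shift_norm_le:
  "norm (H x - lam *\<^sub>R x) \<le> norm (H x - \<mu> *\<^sub>R x) + \<bar>\<mu> - lam\<bar> * norm x"
proof -
  have "H x - lam *\<^sub>R x = (H x - \<mu> *\<^sub>R x) + (\<mu> - lam) *\<^sub>R x"
    by (simp add: scaleR_left_diff_distrib)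
  then show ?thesis by (metis norm_scaleR norm_triangle_ineq)
qed

text \<open>Spectral points approaching \<open>\<mu>\<close> are picked so that their bumps live in
  disjoint annuli around \<open>\<mu>\<close>, the n-th one between the radii
  \<open>r (Suc n)\<close> and \<open>r n\<close>. Disjoint bumps have product zero, so the
  resulting unit vectors are orthogonal, hence weakly null.\<close>

lemma limit_point_sequence:
  assumes lim: "\<And>r. r > 0 \<Longrightarrow> \<exists>s\<in>spectrum_op D H. s \<noteq> of_real \<mu> \<and> dist s (of_real \<mu>) < r"
    and e: "\<epsilon> > 0"
  obtains \<psi> where "\<And>j. \<psi> j \<in> D" "\<And>j. norm (\<psi> j) = 1" "\<And>j. norm (H (\<psi> j) - \<mu> *\<^sub>R \<psi> j) \<le> \<epsilon>"
    "weakly_null \<psi>"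
proof -
  define Q where "Q r r' \<nu> \<rho> y \<longleftrightarrow> 0 < \<rho> \<and> norm (F (bump \<nu> \<rho>) y) = 1 \<and> \<bar>\<nu> - \<mu>\<bar> + \<rho> \<le> r \<and> r' \<le> \<bar>\<nu> - \<mu>\<bar> - \<rho>"
    for r r' \<nu> \<rho> y
  have "\<exists>r. \<forall>n. (0 < r n \<and> r n \<le> \<epsilon>) \<and> (r (Suc n) \<le> r n \<and> (\<exists>\<nu> \<rho> y. Q (r n) (r (Suc n)) \<nu> \<rho> y))"
  proof (rule dependent_nat_choice)
    show "\<exists>r. 0 < r \<and> r \<le> \<epsilon>" using e by auto
    fix r :: real and n :: nat assume r: "0 < r \<and> r \<le> \<epsilon>"
    then obtain s where s: "s \<in> spectrum_op D H" "s \<noteq> of_real \<mu>" "dist s (of_real \<mu>) < r"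
      using lim by blast
    from spectrum_real[OF s(1)] obtain \<nu> where \<nu>: "s = of_real \<nu>" by blast
    define a where "a = \<bar>\<nu> - \<mu>\<bar>"
    have a: "0 < a" "a < r"
      using s(2,3) by (auto simp: \<nu> a_def dist_of_real dist_real_def)
    \<comment> \<open>This radius keeps the bump between \<open>a / 2\<close> and \<open>r\<close>
      in distance from \<open>\<mu>\<close>; \<open>a / 2\<close> becomes the next outer
      radius.\<close>
    define \<rho> where "\<rho> = min (a / 2) (r - a)"
    have \<rho>: "\<rho> > 0" "a + \<rho> \<le> r" "a / 2 \<le> a - \<rho>"
      using a by (auto simp: \<rho>_def min_def)
    obtain y where "norm (F (bump \<nu> \<rho>) y) = 1"
      using spectrum_approx[OF _ \<rho>(1)] s(1) \<nu> by blast
    then have "Q r (a / 2) \<nu> \<rho> y"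
      using \<rho> by (simp add: Q_def a_def[symmetric])
    then show "\<exists>r'. (0 < r' \<and> r' \<le> \<epsilon>) \<and> r' \<le> r \<and> (\<exists>\<nu> \<rho> y. Q r r' \<nu> \<rho> y)"
      using a r by (intro exI[of _ "a / 2"]) auto
  qed
  then obtain r where r: "\<And>n. 0 < r n" "\<And>n. r n \<le> \<epsilon>" "\<And>n. r (Suc n) \<le> r n"
      and ex: "\<And>n. \<exists>\<nu> \<rho> y. Q (r n) (r (Suc n)) \<nu> \<rho> y"
    by blast
  obtain \<nu> \<rho> y where Q: "\<And>n. Q (r n) (r (Suc n)) (\<nu> n) (\<rho> n) (y n)"
    using ex by metis
  define \<psi> where "\<psi> n = F (bump (\<nu> n) (\<rho> n)) (y n)" for n
  have \<rho>: "\<rho> n > 0" "norm (\<psi> n) = 1" "\<bar>\<nu> n - \<mu>\<bar> + \<rho> n \<le> r n" "r (Suc n) \<le> \<bar>\<nu> n - \<mu>\<bar> - \<rho> n" for n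
    using Q[of n] by (auto simp: Q_def \<psi>_def)
  have "cinner (\<psi> j) (\<psi> i) = 0" if "i < j" for i j
  proof -
    have "bump (\<nu> i) (\<rho> i) t * bump (\<nu> j) (\<rho> j) t = 0" for t
    proof (rule ccontr)
      assume "bump (\<nu> i) (\<rho> i) t * bump (\<nu> j) (\<rho> j) t \<noteq> 0"
      then have "\<bar>t - \<nu> i\<bar> < \<rho> i" "\<bar>t - \<nu> j\<bar> < \<rho> j"
        using bump_eq_0[OF \<rho>(1)[of i], where \<mu> = "\<nu> i" and t = t]
          bump_eq_0[OF \<rho>(1)[of j], where \<mu> = "\<nu> j" and t = t]
        by (metis mult_eq_0_iff not_le)+
      moreover have "\<bar>\<nu> i - \<mu>\<bar> \<le> \<bar>t - \<nu> i\<bar> + \<bar>t - \<mu>\<bar>" "\<bar>t - \<mu>\<bar> \<le> \<bar>t - \<nu> j\<bar> + \<bar>\<nu> j - \<mu>\<bar>"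
        by linarith+
      moreover have "r j \<le> r (Suc i)" by (rule lift_Suc_antimono_le[of r, OF r(3)]) (use that in simp)
      ultimately show False using \<rho>(4)[of i] \<rho>(3)[of j] by linarith
    qed
    then have "F (bump (\<nu> i) (\<rho> i)) (\<psi> j) = F (\<lambda>t. 0) (y j)"
      unfolding \<psi>_def by (simp only: F_mult[OF bump_bcont bump_bcont, symmetric])
    then have "F (bump (\<nu> i) (\<rho> i)) (\<psi> j) = 0"
      by (simp add: F_const)
    then show ?thesis
      unfolding \<psi>_def[of i] by (simp add: F_symmetric[symmetric] bump_bcont)
  qed
  then have "weakly_null \<psi>" by (intro orthonormal_weakly_null \<rho>)
  moreover have "norm (H (\<psi> j) - \<mu> *\<^sub>R \<psi> j) \<le> \<epsilon>" for j
    using shift_norm_le[of "\<psi> j" \<mu> "\<nu> j"] bump_approx(2)[OF \<rho>(1)[of j], of "\<nu> j" "y j"] \<rho>(2,3)[of j] r(2)[of j]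
    by (simp add: \<psi>_def)
  ultimately show ?thesis
    using \<rho> bump_approx(1)[OF \<rho>(1)] by (intro that[of \<psi>]) (auto simp: \<psi>_def)
qed

text \<open>If \<open>\<mu>\<close> is isolated, nonzero bump vectors make it an eigenvalue; not
  being discrete, it has an infinite-dimensional eigenspace, which supplies an orthonormal sequence
  of exact eigenvectors. Otherwise \<open>\<mu>\<close> is a limit point of the spectrum.\<close>

lemma ess_spectrum_sequence:
  assumes ess: "complex_of_real \<mu> \<in> ess_spectrum_op D H" and e: "\<epsilon> > 0"
  obtains \<psi> where "\<And>j. \<psi> j \<in> D" "\<And>j. norm (\<psi> j) = 1" "\<And>j. norm (H (\<psi> j) - \<mu> *\<^sub>R \<psi> j) \<le> \<epsilon>"
    "weakly_null \<psi>"
proof (cases "complex_of_real \<mu> isolated_in spectrum_op D H")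
  case True
  let ?E = "eigenspace_op D H (complex_of_real \<mu>)"
  obtain r where r: "r > 0" "\<And>s. s \<in> spectrum_op D H \<Longrightarrow> dist (complex_of_real \<mu>) s < r \<Longrightarrow> s = of_real \<mu>"
    using True by (auto simp: isolated_in_dist_Ex_iff)
  have spec: "complex_of_real \<mu> \<in> spectrum_op D H" using ess by (simp add: ess_spectrum_op_def)
  obtain x where "norm (F (bump \<mu> (r / 2)) x) = 1"
    using spectrum_approx[OF spec, of "r / 2"] r(1) by auto
  moreover have "F (bump \<mu> (r / 2)) x \<in> ?E"
    by (rule isolated_bump_eigen[OF r(2)]) (use r(1) in auto)
  ultimately have "?E \<noteq> {0}" by (metis norm_zero singletonD zero_neq_one)
  then have inf: "\<not> finite_cdim ?E"
    using ess True by (auto simp: ess_spectrum_op_def discrete_spectrum_op_def)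
  have add: "x + y \<in> ?E" if "x \<in> ?E" "y \<in> ?E" for x y
    using clinear_H that by (auto simp: clinear_on_def eigenspace_op_def scaleC_add_right)
  have scale: "c *\<^sub>C x \<in> ?E" if "x \<in> ?E" for c x
    using clinear_H that by (auto simp: clinear_on_def eigenspace_op_def scaleC_scaleC mult.commute)
  obtain \<psi> :: "nat \<Rightarrow> 'h" where \<psi>: "\<And>j. \<psi> j \<in> ?E" "\<And>j. norm (\<psi> j) = 1" "\<And>i j. i < j \<Longrightarrow> cinner (\<psi> j) (\<psi> i) = 0"
    using infinite_cdim_orthonormal[OF inf add scale] by blast
  show ?thesis
  proof (rule that[of \<psi>])
    show "weakly_null \<psi>" by (rule orthonormal_weakly_null[OF \<psi>(2,3)])
    show "norm (H (\<psi> j) - \<mu> *\<^sub>R \<psi> j) \<le> \<epsilon>" for j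
      using \<psi>(1)[of j] e by (simp add: eigenspace_op_def scaleR_scaleC)
  qed (use \<psi> in \<open>auto simp: eigenspace_op_def\<close>)
next
  case False
  have "complex_of_real \<mu> islimpt spectrum_op D H"
    using False ess by (auto simp: isolated_in_islimpt_iff ess_spectrum_op_def)
  then have "\<exists>s\<in>spectrum_op D H. s \<noteq> of_real \<mu> \<and> dist s (of_real \<mu>) < r" if "r > 0" for r
    using that by (auto simp: islimpt_approachable)
  from limit_point_sequence[OF this e] show ?thesis using that by blast
qed

end

section \<open>Existence of the functional calculus\<close>

lemma bcont_unit_reparam:
  assumes "u \<in> bcont_nonneg"
  shows "(\<lambda>s. u (1 / s - 1)) \<in> bcont_unit"
proof -
  obtain M where M: "\<And>t. t \<ge> 0 \<Longrightarrow> cmod (u t) \<le> M"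
    using bcont_nonneg_bound[OF assms] by blast
  have mem: "1 / s - 1 \<ge> 0" if "s \<in> {0<..1}" for s :: real
    using that by (simp add: field_simps)
  have "continuous_on {0<..1} (\<lambda>s. u (1 / s - 1))"
  proof (rule continuous_on_compose2[of "{0..}" u _ "\<lambda>s. 1 / s - 1"])
    show "continuous_on {0..} u" using assms by (simp add: bcont_nonneg_def)
    show "continuous_on {0<..1} (\<lambda>s::real. 1 / s - 1)" by (intro continuous_intros) auto
  qed (use mem in auto)
  then show ?thesis
    unfolding bcont_unit_def using M mem by blast
qed

context nonneg_self_adjoint
begin

lemma positive_contraction_R: "positive_contraction R"
proof
  show "bounded_clinear R" by (rule R_clinear)
  show "cinner (R x) y = cinner x (R y)" for x y by (rule R_symmetric)
  show "0 \<le> Re (cinner (R x) x)" for x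
    using R_form[of x] by (rule order_trans[OF zero_le_power2])
  show "closure (range R) = UNIV" by (simp add: range_R dense)
  show "Re (cinner (R x) x) \<le> (norm x)\<^sup>2" for x
  proof -
    have "Re (cinner (R x) x) \<le> norm (R x) * norm x"
      by (rule order_trans[OF complex_Re_le_cmod norm_cinner_le])
    also have "\<dots> \<le> norm x * norm x" by (intro mult_right_mono norm_R_le) simp
    finally show ?thesis by (simp add: power2_eq_square)
  qed
qed

interpretation pc: positive_contraction R by (rule positive_contraction_R)

lemma calculus_Phi: "calculus D H R (\<lambda>u. pc.Phi (\<lambda>s. u (1 / s - 1)))"
proof
  fix u v :: "real \<Rightarrow> complex" and x y :: 'h and c
  assume u: "u \<in> bcont_nonneg"
  note u' = bcont_unit_reparam[OF u]
  show "bounded_clinear (pc.Phi (\<lambda>s. u (1 / s - 1)))"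
    by (rule pc.Phi_clinear[OF u'])
  show "pc.Phi (\<lambda>s. c * u (1 / s - 1)) x = c *\<^sub>C pc.Phi (\<lambda>s. u (1 / s - 1)) x"
    by (rule pc.Phi_scale[OF u'])
  show "cinner (pc.Phi (\<lambda>s. u (1 / s - 1)) x) y = cinner x (pc.Phi (\<lambda>s. cnj (u (1 / s - 1))) y)"
    by (rule pc.Phi_adjoint[OF u'])
  assume v: "v \<in> bcont_nonneg"
  note v' = bcont_unit_reparam[OF v]
  show "pc.Phi (\<lambda>s. u (1 / s - 1) + v (1 / s - 1)) x
      = pc.Phi (\<lambda>s. u (1 / s - 1)) x + pc.Phi (\<lambda>s. v (1 / s - 1)) x"
    by (rule pc.Phi_add[OF u' v'])
  show "pc.Phi (\<lambda>s. u (1 / s - 1) * v (1 / s - 1)) x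
      = pc.Phi (\<lambda>s. u (1 / s - 1)) (pc.Phi (\<lambda>s. v (1 / s - 1)) x)"
    by (rule pc.Phi_mult[OF u' v'])
  assume "\<And>t. t \<ge> 0 \<Longrightarrow> u t = v t"
  then show "pc.Phi (\<lambda>s. u (1 / s - 1)) = pc.Phi (\<lambda>s. v (1 / s - 1))"
    by (intro pc.Phi_cong) (simp add: field_simps)
next
  fix x
  show "pc.Phi (\<lambda>s. complex_of_real (rec (1 / s - 1))) x = R x"
    by (simp add: rec_def pc.Phi_of_real)
qed (simp_all add: clinear R_mem H_R R_shift pc.Phi_one)

lemma is_functional_calculus_Phi:
  "is_functional_calculus D H (\<lambda>u. pc.Phi (\<lambda>s. u (1 / s - 1)))" (is "is_functional_calculus D H ?\<Phi>")
proof -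
  interpret C: calculus D H R ?\<Phi> by (rule calculus_Phi)
  show ?thesis
    unfolding is_functional_calculus_def
  proof (intro conjI ballI allI impI)
    fix z assume "z \<notin> complex_of_real ` {0..}"
    then show "?\<Phi> (\<lambda>t. 1 / (complex_of_real t - z)) = resolvent_op D H z"
      by (rule C.resolvent_off_halfline(1)[symmetric])
  next
    fix u v assume "u \<in> bcont_nonneg" "v \<in> bcont_nonneg" "\<forall>t\<ge>0. u t = v t"
    then show "?\<Phi> u = ?\<Phi> v" by (intro C.Phi_cong) auto
  next
    fix u assume "u \<in> bcont_nonneg"
    then show "bounded_linear (?\<Phi> u)" "\<And>c x. ?\<Phi> u (c *\<^sub>C x) = c *\<^sub>C ?\<Phi> u x"
      using C.Phi_clinear by (auto simp: bounded_clinear_def)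
  qed (rule C.Phi_add C.Phi_scale C.Phi_mult C.Phi_one C.Phi_adjoint; assumption)+
qed

text \<open>Stated for an arbitrary witness, because \<open>fun_calc\<close> uses whichever one the
  choice operator returns.\<close>

lemma calculus_of_functional_calculus:
  assumes "is_functional_calculus D H \<Phi>"
  shows "calculus D H R \<Phi>"
proof
  have "- 1 \<notin> complex_of_real ` {0..}"
  proof
    assume "- 1 \<in> complex_of_real ` {0..}"
    then obtain t where "t \<ge> 0" "- 1 = complex_of_real t" by auto
    then show False by (metis Re_complex_of_real uminus_complex.sel(1) one_complex.sel(1) neg_0_le_iff_le not_one_le_zero)
  qed
  moreover have "z \<notin> complex_of_real ` {0..} \<Longrightarrow> \<Phi> (\<lambda>t. 1 / (complex_of_real t - z)) = resolvent_op D H z" for z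
    using assms unfolding is_functional_calculus_def by blast
  ultimately have "\<Phi> (\<lambda>t. 1 / (complex_of_real t - (- 1))) = resolvent_op D H (- 1)"
    by blast
  then show "\<Phi> (\<lambda>t. complex_of_real (rec t)) x = R x" for x
    by (simp add: rec_def R_def)
next
  fix u v :: "real \<Rightarrow> complex" and x y :: 'h and c
  note fc = assms[unfolded is_functional_calculus_def]
  show "\<Phi> (\<lambda>t. 1) x = x"
    using fc by blast
  assume u: "u \<in> bcont_nonneg"
  show "bounded_clinear (\<Phi> u)"
    using fc u unfolding bounded_clinear_def by blast
  show "\<Phi> (\<lambda>t. c * u t) x = c *\<^sub>C \<Phi> u x"
    using fc u by blast
  show "cinner (\<Phi> u x) y = cinner x (\<Phi> (\<lambda>t. cnj (u t)) y)"
    using fc u by blast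
  assume v: "v \<in> bcont_nonneg"
  show "\<Phi> (\<lambda>t. u t + v t) x = \<Phi> u x + \<Phi> v x"
    using fc u v by blast
  show "\<Phi> (\<lambda>t. u t * v t) x = \<Phi> u (\<Phi> v x)"
    using fc u v by blast
  assume "\<And>t. t \<ge> 0 \<Longrightarrow> u t = v t"
  then show "\<Phi> u = \<Phi> v"
    using fc u v by blast
qed (simp_all add: clinear R_mem H_R R_shift)

lemma calculus_fun_calc:
  obtains \<Phi> where "calculus D H R \<Phi>" "\<And>u. fun_calc u D H = \<Phi> (\<lambda>t. complex_of_real (u t))"
proof -
  have "is_functional_calculus D H (SOME \<Phi>. is_functional_calculus D H \<Phi>)"
    using is_functional_calculus_Phi by (rule someI[of "is_functional_calculus D H"])
  then show ?thesis
    by (intro that[OF calculus_of_functional_calculus]) (simp_all add: fun_calc_def)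
qed

end

section \<open>The constants and the distance estimate\<close>

lemma positive_INF:
  fixes f :: "real \<Rightarrow> real"
  assumes "continuous_on {a..b} f" "a \<le> b" "\<And>t. t \<in> {a..b} \<Longrightarrow> f t > 0"
  shows "0 < (INF t\<in>{a..b}. f t)" "\<And>t. t \<in> {a..b} \<Longrightarrow> (INF t\<in>{a..b}. f t) \<le> f t"
proof -
  obtain k where k: "k \<in> {a..b}" "\<And>t. t \<in> {a..b} \<Longrightarrow> f k \<le> f t"
    using continuous_attains_inf[OF compact_Icc _ assms(1)] assms(2) by auto
  have "f k \<le> (INF t\<in>{a..b}. f t)" using k(1,2) by (intro cINF_greatest) auto
  then show "0 < (INF t\<in>{a..b}. f t)" using assms(3)[OF k(1)] by simp
  show "(INF t\<in>{a..b}. f t) \<le> f t" if "t \<in> {a..b}" for t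
    by (rule cINF_lower[OF _ that]) (use k(2) in \<open>auto intro: bdd_belowI[where m = "f k"]\<close>)
qed

locale weights =
  fixes f g :: "real \<Rightarrow> real" and lam :: real
  assumes f_bcont: "f \<in> bcont_real" and f_pos: "\<And>t. t \<ge> 0 \<Longrightarrow> f t > 0"
    and g_bcont: "g \<in> bcont_real" and g_pos: "\<And>t. t \<ge> 0 \<Longrightarrow> g t > 0"
    and g_tail: "\<exists>c>0. \<forall>t\<ge>lam + 1. g t * (t - lam) \<ge> c"
    and lam: "lam \<ge> 0"
begin

lemma bdd_above_weight:
  assumes "u \<in> bcont_real" "T \<subseteq> {0..}"
  shows "bdd_above (u ` T)"
proof -
  have "bounded (u ` T)"
    using assms by (auto simp: bcont_real_def intro: bounded_subset[OF _ image_mono])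
  then show ?thesis by (rule bounded_imp_bdd_above)
qed

lemma f_le_c0: "t \<ge> 0 \<Longrightarrow> f t \<le> c0 f g"
  unfolding c0_def by (intro max.coboundedI1 cSUP_upper bdd_above_weight f_bcont) auto

lemma g_le_c0: "t \<ge> 0 \<Longrightarrow> g t \<le> c0 f g"
  unfolding c0_def by (intro max.coboundedI2 cSUP_upper bdd_above_weight g_bcont) auto

lemma c1_pos: "c1 f lam > 0"
  and c1_le: "0 \<le> t \<Longrightarrow> t \<le> lam \<Longrightarrow> c1 f lam \<le> f t"
proof -
  have "continuous_on {0..lam} f"
    using f_bcont by (auto simp: bcont_real_def intro: continuous_on_subset)
  note INF = positive_INF[OF this lam f_pos]
  show "c1 f lam > 0" unfolding c1_def by (rule INF(1)) auto
  show "c1 f lam \<le> f t" if "0 \<le> t" "t \<le> lam"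
    unfolding c1_def by (rule INF(2)) (use that in auto)
qed

lemma c2_pos: "c2 g lam > 0"
  and c2_le_near: "lam \<le> t \<Longrightarrow> t \<le> lam + 1 \<Longrightarrow> c2 g lam \<le> g t"
  and c2_le_far: "lam + 1 \<le> t \<Longrightarrow> c2 g lam \<le> g t * (t - lam)"
proof -
  have "continuous_on {lam..lam + 1} g"
    using g_bcont lam by (auto simp: bcont_real_def intro: continuous_on_subset)
  note INF = positive_INF[OF this _ g_pos]
  obtain c where c: "c > 0" "\<And>t. t \<ge> lam + 1 \<Longrightarrow> c \<le> g t * (t - lam)"
    using g_tail by blast
  have "c \<le> (INF t\<in>{lam + 1..}. g t * (t - lam))"
    by (rule cINF_greatest) (use c in auto)
  moreover have "0 < (INF t\<in>{lam..lam + 1}. g t)"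
    by (rule INF(1)) (use lam in auto)
  ultimately show "c2 g lam > 0" using c(1) by (simp add: c2_def)
  show "c2 g lam \<le> g t" if "lam \<le> t" "t \<le> lam + 1"
    unfolding c2_def by (intro min.coboundedI1 INF(2)) (use that lam in auto)
  show "c2 g lam \<le> g t * (t - lam)" if "lam + 1 \<le> t"
    unfolding c2_def
    by (intro min.coboundedI2 cINF_lower) (use that c in \<open>auto intro!: bdd_belowI[where m = c]\<close>)
qed

text \<open>Up to \<open>lam + 1\<close> the first infimum in \<open>c2\<close> bounds
  \<open>g\<close> and the distance contributes \<open>d\<close>; beyond it the second infimum gives
  \<open>c2\<close> itself, which dominates \<open>c2 d\<close> because
  \<open>d \<le> 1\<close>.\<close>

lemma c2_mult_le:
  assumes "0 < d" "d \<le> 1" "t \<ge> lam + d"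
  shows "c2 g lam * d \<le> g t * (t - lam)"
proof (cases "t \<le> lam + 1")
  case True
  then show ?thesis
    using assms c2_pos lam by (intro mult_mono c2_le_near) (auto intro: less_imp_le[OF g_pos])
next
  case False
  have "c2 g lam * d \<le> c2 g lam" using assms(1,2) c2_pos by (simp add: mult_left_le)
  then show ?thesis using c2_le_far[of t] False by simp
qed

lemma c3_nonneg: "c3 g lam \<ge> 0"
  and c3_le: "t \<ge> 0 \<Longrightarrow> - c3 g lam \<le> g t * (t - lam)"
proof -
  have G: "g t \<le> (SUP t\<in>{0..lam}. g t)" if "t \<in> {0..lam}" for t
    by (intro cSUP_upper bdd_above_weight g_bcont that) auto
  have "0 \<le> (SUP t\<in>{0..lam}. g t)"
    using G[of 0] g_pos[of 0] lam by simp
  then show c3: "c3 g lam \<ge> 0" using lam by (simp add: c3_def)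
  show "- c3 g lam \<le> g t * (t - lam)" if t: "t \<ge> 0"
  proof (cases "t \<le> lam")
    case True
    then have "(lam - t) * g t \<le> c3 g lam"
      unfolding c3_def using t G[of t] less_imp_le[OF g_pos[OF t]] by (intro mult_mono) auto
    then show ?thesis by (simp add: algebra_simps)
  next
    case False
    then have "0 \<le> g t * (t - lam)" using g_pos[OF t] by simp
    then show ?thesis using c3 by linarith
  qed
qed

lemma form_nonneg:
  assumes "A \<ge> 0" "t \<ge> 0"
  shows "0 \<le> A * (f t * (t - lam)\<^sup>2)"
  using assms f_pos[OF assms(2)] by simp

text \<open>The value of \<open>\<delta>\<close> at which \<open>dist_bound\<close> equals
  1.\<close>

definition \<delta>0 :: real where
  "\<delta>0 = (if lam > 0 then c1 f lam * c2 g lam / (c1 f lam + c2 g lam + c3 g lam) else c2 g lam)"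

lemma \<delta>0_pos: "\<delta>0 > 0"
  using c1_pos c2_pos c3_nonneg by (simp add: \<delta>0_def)

text \<open>The weights \<open>A\<close> and \<open>B\<close> are the ones for which \<open>A f(t) (t - lam)\<^sup>2 + B g(t) (t - lam) \<ge> 1\<close> off the
  interval of radius \<open>d\<close>: the second term handles the right side, and the first one handles the left
  side together with the loss \<open>B c3\<close> of the second.\<close>

lemma weights_choice:
  assumes \<delta>: "\<delta> > 0" and d: "dist_bound f g lam \<delta> < d" "d \<le> 1"
  obtains A B L where "A \<ge> 0" "B \<ge> 0" "L \<ge> 0" "(A + B) * \<delta> < 1"
    "\<And>t. t \<ge> 0 \<Longrightarrow> \<bar>t - lam\<bar> > d \<Longrightarrow> 1 \<le> A * (f t * (t - lam)\<^sup>2) + B * (g t * (t - lam))"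
    "\<And>t. t \<ge> 0 \<Longrightarrow> - L \<le> A * (f t * (t - lam)\<^sup>2) + B * (g t * (t - lam))"
proof -
  note pos = c1_pos c2_pos c3_nonneg
  have d0: "d > 0"
  proof -
    have "0 \<le> dist_bound f g lam \<delta>"
      using \<delta> pos by (simp add: dist_bound_def)
    then show ?thesis using d(1) by simp
  qed
  define B where "B = 1 / (c2 g lam * d)"
  \<comment> \<open>Chosen so that \<open>A * c1 * d\<^sup>2 = 1 + B * c3\<close>, just as
    \<open>B * c2 * d = 1\<close>. For \<open>lam = 0\<close> no \<open>t \<ge> 0\<close> lies left
    of \<open>lam\<close>, and \<open>A = 0\<close> suffices.\<close>
  define A where "A = (if lam > 0 then (1 + B * c3 g lam) / (c1 f lam * d\<^sup>2) else 0)"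
  have B: "B > 0" using pos d0 by (simp add: B_def)
  have A: "A \<ge> 0" using pos d0 B by (simp add: A_def)
  have sum: "(A + B) * \<delta> < 1"
  proof (cases "lam > 0")
    case True
    define X where "X = (c1 f lam + c2 g lam + c3 g lam) / (c1 f lam * c2 g lam)"
    have X: "X > 0" using pos by (simp add: X_def)
    have "(X * \<delta>) powr (1/3) < d"
      using d(1) True X \<delta> by (simp add: dist_bound_def X_def[symmetric] powr_mult)
    then have "((X * \<delta>) powr (1/3)) powr 3 < d powr 3"
      by (intro powr_less_mono2) auto
    then have X\<delta>: "X * \<delta> < d ^ 3"
      using X \<delta> d0 by (simp add: powr_powr)
    have "A + B = (c2 g lam * d + c3 g lam + c1 f lam * d\<^sup>2) / (c1 f lam * c2 g lam * d ^ 3)"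
      using True pos d0 by (simp add: A_def B_def field_simps power2_eq_square power3_eq_cube)
    \<comment> \<open>Since \<open>d \<le> 1\<close>, the powers of \<open>d\<close> in the
      numerator may be replaced by 1; what remains is \<open>X / d ^ 3\<close>, matching
      \<open>X * \<delta> < d ^ 3\<close>, the cubed form of the hypothesis on
      \<open>d\<close>.\<close>
    also have "\<dots> \<le> (c1 f lam + c2 g lam + c3 g lam) / (c1 f lam * c2 g lam * d ^ 3)"
    proof (rule divide_right_mono)
      have "c2 g lam * d \<le> c2 g lam" "c1 f lam * d\<^sup>2 \<le> c1 f lam"
        using d0 d(2) pos by (auto simp: mult_left_le power_le_one)
      then show "c2 g lam * d + c3 g lam + c1 f lam * d\<^sup>2 \<le> c1 f lam + c2 g lam + c3 g lam" by simp
    qed (use pos d0 in simp)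
    also have "\<dots> = X / d ^ 3" by (simp add: X_def)
    finally have "(A + B) * \<delta> \<le> X / d ^ 3 * \<delta>" using \<delta> by (intro mult_right_mono) auto
    also have "\<dots> < 1" using X\<delta> d0 by (simp add: divide_less_eq)
    finally show ?thesis .
  next
    case False
    then show ?thesis
      using d(1) pos d0 by (simp add: A_def B_def dist_bound_def field_simps)
  qed
  have far: "1 \<le> A * (f t * (t - lam)\<^sup>2) + B * (g t * (t - lam))" if t: "t \<ge> 0" "\<bar>t - lam\<bar> > d" for t
  proof (cases "t \<ge> lam")
    case True
    then have "c2 g lam * d \<le> g t * (t - lam)" using t d0 d(2) by (intro c2_mult_le) auto
    then have "B * (c2 g lam * d) \<le> B * (g t * (t - lam))" using B by (intro mult_left_mono) auto
    moreover have "B * (c2 g lam * d) = 1" using pos d0 by (simp add: B_def)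
    ultimately show ?thesis using form_nonneg[OF A t(1)] by linarith
  next
    case False
    then have l: "lam > 0" using t by simp
    have "d\<^sup>2 \<le> (t - lam)\<^sup>2"
      using t(2) d0 by (metis abs_le_square_iff abs_of_pos less_imp_le)
    then have "c1 f lam * d\<^sup>2 \<le> f t * (t - lam)\<^sup>2"
      using False t pos f_pos[OF t(1)] by (intro mult_mono c1_le) auto
    then have "A * (c1 f lam * d\<^sup>2) \<le> A * (f t * (t - lam)\<^sup>2)" using A by (rule mult_left_mono)
    moreover have "A * (c1 f lam * d\<^sup>2) = 1 + B * c3 g lam" using pos d0 l by (simp add: A_def)
    moreover have "B * - c3 g lam \<le> B * (g t * (t - lam))"
      using B by (intro mult_left_mono c3_le t) auto
    ultimately show ?thesis by simp
  qed
  have near: "- (B * c3 g lam) \<le> A * (f t * (t - lam)\<^sup>2) + B * (g t * (t - lam))" if t: "t \<ge> 0" for t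
  proof -
    have "B * - c3 g lam \<le> B * (g t * (t - lam))"
      using B by (intro mult_left_mono c3_le t) auto
    then show ?thesis using form_nonneg[OF A t] by simp
  qed
  show ?thesis
    by (rule that[of A B "B * c3 g lam"]) (use A B sum far near pos in simp_all)
qed

lemma dist_bound_less_one:
  assumes "0 < \<delta>" "\<delta> < \<delta>0"
  shows "dist_bound f g lam \<delta> < 1"
proof (cases "lam > 0")
  case True
  define X where "X = (c1 f lam + c2 g lam + c3 g lam) / (c1 f lam * c2 g lam)"
  have X: "X > 0" using c1_pos c2_pos c3_nonneg by (simp add: X_def)
  have "X * \<delta> < X * \<delta>0" using X assms(2) by simp
  also have "X * \<delta>0 = 1"
    using True c1_pos c2_pos c3_nonneg by (simp add: X_def \<delta>0_def add_pos_nonneg)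
  finally have "(X * \<delta>) powr (1/3) < 1 powr (1/3)"
    using X assms(1) by (intro powr_less_mono2) auto
  then show ?thesis
    using True X assms(1) by (simp add: dist_bound_def X_def[symmetric] powr_mult)
next
  case False
  then show ?thesis using assms c2_pos by (simp add: dist_bound_def \<delta>0_def)
qed

end

lemma edist_set_lessE:
  assumes "edist_set z X < ereal r"
  obtains s where "s \<in> X" "dist z s < r"
  using assms unfolding edist_set_def INF_less_iff by auto

text \<open>If the bound fails, a real \<open>d\<close> fits strictly between \<open>b\<close> and
  the minimum of the distance and 1. The cap at 1 yields \<open>d \<le> 1\<close> and also handles
  an empty \<open>X\<close>, whose distance is infinite.\<close>

lemma edist_set_leI:
  assumes "b < 1" "\<And>d. b < d \<Longrightarrow> d \<le> 1 \<Longrightarrow> (\<And>s. s \<in> X \<Longrightarrow> d < dist z s) \<Longrightarrow> False"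
  shows "edist_set z X \<le> ereal b"
proof (rule ccontr)
  assume "\<not> ?thesis"
  then have "ereal b < min (edist_set z X) 1" using assms(1) by simp
  then obtain d where d: "ereal b < ereal d" "ereal d < min (edist_set z X) 1"
    using ereal_dense2 by blast
  have "d < dist z s" if "s \<in> X" for s
  proof -
    have "ereal d < edist_set z X" using d(2) by simp
    also have "\<dots> \<le> ereal (dist z s)" unfolding edist_set_def by (rule INF_lower[OF that])
    finally show ?thesis by simp
  qed
  then show False using assms(2)[of d] d by (simp add: one_ereal_def)
qed

locale weighted_calculus = weights f g lam + calculus D H R \<Phi>
  for f g lam and D :: "'h::complex_hilbert set" and H R \<Phi> +
  assumes fun_calc: "\<And>u. fun_calc u D H = \<Phi> (\<lambda>t. complex_of_real (u t))"
begin

text \<open>Both \<open>f(H)\<close> and \<open>g(H)\<close> are bounded by \<open>c0\<close>. The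
  g-form is thus at most \<open>c0 * (\<delta> / c0)\<close>, and the f-form at most
  \<open>\<delta> * (\<delta> / c0)\<close>, where \<open>\<delta> < c0\<close> enters.\<close>

lemma approx_seqI:
  assumes \<delta>: "0 < \<delta>" "\<delta> < c0 f g"
    and \<psi>: "\<And>j. \<psi> j \<in> D" "\<And>j. norm (\<psi> j) = 1" "\<And>j. norm (H (\<psi> j) - lam *\<^sub>R \<psi> j) \<le> \<delta> / c0 f g"
  shows "approx_seq D H f g lam \<delta> \<psi>"
proof -
  define c where "c = c0 f g"
  have c: "c > 0" "\<delta> < c" using \<delta> by (auto simp: c_def)
  have norm_le: "norm (F u x) \<le> c * norm x" if "u = f \<or> u = g" for u x
    using that f_pos g_pos f_le_c0 g_le_c0 f_bcont g_bcont
    by (intro norm_F_le) (auto simp: c_def abs_of_pos)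
  have "cmod (cinner (F f (H (\<psi> j) - lam *\<^sub>R \<psi> j)) (H (\<psi> j) - lam *\<^sub>R \<psi> j)) \<le> \<delta>"
    "cmod (cinner (F g (\<psi> j)) (H (\<psi> j) - lam *\<^sub>R \<psi> j)) \<le> \<delta>" for j
  proof -
    let ?u = "H (\<psi> j) - lam *\<^sub>R \<psi> j"
    have u: "norm ?u \<le> \<delta> / c" using \<psi>(3) by (simp add: c_def)
    have "cmod (cinner (F f ?u) ?u) \<le> (c * norm ?u) * norm ?u"
      by (rule order_trans[OF norm_cinner_le]) (intro mult_right_mono norm_le; simp)
    also have "\<dots> \<le> (c * (\<delta> / c)) * (\<delta> / c)"
      using u c \<delta> by (intro mult_mono) auto
    also have "\<dots> = \<delta> * (\<delta> / c)" using c by simp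
    also have "\<dots> \<le> \<delta>" using c \<delta> by (intro mult_left_le) (auto simp: divide_le_eq)
    finally show "cmod (cinner (F f ?u) ?u) \<le> \<delta>" .
    have "cmod (cinner (F g (\<psi> j)) ?u) \<le> (c * norm (\<psi> j)) * norm ?u"
      by (rule order_trans[OF norm_cinner_le]) (intro mult_right_mono norm_le; simp)
    also have "\<dots> = c * norm ?u" by (simp add: \<psi>(2))
    also have "\<dots> \<le> c * (\<delta> / c)" using u c by (intro mult_left_mono) auto
    finally show "cmod (cinner (F g (\<psi> j)) ?u) \<le> \<delta>" using c by simp
  qed
  then show ?thesis
    using \<psi>(1,2) by (simp add: approx_seq_def fun_calc F_def)
qed

lemma spectrum_imp_approx_seq:
  assumes \<delta>: "0 < \<delta>" "\<delta> < c0 f g"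
    and dist: "edist_set (complex_of_real lam) (spectrum_op D H) < ereal (\<delta> / c0 f g)"
  shows "\<exists>\<psi>. approx_seq D H f g lam \<delta> \<psi>"
proof -
  obtain s where s: "s \<in> spectrum_op D H" "dist (complex_of_real lam) s < \<delta> / c0 f g"
    using edist_set_lessE[OF dist] by blast
  from spectrum_real[OF s(1)] obtain \<mu> where \<mu>: "s = of_real \<mu>" by blast
  \<comment> \<open>The slack in the strict distance hypothesis serves as bump radius: the error
    \<open>\<epsilon>\<close> at \<open>\<mu>\<close> plus the shift from \<open>\<mu>\<close> to
    \<open>lam\<close> is exactly \<open>\<delta> / c0\<close>.\<close>
  define \<epsilon> where "\<epsilon> = \<delta> / c0 f g - \<bar>\<mu> - lam\<bar>"
  have e: "\<epsilon> > 0" using s(2) by (simp add: \<epsilon>_def \<mu> dist_of_real dist_real_def abs_minus_commute)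
  obtain y where y: "norm (F (bump \<mu> \<epsilon>) y) = 1"
    using spectrum_approx[OF _ e] s(1) \<mu> by blast
  let ?x = "F (bump \<mu> \<epsilon>) y"
  have "norm (H ?x - lam *\<^sub>R ?x) \<le> \<epsilon> + \<bar>\<mu> - lam\<bar>"
    using shift_norm_le[of ?x lam \<mu>] bump_approx(2)[OF e, of \<mu> y] by (simp add: y)
  also have "\<dots> = \<delta> / c0 f g" by (simp add: \<epsilon>_def)
  finally have "norm (H ?x - lam *\<^sub>R ?x) \<le> \<delta> / c0 f g" .
  then have "approx_seq D H f g lam \<delta> (\<lambda>_. ?x)"
    by (intro approx_seqI \<delta> y bump_approx e)
  then show ?thesis by blast
qed

lemma ess_spectrum_imp_approx_seq:
  assumes \<delta>: "0 < \<delta>" "\<delta> < c0 f g"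
    and dist: "edist_set (complex_of_real lam) (ess_spectrum_op D H) < ereal (\<delta> / c0 f g)"
  shows "\<exists>\<psi>. approx_seq D H f g lam \<delta> \<psi> \<and> weakly_null \<psi>"
proof -
  obtain s where s: "s \<in> ess_spectrum_op D H" "dist (complex_of_real lam) s < \<delta> / c0 f g"
    using edist_set_lessE[OF dist] by blast
  obtain \<mu> where \<mu>: "s = of_real \<mu>"
    using spectrum_real s(1) by (auto simp: ess_spectrum_op_def)
  define \<epsilon> where "\<epsilon> = \<delta> / c0 f g - \<bar>\<mu> - lam\<bar>"
  have e: "\<epsilon> > 0" using s(2) by (simp add: \<epsilon>_def \<mu> dist_of_real dist_real_def abs_minus_commute)
  obtain \<psi> where \<psi>: "\<And>j. \<psi> j \<in> D" "\<And>j. norm (\<psi> j) = 1" "\<And>j. norm (H (\<psi> j) - \<mu> *\<^sub>R \<psi> j) \<le> \<epsilon>"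
    "weakly_null \<psi>"
    using ess_spectrum_sequence[OF _ e] s(1) \<mu> by blast
  have "norm (H (\<psi> j) - lam *\<^sub>R \<psi> j) \<le> \<delta> / c0 f g" for j
    using shift_norm_le[of "\<psi> j" lam \<mu>] \<psi>(2,3)[of j] by (simp add: \<epsilon>_def)
  then have "approx_seq D H f g lam \<delta> \<psi>"
    by (intro approx_seqI \<delta> \<psi>)
  then show ?thesis using \<psi>(4) by blast
qed

text \<open>\<open>X\<close> stands for the spectrum or the essential spectrum; the two cases differ
  only in why bumps off \<open>X\<close> vanish along \<open>\<psi>\<close>. If \<open>X\<close> is
  farther than \<open>d\<close> from \<open>lam\<close>, such bumps cover the interval of radius
  \<open>d\<close>, contradicting \<open>(A + B) * \<delta> < 1\<close>.\<close>

lemma approx_seq_imp_dist_le: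
  assumes \<delta>: "0 < \<delta>" "\<delta> < \<delta>0" and \<psi>: "approx_seq D H f g lam \<delta> \<psi>"
    and bumps: "\<And>t. complex_of_real t \<notin> X \<Longrightarrow> \<exists>\<epsilon>>0. bump t \<epsilon> \<in> null \<psi>"
  shows "edist_set (complex_of_real lam) X \<le> ereal (dist_bound f g lam \<delta>)"
proof (rule edist_set_leI[OF dist_bound_less_one[OF \<delta>]])
  fix d assume d: "dist_bound f g lam \<delta> < d" "d \<le> 1" "\<And>s. s \<in> X \<Longrightarrow> d < dist (complex_of_real lam) s"
  obtain A B L where AB: "A \<ge> 0" "B \<ge> 0" "L \<ge> 0" "(A + B) * \<delta> < 1"
    "\<And>t. t \<ge> 0 \<Longrightarrow> \<bar>t - lam\<bar> > d \<Longrightarrow> 1 \<le> A * (f t * (t - lam)\<^sup>2) + B * (g t * (t - lam))"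
    "\<And>t. t \<ge> 0 \<Longrightarrow> - L \<le> A * (f t * (t - lam)\<^sup>2) + B * (g t * (t - lam))"
    using weights_choice[OF \<delta>(1) d(1,2)] by metis
  have "\<exists>\<epsilon>>0. bump t \<epsilon> \<in> null \<psi>" if "\<bar>t - lam\<bar> \<le> d" for t
  proof (rule bumps)
    show "complex_of_real t \<notin> X"
      using d(3)[of "of_real t"] that by (auto simp: dist_of_real dist_real_def abs_minus_commute)
  qed
  then have "1 \<le> (A + B) * \<delta>"
    using \<psi> by (intro approx_seq_bound[OF f_bcont g_bcont _ _ _ _ AB(1-3) _ AB(5,6)])
      (auto simp: approx_seq_def fun_calc F_def)
  then show False using AB(4) by simp
qed

end

theorem theorem2p2:
  fixes f g :: "real \<Rightarrow> real" and lam :: real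
  assumes "continuous_on {0..} f" and "bounded (f ` {0..})" and "\<And>t. t \<ge> 0 \<Longrightarrow> f t > 0"
    and "continuous_on {0..} g" and "bounded (g ` {0..})" and "\<And>t. t \<ge> 0 \<Longrightarrow> g t > 0"
    and "\<And>l::real. l \<ge> 0 \<Longrightarrow> \<exists>c>0. \<forall>t\<ge>l + 1. g t * (t - l) \<ge> c"
    and "lam \<ge> 0"
  shows "\<exists>\<delta>0>0. \<forall>(D :: 'h::complex_hilbert set) (H :: 'h \<Rightarrow> 'h) (\<delta>::real).
    densely_defined D \<and> self_adjoint_op D H \<and> nonneg_op D H \<and> 0 < \<delta> \<and> \<delta> < c0 f g \<longrightarrow>
      (edist_set (complex_of_real lam) (spectrum_op D H) < ereal (\<delta> / c0 f g) \<longrightarrow>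
         (\<exists>\<psi>. approx_seq D H f g lam \<delta> \<psi>)) \<and>
      (edist_set (complex_of_real lam) (ess_spectrum_op D H) < ereal (\<delta> / c0 f g) \<longrightarrow>
         (\<exists>\<psi>. approx_seq D H f g lam \<delta> \<psi> \<and> weakly_null \<psi>)) \<and>
      (\<delta> < \<delta>0 \<longrightarrow>
         (\<forall>\<psi>. approx_seq D H f g lam \<delta> \<psi> \<longrightarrow>
            edist_set (complex_of_real lam) (spectrum_op D H) \<le> ereal (dist_bound f g lam \<delta>)) \<and>
         (\<forall>\<psi>. approx_seq D H f g lam \<delta> \<psi> \<and> weakly_null \<psi> \<longrightarrow>
            edist_set (complex_of_real lam) (ess_spectrum_op D H) \<le> ereal (dist_bound f g lam \<delta>)))"
proof -
  have w: "weights f g lam"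
    using assms by unfold_locales (auto simp: bcont_real_def)
  show ?thesis
  proof (intro exI[of _ "weights.\<delta>0 f g lam"] conjI[OF weights.\<delta>0_pos[OF w]] allI impI, elim conjE)
    fix D :: "'h set" and H :: "'h \<Rightarrow> 'h" and \<delta> :: real
    assume "self_adjoint_op D H" "nonneg_op D H" and \<delta>: "0 < \<delta>" "\<delta> < c0 f g"
    then have "nonneg_self_adjoint D H" by unfold_locales
    then interpret H: nonneg_self_adjoint D H .
    obtain \<Phi> where "calculus D H H.R \<Phi>" "\<And>u. fun_calc u D H = \<Phi> (\<lambda>t. complex_of_real (u t))"
      using H.calculus_fun_calc by blast
    with w interpret weighted_calculus f g lam D H H.R \<Phi>
      by (simp add: weighted_calculus_def weighted_calculus_axioms_def)
    \<comment> \<open>A point off the essential spectrum is either off the spectrum, where some bump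
      is annihilated outright, or a discrete eigenvalue, where weak convergence is used.\<close>
    have "\<exists>\<epsilon>>0. bump t \<epsilon> \<in> null \<psi>" if "weakly_null \<psi>" "complex_of_real t \<notin> ess_spectrum_op D H" for t \<psi>
      using null_off_spectrum null_discrete that by (auto simp: ess_spectrum_op_def)
    then show "(edist_set (complex_of_real lam) (spectrum_op D H) < ereal (\<delta> / c0 f g) \<longrightarrow>
         (\<exists>\<psi>. approx_seq D H f g lam \<delta> \<psi>)) \<and>
      (edist_set (complex_of_real lam) (ess_spectrum_op D H) < ereal (\<delta> / c0 f g) \<longrightarrow>
         (\<exists>\<psi>. approx_seq D H f g lam \<delta> \<psi> \<and> weakly_null \<psi>)) \<and>
      (\<delta> < weights.\<delta>0 f g lam \<longrightarrow>
         (\<forall>\<psi>. approx_seq D H f g lam \<delta> \<psi> \<longrightarrow>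
            edist_set (complex_of_real lam) (spectrum_op D H) \<le> ereal (dist_bound f g lam \<delta>)) \<and>
         (\<forall>\<psi>. approx_seq D H f g lam \<delta> \<psi> \<and> weakly_null \<psi> \<longrightarrow>
            edist_set (complex_of_real lam) (ess_spectrum_op D H) \<le> ereal (dist_bound f g lam \<delta>)))"
      using spectrum_imp_approx_seq[OF \<delta>] ess_spectrum_imp_approx_seq[OF \<delta>]
        approx_seq_imp_dist_le[OF \<delta>(1)] null_off_spectrum
      by blast
  qed
qed

end
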